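(* Let $q$ be a fixed prime power. Then, as $n\to\infty$, $$EX_n=\tfrac32\log(n)+O(1),$$ where the expectation is taken over a uniformly random element of the group $U(n,q)$.
   Context: $U(n,q)$ is the subgroup of $GL(n,q^2)$ preserving a non-degenerate skew-linear form, e.g. $\langle\vec x,\vec y\rangle=\sum_{i=1}^nx_iy_i^q$ on $F_{q^2}^n$. For $\alpha\in U(n,q)$, $X_n(\alpha)$ is the number of irreducible polynomials counted with multiplicity occurring in the rational canonical form of $\alpha$ over $F_{q^2}$; that is, $X_n(\alpha)=\sum_\phi|\lambda_\phi(\alpha)|$, the number of irreducible factors over $F_{q^2}$, counted with multiplicity, of the characteristic polynomial $\prod_\phi\phi^{|\lambda_\phi(\alpha)|}$ of $\alpha$. The $O(1)$ constant may depend on $q$. *)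

theory Defs
  imports
    "HOL-Probability.Probability_Mass_Function"
    "HOL-Library.Landau_Symbols"
    "HOL-Number_Theory.Prime_Powers"
    "Jordan_Normal_Form.Char_Poly"
begin

text \<open>
  Throughout, the type \<open>'a\<close> plays the role of the field with \<open>q\<^sup>2\<close> elements, and vectors and
  matrices have their dimension \<open>n\<close> as an explicit parameter.
\<close>

text \<open>The form is linear in the first argument and semilinear, with respect to the order-two
  automorphism \<open>y \<mapsto> y ^ q\<close>, in the second.\<close>

definition skew_form :: "nat \<Rightarrow> nat \<Rightarrow> 'a :: field vec \<Rightarrow> 'a vec \<Rightarrow> 'a" where
  "skew_form n q x y = (\<Sum>i<n. x $ i * (y $ i) ^ q)"

definition unitary_group :: "nat \<Rightarrow> nat \<Rightarrow> 'a :: field mat set" where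
  "unitary_group n q = {A \<in> carrier_mat n n. invertible_mat A \<and>
     (\<forall>x \<in> carrier_vec n. \<forall>y \<in> carrier_vec n.
        skew_form n q (A *\<^sub>v x) (A *\<^sub>v y) = skew_form n q x y)}"

text \<open>
  The library's \<open>multiplicity\<close> is unavailable for polynomials over an arbitrary \<open>field\<close>, as it
  asks for a normalization structure on the coefficients. The set below is finite, so that
  \<open>Max\<close> is meaningful, whenever \<open>p\<close> is nonzero and \<open>\<phi>\<close> is nonconstant.
\<close>

definition poly_multiplicity :: "'a :: field poly \<Rightarrow> 'a poly \<Rightarrow> nat" where
  "poly_multiplicity \<phi> p = Max {k. \<phi> ^ k dvd p}"

text \<open>
  For a monic irreducible \<open>\<phi>\<close>, the multiplicity of \<open>\<phi>\<close> in the characteristic polynomial of \<open>A\<close>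
  is the size of the partition attached to \<open>\<phi>\<close> in the rational canonical form of \<open>A\<close>.
  Requiring \<open>\<phi>\<close> to be monic selects one representative of each class of associates.
\<close>

definition num_irred_factors :: "'a :: field mat \<Rightarrow> nat" where
  "num_irred_factors A =
     (\<Sum>\<phi> | monic \<phi> \<and> irreducible \<phi> \<and> \<phi> dvd char_poly A. poly_multiplicity \<phi> (char_poly A))"

end

theory Submission
  imports Defs
begin

unbundle no vec_syntax

text \<open>
  Write \<open>X\<^sub>n = \<Sum>\<^sub>\<phi> \<Sum>\<^sub>k [\<phi>\<^sup>k dvd \<chi>\<^sub>A]\<close>. Counting pairs \<open>(A, v)\<close> with \<open>v\<close> of prescribed minimal polynomial
  \<open>f\<close> under \<open>A\<close>: the Gram matrix of \<open>v, A v, A\<^sup>2 v, \<dots>\<close> is a Hermitian sequence satisfying the linear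
  recurrences of \<open>f\<close> and of its conjugate reciprocal \<open>f\<^sup>*\<close>, so there are at most \<open>q ^ degree f\<close> of them,
  and only the zero sequence if \<open>f\<close> and \<open>f\<^sup>*\<close> are coprime; by Witt's theorem each Gram matrix accounts
  for at most \<open>|U(n,q)|\<close> pairs. As \<open>\<phi>\<^sup>k dvd \<chi>\<^sub>A\<close> makes the kernel of \<open>\<phi>\<^sup>k(A)\<close> large, Markov's inequality bounds the
  expected multiplicity of \<open>\<phi>\<close> by \<open>w + 10 w\<^sup>2\<close>, where \<open>w = q\<^sup>-\<^sup>d\<close> if \<open>\<phi>\<close> of degree \<open>d\<close> divides \<open>\<phi>\<^sup>*\<close>, and
  \<open>w = q\<^sup>-\<^sup>2\<^sup>d\<close> otherwise, in which case \<open>2 d \<le> n\<close> is forced.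

  No lower bounds on probabilities are needed: the degree-weighted expected multiplicities add up to
  exactly \<open>n\<close>, while counting polynomials \<open>f\<close> with \<open>f\<^sup>*\<close> proportional to \<open>f\<close> shows that the degree-weighted
  upper bounds add up to at most \<open>n + O(1)\<close>. So the bounds are sharp up to a bounded total error,
  and summation by parts turns the degree-weighted sums \<open>n/2 + O(1)\<close> (self-dual \<open>\<phi>\<close>) and \<open>m + O(1)\<close>
  (the other \<open>\<phi>\<close> of degree at most \<open>m = n div 2\<close>) into \<open>1/2 ln n + O(1)\<close> and \<open>ln n + O(1)\<close>.
\<close>

section \<open>Finite fields of square order\<close>

text \<open>The exponents in \<open>w\<close> compare two counts. If \<phi> of degree
  \<open>d\<close> divides the characteristic polynomial, then \<phi>(A) kills at least
  \<open>q ^ (2 * d) - 1\<close> nonzero vectors, whereas a vector with minimal polynomial \<phi>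
  has at most \<open>q ^ d\<close> Gram sequences if \<phi> is self-dual and a single one otherwise.
  The quotients are \<open>w\<close> up to a relative error of order at most \<open>w\<close>. The
  coefficient 1 of \<open>w\<close> is essential: a larger constant would cost a multiple of
  \<open>ln n\<close>. Errors of order \<open>w\<^sup>2\<close> are harmless, because at most about
  \<open>1 / w\<close> polynomials share a given weight, so that even the degree-weighted sum of
  these errors converges geometrically. The lower bound for the total weight of the self-dual \<phi>
  is taken from the group itself: all \<open>n\<close> degrees of a characteristic polynomial have
  to be accounted for, the share of the other \<phi> is known from counting all irreducible
  polynomials over the field, and what remains belongs to the self-dual ones.\<close>

lemma card_le_fibers:
  assumes "finite A" "\<And>y. y \<in> f ` A \<Longrightarrow> card {x \<in> A. f x = y} \<le> k"
  shows "card A \<le> card (f ` A) * k"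
proof -
  have "A = (\<Union>y\<in>f ` A. {x \<in> A. f x = y})" by auto
  then have "card A = card (\<Union>y\<in>f ` A. {x \<in> A. f x = y})" by simp
  also have "\<dots> \<le> (\<Sum>y\<in>f ` A. card {x \<in> A. f x = y})"
    by (rule card_UN_le) (use assms in auto)
  also have "\<dots> \<le> card (f ` A) * k"
    using assms sum_bounded_above[of "f ` A" "\<lambda>y. card {x \<in> A. f x = y}" k] by simp
  finally show ?thesis .
qed

text \<open>Small fibers force a large image. Trace and norm are shown to be onto in this way, with
  fibers bounded by numbers of roots.\<close>

lemma image_eq_of_fibers:
  assumes "finite A" "finite B" "f ` A \<subseteq> B" "k > 0"
    and "\<And>y. y \<in> f ` A \<Longrightarrow> card {x \<in> A. f x = y} \<le> k"
    and "card B * k \<le> card A"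
  shows "f ` A = B"
proof -
  have "card A \<le> card (f ` A) * k"
    using card_le_fibers[of A f k] assms(1,5) by blast
  then have "card B * k \<le> card (f ` A) * k" using assms(6) by linarith
  then have "card B \<le> card (f ` A)" using assms(4) by simp
  then show ?thesis using assms card_seteq by metis
qed

text \<open>Multiplication by a nonzero \<open>x\<close> permutes the nonzero elements; comparing
  the two products of all of them gives \<open>x ^ (CARD('a) - 1) = 1\<close>.\<close>

lemma finite_field_power_card:
  fixes x :: "'a :: {finite, field}"
  shows "x ^ CARD('a) = x"
proof (cases "x = 0")
  case False
  have "bij_betw (\<lambda>y. x * y) (UNIV - {0}) (UNIV - {0})"
    by (rule bij_betwI[where g = "\<lambda>y. y / x"]) (use False in auto)
  then have "(\<Prod>y\<in>UNIV - {0}. x * y) = \<Prod>(UNIV - {0})"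
    by (rule prod.reindex_bij_betw[where g = "\<lambda>y. y"])
  then have "x ^ (CARD('a) - 1) * \<Prod>(UNIV - {0}) = \<Prod>(UNIV - {0 :: 'a})"
    by (simp add: prod.distrib card_Diff_singleton)
  moreover have "\<Prod>(UNIV - {0 :: 'a}) \<noteq> 0" by simp
  ultimately have "x ^ (CARD('a) - 1) = 1" by simp
  moreover have "CARD('a) = Suc (CARD('a) - 1)"
    using finite_UNIV_card_ge_0[where ?'a = 'a] by simp
  ultimately show ?thesis by (metis mult.right_neutral power_Suc)
next
  case True
  then show ?thesis using finite_UNIV_card_ge_0[where ?'a = 'a] by simp
qed

text \<open>Translation by 1 permutes the field, so comparing the two sums of all elements shows
  that the cardinality vanishes in the field.\<close>

lemma CHAR_dvd_card_field: "CHAR('a :: {finite, field}) dvd CARD('a)"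
proof -
  have "(\<Sum>x\<in>(UNIV :: 'a set). x) = (\<Sum>x\<in>UNIV. x + 1)"
    by (rule sum.reindex_bij_witness[where i = "\<lambda>x. x + 1" and j = "\<lambda>x. x - 1"]) auto
  then have "of_nat CARD('a) = (0 :: 'a)" by (simp add: sum.distrib)
  then show ?thesis by (simp only: of_nat_eq_0_iff_char_dvd)
qed

lemma card_le_roots:
  fixes p :: "'a :: {finite, field} poly"
  assumes "p \<noteq> 0" "\<And>x. x \<in> S \<Longrightarrow> poly p x = 0"
  shows "card S \<le> degree p"
proof -
  have "card S \<le> card {x. poly p x = 0}"
    by (rule card_mono) (use assms in auto)
  also have "\<dots> \<le> degree p" using assms(1) by (rule card_poly_roots_bound)
  finally show ?thesis .
qed

text \<open>The parameter \<open>ty\<close> ties the type variable \<open>'a\<close> to the locale,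
  whose assumptions mention the field only through its cardinality.\<close>

locale unitary_field =
  fixes q :: nat and ty :: "'a :: {finite, field} itself"
  assumes primepow_q: "primepow q" and card_field: "CARD('a) = q ^ 2"
begin

lemma q_ge_2: "q \<ge> 2"
  using primepow_gt_Suc_0[OF primepow_q] by simp

lemma q_pos [simp]: "q > 0"
  using q_ge_2 by simp

lemma frob_frob [simp]: "((x :: 'a) ^ q) ^ q = x"
  using finite_field_power_card[of x] by (simp add: card_field power_mult[symmetric] power2_eq_square)

text \<open>This is what makes \<open>x \<mapsto> x ^ q\<close> additive in
  \<open>frob_add\<close>.\<close>

lemma q_char: "\<exists>k. q = CHAR('a) ^ k"
proof -
  obtain p k where p: "prime p" "q = p ^ k"
    using primepow_q unfolding primepow_def by blast
  have pos: "CHAR('a) > 0" by (rule finite_imp_CHAR_pos) simp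
  have "prime CHAR('a)" using pos by (rule prime_CHAR_semidom)
  moreover have "CHAR('a) dvd p ^ (k * 2)"
    using CHAR_dvd_card_field[where ?'a = 'a] p by (simp add: card_field power_mult)
  ultimately have "CHAR('a) = p"
    using p(1) by (metis prime_dvd_power primes_dvd_imp_eq)
  then show ?thesis using p by auto
qed

lemma prime_char: "prime CHAR('a)"
  by (rule prime_CHAR_semidom, rule finite_imp_CHAR_pos) simp

lemma frob_add: "((x :: 'a) + y) ^ q = x ^ q + y ^ q"
proof -
  obtain k where "q = CHAR('a) ^ k" using q_char by blast
  then show ?thesis using freshmans_dream'[OF prime_char] by blast
qed

lemma frob_0 [simp]: "(0 :: 'a) ^ q = 0"
  using q_pos by simp

lemma frob_minus: "(- (x :: 'a)) ^ q = - (x ^ q)"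
  using frob_add[of x "- x"] by (simp add: eq_neg_iff_add_eq_0 add.commute)

lemma frob_diff: "((x :: 'a) - y) ^ q = x ^ q - y ^ q"
  using frob_add[of x "- y"] by (simp add: frob_minus)

lemma frob_sum: "(\<Sum>i\<in>S. f i :: 'a) ^ q = (\<Sum>i\<in>S. f i ^ q)"
  by (induction S rule: infinite_finite_induct) (auto simp: frob_add)

lemma frob_eq_0_iff [simp]: "(x :: 'a) ^ q = 0 \<longleftrightarrow> x = 0"
  using q_pos by simp

lemma card_fixed: "card {x :: 'a. x ^ q = x} \<le> q"
proof -
  let ?p = "monom 1 q - monom 1 1 :: 'a poly"
  have "coeff ?p q = 1" using q_ge_2 by simp
  then have "?p \<noteq> 0" by (metis coeff_0 zero_neq_one)
  then have "card {x :: 'a. x ^ q = x} \<le> degree ?p"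
    by (rule card_le_roots) (auto simp: poly_monom)
  also have "\<dots> \<le> q"
    using q_ge_2 by (intro degree_diff_le) (auto intro: order_trans[OF degree_monom_le])
  finally show ?thesis .
qed

lemma ex_not_fixed: "\<exists>e :: 'a. e ^ q \<noteq> e"
proof (rule ccontr)
  assume "\<not> ?thesis"
  then have "{x :: 'a. x ^ q = x} = UNIV" by auto
  then have "q ^ 2 \<le> q" using card_fixed card_field by simp
  then show False using q_ge_2 by (simp add: power2_eq_square)
qed

text \<open>Each fiber consists of roots of a polynomial of degree \<open>q\<close>, the target has
  at most \<open>q\<close> elements, and \<open>q * q\<close> is the size of the field. It serves to
  change the norm of a vector by a prescribed amount.\<close>

lemma trace_surj:
  assumes "(s :: 'a) ^ q = s"
  shows "\<exists>t. t + t ^ q = s"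
proof -
  have "(\<lambda>t :: 'a. t + t ^ q) ` UNIV = {x. x ^ q = x}"
  proof (rule image_eq_of_fibers[where k = q])
    fix y :: 'a
    let ?p = "monom 1 q + monom 1 1 - [:y:] :: 'a poly"
    have "coeff ?p q = 1" using q_ge_2 by (simp add: coeff_pCons split: nat.split)
    then have "?p \<noteq> 0" by (metis coeff_0 zero_neq_one)
    then have "card {x :: 'a. x + x ^ q = y} \<le> degree ?p"
      by (rule card_le_roots) (auto simp: poly_monom)
    also have "\<dots> \<le> q"
      using q_ge_2 by (intro degree_diff_le degree_add_le) (auto intro: order_trans[OF degree_monom_le])
    finally show "card {x \<in> UNIV. x + x ^ q = y} \<le> q" by simp
  next
    show "card {x :: 'a. x ^ q = x} * q \<le> CARD('a)"
      using card_fixed card_field by (simp add: power2_eq_square)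
  qed (use q_pos in \<open>auto simp: frob_add add.commute\<close>)
  then show ?thesis using assms by (metis (mono_tags, lifting) imageE mem_Collect_eq)
qed

lemma card_norm_fiber: 
  assumes "(y :: 'a) \<noteq> 0"
  shows "card {x :: 'a. x * x ^ q = y} \<le> q + 1"
proof -
  let ?p = "monom 1 (q + 1) - [:y:] :: 'a poly"
  have "coeff ?p (q + 1) = 1" using q_ge_2 by (simp add: coeff_pCons split: nat.split)
  then have "?p \<noteq> 0" by (metis coeff_0 zero_neq_one)
  then have "card {x :: 'a. x * x ^ q = y} \<le> degree ?p"
    by (rule card_le_roots) (auto simp: poly_monom)
  also have "\<dots> \<le> q + 1"
    by (intro degree_diff_le) (auto intro: order_trans[OF degree_monom_le])
  finally show ?thesis .
qed

text \<open>The same count on nonzero elements: fibers of size at most \<open>q + 1\<close>, a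
  target of size at most \<open>q - 1\<close>, and \<open>(q - 1) * (q + 1) = q ^ 2 - 1\<close>. It
  serves to scale a vector to norm 1.\<close>

lemma norm_surj:
  assumes "(s :: 'a) ^ q = s" "s \<noteq> 0"
  shows "\<exists>t. t * t ^ q = s"
proof -
  have "(\<lambda>t :: 'a. t * t ^ q) ` (UNIV - {0}) = {x. x ^ q = x} - {0}"
  proof (rule image_eq_of_fibers[where k = "q + 1"])
    fix y :: 'a assume "y \<in> (\<lambda>t :: 'a. t * t ^ q) ` (UNIV - {0})"
    then have "y \<noteq> 0" by auto
    have "card {x \<in> UNIV - {0}. x * x ^ q = y} \<le> card {x :: 'a. x * x ^ q = y}"
      by (rule card_mono) auto
    also have "\<dots> \<le> q + 1" using card_norm_fiber[OF \<open>y \<noteq> 0\<close>] .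
    finally show "card {x \<in> UNIV - {0}. x * x ^ q = y} \<le> q + 1" .
  next
    have "card ({x :: 'a. x ^ q = x} - {0}) \<le> q - 1"
      using card_fixed by (subst card_Diff_singleton) auto
    then have "card ({x :: 'a. x ^ q = x} - {0}) * (q + 1) \<le> (q - 1) * (q + 1)"
      by (rule mult_right_mono) simp
    also have "\<dots> = q ^ 2 - 1" by (simp add: power2_eq_square algebra_simps)
    finally show "card ({x :: 'a. x ^ q = x} - {0}) * (q + 1) \<le> card (UNIV - {0 :: 'a})"
      by (simp add: card_field card_Diff_singleton)
  qed (auto simp: power_mult_distrib mult.commute)
  then show ?thesis using assms by (metis (mono_tags, lifting) imageE mem_Collect_eq DiffI singletonD)
qed

text \<open>Every element of \<open>V\<close> is uniquely \<open>x + e y\<close> with \<open>x, y\<close> fixed by \<open>\<tau>\<close>, for any \<open>e\<close> with \<open>e\<^sup>q \<noteq> e\<close>.\<close>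

lemma real_form_card:
  fixes V :: "('i \<Rightarrow> 'a) set" and \<tau> :: "('i \<Rightarrow> 'a) \<Rightarrow> 'i \<Rightarrow> 'a"
  assumes fin: "finite V"
    and lin: "\<And>a b x y. x \<in> V \<Longrightarrow> y \<in> V \<Longrightarrow> (\<lambda>i. a * x i + b * y i) \<in> V"
    and tau: "\<And>x. x \<in> V \<Longrightarrow> \<tau> x \<in> V" "\<And>x. x \<in> V \<Longrightarrow> \<tau> (\<tau> x) = x"
    and semi: "\<And>a b x y. x \<in> V \<Longrightarrow> y \<in> V \<Longrightarrow>
        \<tau> (\<lambda>i. a * x i + b * y i) = (\<lambda>i. a ^ q * \<tau> x i + b ^ q * \<tau> y i)"
  shows "card {x \<in> V. \<tau> x = x} ^ 2 = card V"
proof -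
  obtain e :: 'a where e: "e ^ q \<noteq> e" using ex_not_fixed by blast
  let ?H = "{x \<in> V. \<tau> x = x}"
  let ?f = "\<lambda>(x, y). (\<lambda>i. x i + e * y i) :: 'i \<Rightarrow> 'a"
  have f_in: "(\<lambda>i. x i + e * y i) \<in> V" if "x \<in> V" "y \<in> V" for x y
    using lin[OF that, of 1 e] by simp
  have tau_f: "\<tau> (\<lambda>i. x i + e * y i) = (\<lambda>i. \<tau> x i + e ^ q * \<tau> y i)" if "x \<in> V" "y \<in> V" for x y
    using semi[OF that, of 1 e] by simp
  have inj: "inj_on ?f (?H \<times> ?H)"
  proof (rule inj_onI, clarify)
    fix x y x' y'
    assume H: "x \<in> V" "\<tau> x = x" "y \<in> V" "\<tau> y = y" "x' \<in> V" "\<tau> x' = x'" "y' \<in> V" "\<tau> y' = y'"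
      and eq: "(\<lambda>i. x i + e * y i) = (\<lambda>i. x' i + e * y' i)"
    have eq2: "(\<lambda>i. x i + e ^ q * y i) = (\<lambda>i. x' i + e ^ q * y' i)"
      using tau_f[of x y] tau_f[of x' y'] H eq by simp
    have y: "y i = y' i" for i
    proof -
      have "(e ^ q - e) * (y i - y' i) = 0"
      proof -
        have "(e ^ q - e) * (y i - y' i) =
          ((x i + e ^ q * y i) - (x' i + e ^ q * y' i)) - ((x i + e * y i) - (x' i + e * y' i))"
          by (simp add: algebra_simps)
        then show ?thesis using fun_cong[OF eq, of i] fun_cong[OF eq2, of i] by simp
      qed
      then show ?thesis using e by simp
    qed
    moreover have "x i = x' i" for i
      using fun_cong[OF eq, of i] y[of i] by simp
    ultimately show "x = x' \<and> y = y'" by auto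
  qed
  have img: "?f ` (?H \<times> ?H) = V"
  proof
    show "?f ` (?H \<times> ?H) \<subseteq> V" using f_in by auto
    show "V \<subseteq> ?f ` (?H \<times> ?H)"
    proof
      fix b assume b: "b \<in> V"
      \<comment> \<open>The witnesses solve the linear system \<open>b = x + e y\<close>,
        \<open>\<tau> b = x + e ^ q y\<close>. Since the Frobenius map exchanges \<open>e\<close>
        and \<open>e ^ q\<close>, it negates \<open>c\<close>, and this makes both solutions fixed
        by \<tau>.\<close>
      define c where "c = 1 / (e - e ^ q)"
      define y where "y = (\<lambda>i. c * b i + (- c) * \<tau> b i)"
      define x where "x = (\<lambda>i. (- (e ^ q) * c) * b i + (e * c) * \<tau> b i)"
      have c1: "c * (e - e ^ q) = 1" unfolding c_def using e by simp
      have "(c * (e - e ^ q)) ^ q = 1" unfolding c1 by simp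
      then have c2: "c ^ q * (e ^ q - e) = 1"
        by (simp add: power_mult_distrib frob_diff)
      have "(c ^ q + c) * (e ^ q - e) = c ^ q * (e ^ q - e) - c * (e - e ^ q)"
        by (simp add: algebra_simps)
      also have "\<dots> = 0" unfolding c1 c2 by simp
      finally have cq: "c ^ q = - c" using e by (simp add: eq_neg_iff_add_eq_0)
      note tb = tau(1)[OF b]
      have y: "y \<in> V" unfolding y_def by (rule lin[OF b tb])
      have "\<tau> y = y"
        unfolding y_def semi[OF b tb] tau(2)[OF b] by (simp add: cq frob_minus add.commute)
      note y = y this
      have x: "x \<in> V" unfolding x_def by (rule lin[OF b tb])
      have "\<tau> x = x"
        unfolding x_def semi[OF b tb] tau(2)[OF b]
        by (simp add: cq frob_minus power_mult_distrib add.commute mult.commute)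
      note x = x this
      have "x i + e * y i = b i" for i
      proof -
        have "x i + e * y i = (e - e ^ q) * c * b i" unfolding x_def y_def by (simp add: algebra_simps)
        also have "(e - e ^ q) * c = 1" using c1 by (simp add: mult.commute)
        finally show ?thesis by simp
      qed
      then have "?f (x, y) = b" by auto
      then show "b \<in> ?f ` (?H \<times> ?H)" using x y by (intro image_eqI[where x = "(x, y)"]) auto
    qed
  qed
  have "card V = card (?f ` (?H \<times> ?H))" by (simp only: img)
  also have "\<dots> = card (?H \<times> ?H)" by (rule card_image[OF inj])
  finally have "card (?H \<times> ?H) = card V" by simp
  then show ?thesis by (simp add: card_cartesian_product power2_eq_square)
qed

end

section \<open>Frames and column rank\<close>


lemma card_carrier_vec:
  "card (carrier_vec n :: 'a :: finite vec set) = CARD('a) ^ n" and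
  finite_carrier_vec: "finite (carrier_vec n :: 'a :: finite vec set)"
proof -
  have bij: "bij_betw (\<lambda>f. vec n f) (PiE {..<n} (\<lambda>_. UNIV)) (carrier_vec n :: 'a vec set)"
  proof (rule bij_betwI[where g = "\<lambda>v. restrict (vec_index v) {..<n}"])
    show "restrict (vec_index (vec n f)) {..<n} = f" if "f \<in> PiE {..<n} (\<lambda>_. UNIV)" for f :: "nat \<Rightarrow> 'a"
      using that by (auto simp: fun_eq_iff restrict_def PiE_def extensional_def)
  qed (auto intro!: eq_vecI)
  show "card (carrier_vec n :: 'a vec set) = CARD('a) ^ n"
    using bij_betw_same_card[OF bij] by (simp add: card_PiE)
  show "finite (carrier_vec n :: 'a vec set)"
    using bij_betw_finite[OF bij] by (simp add: finite_PiE)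
qed

lemma finite_carrier_mat: "finite (carrier_mat n m :: 'a :: finite mat set)"
proof (rule finite_surj)
  show "finite (PiE ({..<n} \<times> {..<m}) (\<lambda>_. UNIV :: 'a set))" by (simp add: finite_PiE)
  show "carrier_mat n m \<subseteq> (\<lambda>f. mat n m f :: 'a mat) ` PiE ({..<n} \<times> {..<m}) (\<lambda>_. UNIV)"
  proof
    fix A :: "'a mat" assume "A \<in> carrier_mat n m"
    then have "A = mat n m (restrict (index_mat A) ({..<n} \<times> {..<m}))"
      by (intro eq_matI) auto
    then show "A \<in> (\<lambda>f. mat n m f) ` PiE ({..<n} \<times> {..<m}) (\<lambda>_. UNIV)"
      by (rule image_eqI[where f = "mat n m"]) auto
  qed
qed

lemma det_nonzero_inverse:
  fixes A :: "'a :: field mat"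
  assumes A: "A \<in> carrier_mat n n" and d: "det A \<noteq> 0"
  obtains B where "B \<in> carrier_mat n n" "A * B = 1\<^sub>m n" "B * A = 1\<^sub>m n"
proof -
  from det_non_zero_imp_unit[OF A d, of "()"] 
  show thesis using that by (auto simp: Units_def ring_mat_def)
qed

lemma card_field_gt_1: "CARD('a :: {finite, zero_neq_one}) > 1"
  using card_mono[of UNIV "{0 :: 'a, 1}"] by simp

text \<open>Subspaces are represented throughout by frames, that is, by matrices with independent
  columns, so that vectors of the subspace have coordinates.\<close>

definition full_col_rank :: "'a :: semiring_1 mat \<Rightarrow> bool" where
  "full_col_rank F \<longleftrightarrow> (\<forall>c \<in> carrier_vec (dim_col F). F *\<^sub>v c = 0\<^sub>v (dim_row F) \<longrightarrow> c = 0\<^sub>v (dim_col F))"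

definition snoc_col :: "'a mat \<Rightarrow> 'a vec \<Rightarrow> 'a mat" where
  "snoc_col F v = mat (dim_row F) (Suc (dim_col F))
     (\<lambda>(i, j). if j < dim_col F then F $$ (i, j) else v $ i)"

lemma snoc_col_carrier [simp]: "F \<in> carrier_mat n m \<Longrightarrow> snoc_col F v \<in> carrier_mat n (Suc m)"
  by (simp add: snoc_col_def)

lemma snoc_col_mult_vec:
  fixes F :: "'a :: comm_ring_1 mat"
  assumes "F \<in> carrier_mat n m" "v \<in> carrier_vec n" "c \<in> carrier_vec (Suc m)"
  shows "snoc_col F v *\<^sub>v c = F *\<^sub>v vec m (($) c) + c $ m \<cdot>\<^sub>v v"
  using assms
  by (intro eq_vecI) (auto simp: snoc_col_def scalar_prod_def mult.commute intro!: sum.cong)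

lemma full_col_rank_inj:
  fixes F :: "'a :: comm_ring_1 mat"
  assumes "full_col_rank F" "F \<in> carrier_mat n m" "a \<in> carrier_vec m" "b \<in> carrier_vec m"
    and "F *\<^sub>v a = F *\<^sub>v b"
  shows "a = b"
proof -
  have "F *\<^sub>v (a - b) = F *\<^sub>v a - F *\<^sub>v b"
    using assms by (simp add: mult_minus_distrib_mat_vec)
  also have "\<dots> = 0\<^sub>v n" using assms by simp
  finally have "a - b = 0\<^sub>v m"
    using assms unfolding full_col_rank_def by auto
  then have "(a - b) $ i = 0" if "i < m" for i using that by simp
  then show ?thesis using assms by (intro eq_vecI) auto
qed

lemma full_col_rank_snoc:
  fixes F :: "'a :: field mat"
  assumes F: "full_col_rank F" "F \<in> carrier_mat n m" and v: "v \<in> carrier_vec n"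
    and nin: "\<And>c. c \<in> carrier_vec m \<Longrightarrow> v \<noteq> F *\<^sub>v c"
  shows "full_col_rank (snoc_col F v)"
  unfolding full_col_rank_def
proof (intro ballI impI)
  fix c assume c: "c \<in> carrier_vec (dim_col (snoc_col F v))"
    and z: "snoc_col F v *\<^sub>v c = 0\<^sub>v (dim_row (snoc_col F v))"
  have c': "c \<in> carrier_vec (Suc m)" using c F by (simp add: snoc_col_def)
  let ?d = "vec m (($) c)"
  have z': "F *\<^sub>v ?d + c $ m \<cdot>\<^sub>v v = 0\<^sub>v n"
    using z snoc_col_mult_vec[OF F(2) v c'] F by (simp add: snoc_col_def)
  have z'': "(F *\<^sub>v ?d) $ i + c $ m * v $ i = 0" if "i < n" for i
    using arg_cong[OF z', of "\<lambda>x. x $ i"] that F v by simp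
  have cm: "c $ m = 0"
  proof (rule ccontr)
    assume ne: "c $ m \<noteq> 0"
    have "v = F *\<^sub>v ((- 1 / c $ m) \<cdot>\<^sub>v ?d)"
    proof -
      have "F *\<^sub>v ((- 1 / c $ m) \<cdot>\<^sub>v ?d) = (- 1 / c $ m) \<cdot>\<^sub>v (F *\<^sub>v ?d)"
        using F by (simp add: mult_mat_vec)
      moreover have "v = (- 1 / c $ m) \<cdot>\<^sub>v (F *\<^sub>v ?d)"
      proof (rule eq_vecI)
        fix i assume "i < dim_vec ((- 1 / c $ m) \<cdot>\<^sub>v (F *\<^sub>v ?d))"
        then have i: "i < n" using F by simp
        have "(F *\<^sub>v ?d) $ i = - (c $ m * v $ i)" using z''[OF i] by (simp add: eq_neg_iff_add_eq_0)
        then show "v $ i = ((- 1 / c $ m) \<cdot>\<^sub>v (F *\<^sub>v ?d)) $ i"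
          using ne i F by (simp add: field_simps del: index_mult_mat_vec)
      qed (use v F in auto)
      ultimately show ?thesis by simp
    qed
    then show False using nin[of "(- 1 / c $ m) \<cdot>\<^sub>v ?d"] by simp
  qed
  have "F *\<^sub>v ?d = 0\<^sub>v n"
    using z'' cm F by (intro eq_vecI) auto
  then have d0: "?d = 0\<^sub>v m" using F unfolding full_col_rank_def by auto
  have "c $ i = 0" if "i < Suc m" for i
    using that cm arg_cong[OF d0, of "\<lambda>x. x $ i"] by (cases "i = m") auto
  then show "c = 0\<^sub>v (dim_col (snoc_col F v))"
    using c' F by (intro eq_vecI) (auto simp: snoc_col_def)
qed

text \<open>Over a finite field dimensions can be compared by counting:
  \<open>c \<mapsto> F c\<close> injects \<open>CARD('a) ^ m\<close> vectors into
  \<open>CARD('a) ^ n\<close>.\<close>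

lemma full_col_rank_le:
  fixes F :: "'a :: {finite, field} mat"
  assumes "full_col_rank F" "F \<in> carrier_mat n m"
  shows "m \<le> n"
proof -
  have "card (carrier_vec m :: 'a vec set) \<le> card (carrier_vec n :: 'a vec set)"
  proof (rule card_inj_on_le)
    show "inj_on ((*\<^sub>v) F) (carrier_vec m)"
      using full_col_rank_inj[OF assms] by (auto intro: inj_onI)
  qed (use assms finite_carrier_vec in auto)
  moreover have "CARD('a) > 1" by (rule card_field_gt_1)
  ultimately show ?thesis by (simp add: card_carrier_vec)
qed

lemma ex_not_in_range:
  fixes F :: "'a :: {finite, field} mat"
  assumes "F \<in> carrier_mat n m" "m < n"
  obtains v where "v \<in> carrier_vec n" "\<And>c. c \<in> carrier_vec m \<Longrightarrow> v \<noteq> F *\<^sub>v c"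
proof -
  have "card ((*\<^sub>v) F ` carrier_vec m) \<le> CARD('a) ^ m"
    using card_image_le[OF finite_carrier_vec, of "(*\<^sub>v) F" m] by (simp add: card_carrier_vec)
  moreover have "CARD('a) > 1" by (rule card_field_gt_1)
  ultimately have "card ((*\<^sub>v) F ` carrier_vec m) < CARD('a) ^ n"
    using assms(2) by (meson le_less_trans power_strict_increasing)
  then have "\<not> carrier_vec n \<subseteq> (*\<^sub>v) F ` carrier_vec m"
    using card_mono[of "(*\<^sub>v) F ` carrier_vec m" "carrier_vec n"] finite_carrier_vec
    by (metis card_carrier_vec finite_imageI not_le)
  then show thesis using that by blast
qed

lemma full_col_rank_det:
  fixes F :: "'a :: field mat"
  assumes "full_col_rank F" "F \<in> carrier_mat n n"
  shows "det F \<noteq> 0"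
  using assms det_0_iff_vec_prod_zero_field[OF assms(2)] unfolding full_col_rank_def by auto

lemma full_col_rank_extend:
  fixes F :: "'a :: {finite, field} mat"
  assumes "full_col_rank F" "F \<in> carrier_mat n m"
  obtains P where "P \<in> carrier_mat n n" "det P \<noteq> 0"
    "\<And>i j. i < n \<Longrightarrow> j < m \<Longrightarrow> P $$ (i, j) = F $$ (i, j)"
proof -
  have "\<exists>P. P \<in> carrier_mat n n \<and> det P \<noteq> 0 \<and> (\<forall>i<n. \<forall>j<m. P $$ (i, j) = F $$ (i, j))"
    using assms
  proof (induction "n - m" arbitrary: F m)
    case 0
    then have "m = n" using full_col_rank_le[of F n m] by simp
    then show ?case using 0 full_col_rank_det by blast
  next
    case (Suc k)
    then have mn: "m < n" by simp
    obtain v where v: "v \<in> carrier_vec n" "\<And>c. c \<in> carrier_vec m \<Longrightarrow> v \<noteq> F *\<^sub>v c"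
      using ex_not_in_range[OF Suc.prems(2) mn] by blast
    have k: "k = n - Suc m" using Suc.hyps(2) by simp
    obtain P where "P \<in> carrier_mat n n" "det P \<noteq> 0"
      "\<And>i j. i < n \<Longrightarrow> j < Suc m \<Longrightarrow> P $$ (i, j) = snoc_col F v $$ (i, j)"
      using Suc.hyps(1)[OF k full_col_rank_snoc[OF Suc.prems v] snoc_col_carrier[OF Suc.prems(2)]]
      by blast
    then show ?case using Suc.prems by (intro exI[of _ P]) (auto simp: snoc_col_def)
  qed
  then show thesis using that by blast
qed

text \<open>Complete \<open>F\<close> to an invertible \<open>P\<close>. Then
  \<open>P\<^sup>T\<close> is onto, and its first \<open>m\<close> rows are those of
  \<open>F\<^sup>T\<close>, so it suffices to hit \<open>c\<close> padded by zeros.\<close>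

lemma full_col_rank_transpose_surj:
  fixes F :: "'a :: {finite, field} mat"
  assumes F: "full_col_rank F" "F \<in> carrier_mat n m" and c: "c \<in> carrier_vec m"
  obtains y where "y \<in> carrier_vec n" "F\<^sup>T *\<^sub>v y = c"
proof -
  have mn: "m \<le> n" using full_col_rank_le[OF F] .
  obtain P where P: "P \<in> carrier_mat n n" "det P \<noteq> 0"
    "\<And>i j. i < n \<Longrightarrow> j < m \<Longrightarrow> P $$ (i, j) = F $$ (i, j)"
    using full_col_rank_extend[OF F] by blast
  have PT: "P\<^sup>T \<in> carrier_mat n n" "det (P\<^sup>T) \<noteq> 0" using P by (auto simp: det_transpose)
  obtain B where B: "B \<in> carrier_mat n n" "P\<^sup>T * B = 1\<^sub>m n" using det_nonzero_inverse[OF PT] by blast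
  define c' where "c' = vec n (\<lambda>i. if i < m then c $ i else 0)"
  have c': "c' \<in> carrier_vec n" by (simp add: c'_def)
  have eq: "P\<^sup>T *\<^sub>v (B *\<^sub>v c') = c'"
    using B PT c' by (simp add: assoc_mult_mat_vec[symmetric])
  have "F\<^sup>T *\<^sub>v (B *\<^sub>v c') = c"
  proof (rule eq_vecI)
    fix j assume "j < dim_vec c"
    then have j: "j < m" using c by simp
    have "row (F\<^sup>T) j = row (P\<^sup>T) j"
      using P F j mn by (intro eq_vecI) auto
    then have "(F\<^sup>T *\<^sub>v (B *\<^sub>v c')) $ j = (P\<^sup>T *\<^sub>v (B *\<^sub>v c')) $ j"
      using j mn F PT by simp
    also have "\<dots> = c $ j" unfolding eq using j mn by (simp add: c'_def)
    finally show "(F\<^sup>T *\<^sub>v (B *\<^sub>v c')) $ j = c $ j" .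
  qed (use F c in auto)
  then show thesis using that[of "B *\<^sub>v c'"] B c' by simp
qed

section \<open>The Hermitian form\<close>

lemma mult_mat_vec_add_smult:
  fixes F :: "'a :: field mat"
  assumes "F \<in> carrier_mat n m" "a \<in> carrier_vec m" "b \<in> carrier_vec m"
  shows "F *\<^sub>v (a + t \<cdot>\<^sub>v b) = F *\<^sub>v a + t \<cdot>\<^sub>v (F *\<^sub>v b)"
  using assms by (simp add: mult_add_distrib_mat_vec mult_mat_vec)

context unitary_field
begin

abbreviation form :: "nat \<Rightarrow> 'a vec \<Rightarrow> 'a vec \<Rightarrow> 'a" where "form n \<equiv> skew_form n q"

lemma form_add_left:
  assumes "x \<in> carrier_vec n" "y \<in> carrier_vec n"
  shows "form n (x + y) z = form n x z + form n y z"
  using assms by (simp add: skew_form_def sum.distrib[symmetric] algebra_simps)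

lemma form_smult_left:
  assumes "x \<in> carrier_vec n"
  shows "form n (c \<cdot>\<^sub>v x) z = c * form n x z"
  using assms by (simp add: skew_form_def sum_distrib_left algebra_simps)

lemma form_conj: "form n y x = form n x y ^ q"
  by (simp add: skew_form_def frob_sum power_mult_distrib mult.commute)

lemma form_add_right:
  assumes "x \<in> carrier_vec n" "y \<in> carrier_vec n"
  shows "form n z (x + y) = form n z x + form n z y"
  using assms by (simp add: skew_form_def sum.distrib[symmetric] algebra_simps frob_add)

lemma form_smult_right:
  assumes "x \<in> carrier_vec n"
  shows "form n z (c \<cdot>\<^sub>v x) = c ^ q * form n z x"
  using assms by (simp add: skew_form_def sum_distrib_left algebra_simps power_mult_distrib)

lemma form_zero_left [simp]: "form n (0\<^sub>v n) z = 0"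
  by (simp add: skew_form_def)

lemma form_diag_fixed: "form n x x ^ q = form n x x"
  using form_conj[of n x x] by simp

lemma form_unit_left:
  assumes "i < n" "x \<in> carrier_vec n"
  shows "form n (unit_vec n i) x = (x $ i) ^ q"
proof -
  have "form n (unit_vec n i) x = (\<Sum>k<n. if k = i then (x $ i) ^ q else 0)"
    unfolding skew_form_def using assms by (intro sum.cong) (auto simp: unit_vec_def)
  then show ?thesis using assms by simp
qed

lemma form_prescribed:
  assumes F: "full_col_rank F" "F \<in> carrier_mat n m" and c: "(c :: 'a vec) \<in> carrier_vec m"
  obtains v where "v \<in> carrier_vec n"
    "\<And>a. a \<in> carrier_vec m \<Longrightarrow> form n (F *\<^sub>v a) v = (\<Sum>j<m. a $ j * c $ j)"
proof -
  obtain y where y: "y \<in> carrier_vec n" "F\<^sup>T *\<^sub>v y = c"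
    using full_col_rank_transpose_surj[OF F c] by blast
  \<comment> \<open>The form raises its second argument to the power \<open>q\<close> again, which
    turns the entries of \<open>v\<close> back into those of \<open>y\<close>.\<close>
  define v where "v = vec n (\<lambda>i. (y $ i) ^ q)"
  have "form n (F *\<^sub>v a) v = (\<Sum>j<m. a $ j * c $ j)" if a: "a \<in> carrier_vec m" for a
  proof -
    have "form n (F *\<^sub>v a) v = (\<Sum>i<n. \<Sum>j<m. F $$ (i, j) * a $ j * y $ i)"
      unfolding skew_form_def v_def using F a
      by (intro sum.cong refl) (simp add: scalar_prod_def sum_distrib_right lessThan_atLeast0)
    also have "\<dots> = (\<Sum>j<m. a $ j * (\<Sum>i<n. F $$ (i, j) * y $ i))"
      by (subst sum.swap) (simp add: sum_distrib_left algebra_simps)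
    also have "\<dots> = (\<Sum>j<m. a $ j * c $ j)"
      unfolding y(2)[symmetric] using F y(1)
      by (intro sum.cong refl arg_cong2[where f = "(*)"]) (simp add: scalar_prod_def lessThan_atLeast0)
    finally show ?thesis .
  qed
  then show thesis using that[of v] by (simp add: v_def)
qed

text \<open>For every \<open>c\<close> choose \<open>y c\<close> whose products with the frame are
  given by \<open>c\<close>. The vectors \<open>y c + F b\<close> are pairwise distinct: isotropy
  lets \<open>c\<close> be read off from the products with the frame, and then independence of the
  columns gives \<open>b\<close>. So \<open>2 * m\<close> coordinates fit into dimension
  \<open>n\<close>.\<close>

lemma isotropic_frame_le:
  assumes F: "full_col_rank F" "(F :: 'a mat) \<in> carrier_mat n m"
    and iso: "\<And>a b. a \<in> carrier_vec m \<Longrightarrow> b \<in> carrier_vec m \<Longrightarrow> form n (F *\<^sub>v a) (F *\<^sub>v b) = 0"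
  shows "2 * m \<le> n"
proof -
  have "\<exists>v. v \<in> carrier_vec n \<and> (\<forall>a \<in> carrier_vec m. form n (F *\<^sub>v a) v = (\<Sum>j<m. a $ j * c $ j))"
    if "c \<in> carrier_vec m" for c
    using form_prescribed[OF F that] by metis
  then obtain y where y: "\<And>c. c \<in> carrier_vec m \<Longrightarrow> y c \<in> carrier_vec n"
    "\<And>c a. c \<in> carrier_vec m \<Longrightarrow> a \<in> carrier_vec m \<Longrightarrow> form n (F *\<^sub>v a) (y c) = (\<Sum>j<m. a $ j * c $ j)"
    by metis
  let ?g = "\<lambda>(c, b). y c + F *\<^sub>v b"
  have recover: "form n (F *\<^sub>v unit_vec m j) (?g (c, b)) = c $ j"
    if "c \<in> carrier_vec m" "b \<in> carrier_vec m" "j < m" for c b j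
  proof -
    have "form n (F *\<^sub>v unit_vec m j) (?g (c, b)) = (\<Sum>k<m. unit_vec m j $ k * c $ k)"
      using that y F by (simp add: form_add_right iso)
    also have "\<dots> = (\<Sum>k<m. if k = j then c $ k else 0)"
      using that by (intro sum.cong) (auto simp: unit_vec_def)
    finally show ?thesis using that by simp
  qed
  have "inj_on ?g (carrier_vec m \<times> carrier_vec m)"
  proof (rule inj_onI, clarify)
    fix c b c' b'
    assume cb: "c \<in> carrier_vec m" "b \<in> carrier_vec m" "c' \<in> carrier_vec m" "b' \<in> carrier_vec m"
      and eq: "y c + F *\<^sub>v b = y c' + F *\<^sub>v b'"
    have "c $ j = c' $ j" if "j < m" for j
      using recover[of c b j] recover[of c' b' j] cb that eq by simp
    then have cc: "c = c'" using cb by (intro eq_vecI) auto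
    have "(F *\<^sub>v b) $ i = (F *\<^sub>v b') $ i" if "i < n" for i
      using arg_cong[OF eq, of "\<lambda>v. v $ i"] that cc F y(1)[OF cb(1)] by simp
    then have "F *\<^sub>v b = F *\<^sub>v b'" using F by (intro eq_vecI) auto
    then show "c = c' \<and> b = b'" using cc full_col_rank_inj[OF F] cb by blast
  qed
  then have "card (carrier_vec m \<times> carrier_vec m :: ('a vec \<times> 'a vec) set) \<le> card (carrier_vec n :: 'a vec set)"
    by (rule card_inj_on_le) (use y F finite_carrier_vec in auto)
  then have "CARD('a) ^ (2 * m) \<le> CARD('a) ^ n"
    by (simp add: card_cartesian_product card_carrier_vec mult_2 power_add)
  then show ?thesis using card_field_gt_1[where ?'a = 'a] by simp
qed

subsection \<open>Witt's extension theorem\<close>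

text \<open>The vector \<open>u = F r\<close> lies in the radical of the span. Adding
  \<open>t u\<close> to a vector \<open>w\<close> with the prescribed products leaves these products
  alone and changes the norm by \<open>t + t ^ q\<close>, so surjectivity of the trace makes the
  norm zero. The result is outside the span because \<open>u\<close> is orthogonal to the span but
  has product 1 with it.\<close>

lemma extend_degenerate:
  assumes F: "full_col_rank F" "(F :: 'a mat) \<in> carrier_mat n m"
    and r: "r \<in> carrier_vec m" "\<And>a. a \<in> carrier_vec m \<Longrightarrow> form n (F *\<^sub>v a) (F *\<^sub>v r) = 0"
    and c: "c \<in> carrier_vec m" "(\<Sum>j<m. r $ j * c $ j) = 1"
  obtains v where "v \<in> carrier_vec n" "\<And>a. a \<in> carrier_vec m \<Longrightarrow> v \<noteq> F *\<^sub>v a"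
    "\<And>a. a \<in> carrier_vec m \<Longrightarrow> form n (F *\<^sub>v a) v = (\<Sum>j<m. a $ j * c $ j)" "form n v v = 0"
proof -
  obtain w where w: "w \<in> carrier_vec n"
    "\<And>a. a \<in> carrier_vec m \<Longrightarrow> form n (F *\<^sub>v a) w = (\<Sum>j<m. a $ j * c $ j)"
    using form_prescribed[OF F c(1)] by blast
  define u where "u = F *\<^sub>v r"
  have u: "u \<in> carrier_vec n" "form n u u = 0" "form n u w = 1"
    using F r w c by (auto simp: u_def)
  have wu: "form n w u = 1" using u(3) form_conj[of n w u] by simp
  have "(- form n w w) ^ q = - form n w w" by (simp add: frob_minus form_diag_fixed)
  then obtain t where t: "t + t ^ q = - form n w w" using trace_surj by blast
  define v where "v = w + t \<cdot>\<^sub>v u"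
  have v: "v \<in> carrier_vec n" using w u by (simp add: v_def)
  have fv: "form n (F *\<^sub>v a) v = (\<Sum>j<m. a $ j * c $ j)" if "a \<in> carrier_vec m" for a
    unfolding v_def using that w u r(2)[OF that]
    by (simp add: form_add_right form_smult_right u_def)
  have "form n v v = form n w w + (t + t ^ q)"
    unfolding v_def using w u wu
    by (simp add: form_add_right form_smult_right form_add_left form_smult_left algebra_simps)
  then have vv: "form n v v = 0" using t by simp
  have "v \<noteq> F *\<^sub>v a" if a: "a \<in> carrier_vec m" for a
  proof
    assume "v = F *\<^sub>v a"
    then have "form n u v = form n (F *\<^sub>v a) u ^ q" using form_conj[of n u "F *\<^sub>v a"] by simp
    also have "\<dots> = 0" using r(2)[OF a] by (simp add: u_def)
    finally show False using fv[OF r(1)] c(2) by (simp add: u_def)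
  qed
  then show thesis using that v fv vv by blast
qed

text \<open>On a nondegenerate span the map from coordinates \<open>b\<close> to the products of the
  frame vectors with \<open>F b\<close> is injective, hence onto by finiteness. Choose
  \<open>b\<close> hitting the negated products with \<open>w\<close>.\<close>

lemma orthogonal_projection:
  assumes F: "full_col_rank F" "(F :: 'a mat) \<in> carrier_mat n m"
    and nd: "\<And>r. r \<in> carrier_vec m \<Longrightarrow>
        (\<And>a. a \<in> carrier_vec m \<Longrightarrow> form n (F *\<^sub>v a) (F *\<^sub>v r) = 0) \<Longrightarrow> r = 0\<^sub>v m"
    and w: "w \<in> carrier_vec n"
  obtains b where "b \<in> carrier_vec m"
    "\<And>a. a \<in> carrier_vec m \<Longrightarrow> form n (F *\<^sub>v a) (w + F *\<^sub>v b) = 0"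
proof -
  define g where "g x = vec m (\<lambda>i. form n (col F i) x)" for x
  have expand: "form n (F *\<^sub>v a) x = (\<Sum>i<m. a $ i * g x $ i)" if a: "a \<in> carrier_vec m" for a x
  proof -
    have "form n (F *\<^sub>v a) x = (\<Sum>k<n. \<Sum>i<m. F $$ (k, i) * a $ i * (x $ k) ^ q)"
      unfolding skew_form_def using F a
      by (intro sum.cong refl) (simp add: scalar_prod_def sum_distrib_right lessThan_atLeast0)
    also have "\<dots> = (\<Sum>i<m. a $ i * g x $ i)"
      using F unfolding g_def skew_form_def
      by (subst sum.swap) (simp add: sum_distrib_left algebra_simps)
    finally show ?thesis .
  qed
  have "inj_on (\<lambda>b. g (F *\<^sub>v b)) (carrier_vec m)"
  proof (rule inj_onI)
    fix b b' assume b: "b \<in> carrier_vec m" "b' \<in> carrier_vec m" and eq: "g (F *\<^sub>v b) = g (F *\<^sub>v b')"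
    have z: "b + (- 1) \<cdot>\<^sub>v b' = 0\<^sub>v m"
    proof (rule nd)
      fix a :: "'a vec" assume a: "a \<in> carrier_vec m"
      have "form n (F *\<^sub>v a) (F *\<^sub>v (b + (- 1) \<cdot>\<^sub>v b')) = form n (F *\<^sub>v a) (F *\<^sub>v b) - form n (F *\<^sub>v a) (F *\<^sub>v b')"
        using F b by (simp add: mult_mat_vec_add_smult[of _ n m] form_add_right form_smult_right frob_minus)
      then show "form n (F *\<^sub>v a) (F *\<^sub>v (b + (- 1) \<cdot>\<^sub>v b')) = 0"
        using expand[OF a] eq by simp
    qed (use b in simp)
    have "b $ i = b' $ i" if "i < m" for i
    proof -
      have "(b + (- 1) \<cdot>\<^sub>v b') $ i = 0" by (simp only: z index_zero_vec(1) that)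
      then show ?thesis using that b by simp
    qed
    then show "b = b'" using b by (intro eq_vecI) auto
  qed
  then have "(\<lambda>b. g (F *\<^sub>v b)) ` carrier_vec m = carrier_vec m"
    by (intro endo_inj_surj[OF finite_carrier_vec]) (auto simp: g_def)
  then have "- g w \<in> (\<lambda>b. g (F *\<^sub>v b)) ` carrier_vec m" by (simp add: g_def)
  then obtain b where b: "b \<in> carrier_vec m" "g (F *\<^sub>v b) = - g w" by auto
  have "form n (F *\<^sub>v a) (w + F *\<^sub>v b) = 0" if a: "a \<in> carrier_vec m" for a
  proof -
    have "form n (F *\<^sub>v a) (w + F *\<^sub>v b) = (\<Sum>i<m. a $ i * (g w $ i + g (F *\<^sub>v b) $ i))"
    proof -
      have "form n (F *\<^sub>v a) (w + F *\<^sub>v b) = form n (F *\<^sub>v a) w + form n (F *\<^sub>v a) (F *\<^sub>v b)"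
        using w b(1) F by (intro form_add_right) auto
      also have "\<dots> = (\<Sum>i<m. a $ i * (g w $ i + g (F *\<^sub>v b) $ i))"
        unfolding expand[OF a] by (simp add: sum.distrib[symmetric] distrib_left)
      finally show ?thesis .
    qed
    also have "\<dots> = 0" unfolding b(2) by (intro sum.neutral) (auto simp: g_def)
    finally show ?thesis .
  qed
  then show thesis using that b by blast
qed

text \<open>The orthogonal complement of the span is nonzero, and the form restricted to it is not
  identically zero. Then some vector in it has nonzero norm, since vanishing norms would make all
  traces \<open>t + t ^ q\<close> vanish, and surjectivity of the field norm rescales that vector to
  norm 1.\<close>

lemma extend_nondegenerate:
  assumes F: "full_col_rank F" "(F :: 'a mat) \<in> carrier_mat n m" "m < n"
    and nd: "\<And>r. r \<in> carrier_vec m \<Longrightarrow>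
        (\<And>a. a \<in> carrier_vec m \<Longrightarrow> form n (F *\<^sub>v a) (F *\<^sub>v r) = 0) \<Longrightarrow> r = 0\<^sub>v m"
  obtains v where "v \<in> carrier_vec n" "\<And>a. a \<in> carrier_vec m \<Longrightarrow> v \<noteq> F *\<^sub>v a"
    "\<And>a. a \<in> carrier_vec m \<Longrightarrow> form n (F *\<^sub>v a) v = 0" "form n v v = 1"
proof -
  define perp where "perp = {v \<in> carrier_vec n. \<forall>a \<in> carrier_vec m. form n (F *\<^sub>v a) v = 0}"
  have perp_closed: "x + t \<cdot>\<^sub>v y \<in> perp" "t \<cdot>\<^sub>v y \<in> perp" if "x \<in> perp" "y \<in> perp" for x y t
    using that by (auto simp: perp_def form_add_right form_smult_right)
  obtain w0 where w0: "w0 \<in> carrier_vec n" "\<And>c. c \<in> carrier_vec m \<Longrightarrow> w0 \<noteq> F *\<^sub>v c"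
    using ex_not_in_range[OF F(2,3)] by blast
  obtain b where b: "b \<in> carrier_vec m"
    "\<And>a. a \<in> carrier_vec m \<Longrightarrow> form n (F *\<^sub>v a) (w0 + F *\<^sub>v b) = 0"
    using orthogonal_projection[OF F(1,2) nd w0(1)] by blast
  define w where "w = w0 + F *\<^sub>v b"
  have w: "w \<in> perp" "w \<in> carrier_vec n" using b w0 F by (auto simp: w_def perp_def)
  have "w \<noteq> 0\<^sub>v n"
  proof
    assume w0': "w = 0\<^sub>v n"
    have "w0 $ i = (F *\<^sub>v ((- 1) \<cdot>\<^sub>v b)) $ i" if "i < n" for i
    proof -
      have "w0 $ i + (F *\<^sub>v b) $ i = 0"
        using arg_cong[OF w0', of "\<lambda>v. v $ i"] that F w0 by (simp add: w_def)
      moreover have "(F *\<^sub>v ((- 1) \<cdot>\<^sub>v b)) $ i = - ((F *\<^sub>v b) $ i)"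
        using F b that by (simp add: mult_mat_vec del: index_mult_mat_vec)
      ultimately show ?thesis by (metis add_right_cancel eq_neg_iff_add_eq_0)
    qed
    then have "w0 = F *\<^sub>v ((- 1) \<cdot>\<^sub>v b)" using w0 F by (intro eq_vecI) auto
    then show False using w0(2)[of "(- 1) \<cdot>\<^sub>v b"] b by simp
  qed
  then obtain i where i: "i < n" "w $ i \<noteq> 0"
    using w(2) by (metis carrier_vecD eq_vecI index_zero_vec)
  \<comment> \<open>This vector pairs nontrivially with \<open>w\<close>. Projecting it into
    \<open>perp\<close> keeps the product, because \<open>w\<close> is orthogonal to the correction
    term in the range of \<open>F\<close>.\<close>
  define x0 where "x0 = (1 / (w $ i)) \<cdot>\<^sub>v unit_vec n i"
  have x0: "x0 \<in> carrier_vec n" by (simp add: x0_def)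
  obtain b' where b': "b' \<in> carrier_vec m"
    "\<And>a. a \<in> carrier_vec m \<Longrightarrow> form n (F *\<^sub>v a) (x0 + F *\<^sub>v b') = 0"
    using orthogonal_projection[OF F(1,2) nd x0] by blast
  define x1 where "x1 = x0 + F *\<^sub>v b'"
  have x1: "x1 \<in> perp" "x1 \<in> carrier_vec n" using b' x0 F by (auto simp: x1_def perp_def)
  have "form n x1 w = form n x0 w + form n (F *\<^sub>v b') w"
    unfolding x1_def using x0 F b' by (simp add: form_add_left)
  also have "form n (F *\<^sub>v b') w = 0" using w b' by (simp add: perp_def)
  also have "form n x0 w = (1 / (w $ i)) * (w $ i) ^ q"
    unfolding x0_def using i w by (simp add: form_smult_left form_unit_left)
  finally have "form n x1 w \<noteq> 0" using i by simp
  define x where "x = (1 / form n x1 w) \<cdot>\<^sub>v x1"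
  have x: "x \<in> perp" "x \<in> carrier_vec n" using x1 perp_closed by (auto simp: x_def)
  have xw: "form n x w = 1" unfolding x_def using x1 \<open>form n x1 w \<noteq> 0\<close> by (simp add: form_smult_left)
  have wx: "form n w x = 1" using form_conj[of n w x] xw by simp
  have "\<exists>u \<in> perp. form n u u \<noteq> 0"
  proof (rule ccontr)
    assume "\<not> ?thesis"
    then have z: "form n u u = 0" if "u \<in> perp" for u using that by blast
    obtain t where t: "t + t ^ q = (1 :: 'a)" using trace_surj[of 1] by auto
    \<comment> \<open>Polarization: with the norms of \<open>x\<close> and \<open>w\<close> zero and
      their product 1, only the trace of \<open>t\<close> is left, and \<open>t\<close> was chosen
      with trace 1.\<close>
    have "form n (x + t \<cdot>\<^sub>v w) (x + t \<cdot>\<^sub>v w) = t + t ^ q"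
      using x w z[OF x(1)] z[OF w(1)] xw wx
      by (simp add: form_add_right form_smult_right form_add_left form_smult_left)
    then show False using z[OF perp_closed(1)[OF x(1) w(1)], of t] t by simp
  qed
  then obtain u where u: "u \<in> perp" "form n u u \<noteq> 0" by blast
  have "(1 / form n u u) ^ q = 1 / form n u u" by (simp add: power_divide form_diag_fixed)
  then obtain l where l: "l * l ^ q = 1 / form n u u" using norm_surj[of "1 / form n u u"] u by auto
  define v where "v = l \<cdot>\<^sub>v u"
  have v: "v \<in> perp" using perp_closed u by (simp add: v_def)
  have "form n v v = l * l ^ q * form n u u"
    unfolding v_def using u by (simp add: perp_def form_smult_left form_smult_right)
  then have vv: "form n v v = 1" using l u by simp
  have "v \<noteq> F *\<^sub>v a" if a: "a \<in> carrier_vec m" for a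
    using v a vv by (auto simp: perp_def)
  then show thesis using that v vv by (auto simp: perp_def)
qed

lemma invertible_mat_of_inverse:
  assumes "A \<in> carrier_mat n n" "B \<in> carrier_mat n n" "A * B = 1\<^sub>m n" "B * A = 1\<^sub>m n"
  shows "invertible_mat A"
  using assms by (auto simp: invertible_mat_def inverts_mat_def)

text \<open>Both frames are extended, one vector at a time, by vectors whose products with the frame and with
  themselves are dictated by the common Gram matrix alone; two full bases with equal Gram matrices
  differ by an isometry.\<close>

theorem witt_extension:
  assumes "full_col_rank F" "(F :: 'a mat) \<in> carrier_mat n m"
    and "full_col_rank F'" "(F' :: 'a mat) \<in> carrier_mat n m"
    and "\<And>a b. a \<in> carrier_vec m \<Longrightarrow> b \<in> carrier_vec m \<Longrightarrow>
       form n (F *\<^sub>v a) (F *\<^sub>v b) = form n (F' *\<^sub>v a) (F' *\<^sub>v b)"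
  shows "\<exists>A \<in> unitary_group n q. A * F = F'"
  using assms
proof (induction "n - m" arbitrary: F F' m)
  case 0
  then have mn: "m = n" using full_col_rank_le[of F n m] by simp
  note F = 0(2,3)[unfolded mn] and F' = 0(4,5)[unfolded mn] and G = 0(6)[unfolded mn]
  obtain B where B: "B \<in> carrier_mat n n" "F * B = 1\<^sub>m n" "B * F = 1\<^sub>m n"
    using det_nonzero_inverse[OF F(2) full_col_rank_det[OF F]] by blast
  obtain B' where B': "B' \<in> carrier_mat n n" "F' * B' = 1\<^sub>m n" "B' * F' = 1\<^sub>m n"
    using det_nonzero_inverse[OF F'(2) full_col_rank_det[OF F']] by blast
  define A where "A = F' * B"
  have A: "A \<in> carrier_mat n n" using F' B by (simp add: A_def)
  have "A * (F * B') = F' * (B * F) * B'"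
    unfolding A_def using F(2) F'(2) B(1) B'(1) by (simp add: assoc_mult_mat[of _ n n _ n _ n])
  then have AB: "A * (F * B') = 1\<^sub>m n" using F' B' B by simp
  have "(F * B') * A = F * (B' * F') * B"
    unfolding A_def using F(2) F'(2) B(1) B'(1) by (simp add: assoc_mult_mat[of _ n n _ n _ n])
  then have BA: "(F * B') * A = 1\<^sub>m n" using F B B' by simp
  have inv: "invertible_mat A"
    by (rule invertible_mat_of_inverse[OF A _ AB BA]) (use F B' in auto)
  have "form n (A *\<^sub>v x) (A *\<^sub>v y) = form n x y" if xy: "x \<in> carrier_vec n" "y \<in> carrier_vec n" for x y
  proof -
    have A_eq: "A *\<^sub>v z = F' *\<^sub>v (B *\<^sub>v z)" if "z \<in> carrier_vec n" for z
      unfolding A_def by (rule assoc_mult_mat_vec[OF F'(2) B(1) that])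
    have B_eq: "F *\<^sub>v (B *\<^sub>v z) = z" if "z \<in> carrier_vec n" for z
      using assoc_mult_mat_vec[OF F(2) B(1) that] B(2) that by simp
    have "form n (F *\<^sub>v (B *\<^sub>v x)) (F *\<^sub>v (B *\<^sub>v y)) = form n (F' *\<^sub>v (B *\<^sub>v x)) (F' *\<^sub>v (B *\<^sub>v y))"
      using B xy by (intro G) auto
    then show ?thesis by (simp only: A_eq B_eq xy)
  qed
  moreover have "A * F = F'"
    unfolding A_def using F(2) F'(2) B(1,3) by (simp add: assoc_mult_mat[of _ n n _ n _ n])
  ultimately show ?case using A inv by (auto simp: unitary_group_def)
next
  case (Suc k)
  note F = Suc.prems(1,2) and F' = Suc.prems(3,4) and G = Suc.prems(5)
  have mn: "m < n" using Suc.hyps(2) by simp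
  have k: "k = n - Suc m" using Suc.hyps(2) by simp
  obtain v v' where v: "v \<in> carrier_vec n" "\<And>a. a \<in> carrier_vec m \<Longrightarrow> v \<noteq> F *\<^sub>v a"
    and v': "v' \<in> carrier_vec n" "\<And>a. a \<in> carrier_vec m \<Longrightarrow> v' \<noteq> F' *\<^sub>v a"
    and same: "\<And>a. a \<in> carrier_vec m \<Longrightarrow> form n (F *\<^sub>v a) v = form n (F' *\<^sub>v a) v'"
      "form n v v = form n v' v'"
  proof (cases "\<exists>r \<in> carrier_vec m. r \<noteq> 0\<^sub>v m \<and> (\<forall>a \<in> carrier_vec m. form n (F *\<^sub>v a) (F *\<^sub>v r) = 0)")
    case True
    then obtain r where r: "r \<in> carrier_vec m" "r \<noteq> 0\<^sub>v m"
      "\<And>a. a \<in> carrier_vec m \<Longrightarrow> form n (F *\<^sub>v a) (F *\<^sub>v r) = 0" by blast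
    then have r': "\<And>a. a \<in> carrier_vec m \<Longrightarrow> form n (F' *\<^sub>v a) (F' *\<^sub>v r) = 0" using G by simp
    obtain i where i: "i < m" "r $ i \<noteq> 0"
      using r(1,2) by (metis carrier_vecD eq_vecI index_zero_vec)
    \<comment> \<open>Dual to the radical direction \<open>r\<close>. Using the same
      \<open>c\<close> for both frames keeps the extended Gram matrices equal.\<close>
    define c where "c = vec m (\<lambda>j. if j = i then 1 / r $ i else 0)"
    have "(\<Sum>j<m. r $ j * c $ j) = (\<Sum>j<m. if j = i then 1 else 0)"
      using i by (intro sum.cong) (auto simp: c_def)
    then have c: "c \<in> carrier_vec m" "(\<Sum>j<m. r $ j * c $ j) = 1" using i by (auto simp: c_def)
    obtain v where v: "v \<in> carrier_vec n" "\<And>a. a \<in> carrier_vec m \<Longrightarrow> v \<noteq> F *\<^sub>v a"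
      "\<And>a. a \<in> carrier_vec m \<Longrightarrow> form n (F *\<^sub>v a) v = (\<Sum>j<m. a $ j * c $ j)" "form n v v = 0"
      using extend_degenerate[OF F r(1,3) c] by blast
    obtain v' where v': "v' \<in> carrier_vec n" "\<And>a. a \<in> carrier_vec m \<Longrightarrow> v' \<noteq> F' *\<^sub>v a"
      "\<And>a. a \<in> carrier_vec m \<Longrightarrow> form n (F' *\<^sub>v a) v' = (\<Sum>j<m. a $ j * c $ j)" "form n v' v' = 0"
      using extend_degenerate[OF F' r(1) r' c] by blast
    show thesis by (rule that[OF v(1,2) v'(1,2)]) (simp_all add: v(3,4) v'(3,4))
  next
    case False
    have nd: "r = 0\<^sub>v m" if "r \<in> carrier_vec m" "\<And>a. a \<in> carrier_vec m \<Longrightarrow> form n (F *\<^sub>v a) (F *\<^sub>v r) = 0" for r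
      using False that by blast
    have nd': "r = 0\<^sub>v m" if "r \<in> carrier_vec m" "\<And>a. a \<in> carrier_vec m \<Longrightarrow> form n (F' *\<^sub>v a) (F' *\<^sub>v r) = 0" for r
      using nd[of r] that G by simp
    obtain v where v: "v \<in> carrier_vec n" "\<And>a. a \<in> carrier_vec m \<Longrightarrow> v \<noteq> F *\<^sub>v a"
      "\<And>a. a \<in> carrier_vec m \<Longrightarrow> form n (F *\<^sub>v a) v = 0" "form n v v = 1"
      using extend_nondegenerate[OF F mn nd] by blast
    obtain v' where v': "v' \<in> carrier_vec n" "\<And>a. a \<in> carrier_vec m \<Longrightarrow> v' \<noteq> F' *\<^sub>v a"
      "\<And>a. a \<in> carrier_vec m \<Longrightarrow> form n (F' *\<^sub>v a) v' = 0" "form n v' v' = 1"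
      using extend_nondegenerate[OF F' mn nd'] by blast
    show thesis by (rule that[OF v(1,2) v'(1,2)]) (simp_all add: v(3,4) v'(3,4))
  qed
  have snoc: "form n (snoc_col F v *\<^sub>v a) (snoc_col F v *\<^sub>v b) = form n (snoc_col F' v' *\<^sub>v a) (snoc_col F' v' *\<^sub>v b)"
    if ab: "a \<in> carrier_vec (Suc m)" "b \<in> carrier_vec (Suc m)" for a b
  proof -
    let ?a = "vec m (($) a)" and ?b = "vec m (($) b)"
    have 1: "form n (F *\<^sub>v ?a) v = form n (F' *\<^sub>v ?a) v'" by (rule same) simp
    have 2: "form n v (F *\<^sub>v ?b) = form n v' (F' *\<^sub>v ?b)"
      using form_conj[of n v "F *\<^sub>v ?b"] form_conj[of n v' "F' *\<^sub>v ?b"] same(1)[of ?b] by simp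
    have 3: "form n (F *\<^sub>v ?a) (F *\<^sub>v ?b) = form n (F' *\<^sub>v ?a) (F' *\<^sub>v ?b)" by (rule G) auto
    have exp: "form n (x + s \<cdot>\<^sub>v y) (z + t \<cdot>\<^sub>v y) = form n x z + t ^ q * form n x y + s * form n y z + s * t ^ q * form n y y"
      if "x \<in> carrier_vec n" "y \<in> carrier_vec n" "z \<in> carrier_vec n" for x y z s t
      using that by (simp add: form_add_right form_smult_right form_add_left form_smult_left algebra_simps)
    show ?thesis
      unfolding snoc_col_mult_vec[OF F(2) v(1) ab(1)] snoc_col_mult_vec[OF F(2) v(1) ab(2)]
        snoc_col_mult_vec[OF F'(2) v'(1) ab(1)] snoc_col_mult_vec[OF F'(2) v'(1) ab(2)]
      using F F' v v' 1 2 3 same(2) by (subst (1 2) exp) auto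
  qed
  have "\<exists>A \<in> unitary_group n q. A * snoc_col F v = snoc_col F' v'"
    using Suc.hyps(1)[OF k full_col_rank_snoc[OF F v] snoc_col_carrier[OF F(2)]
        full_col_rank_snoc[OF F' v'] snoc_col_carrier[OF F'(2)]] snoc by blast
  then obtain A where A: "A \<in> unitary_group n q" "A * snoc_col F v = snoc_col F' v'" by blast
  have Ac: "A \<in> carrier_mat n n" using A by (simp add: unitary_group_def)
  have "A * F = F'"
  proof (rule eq_matI)
    fix i j assume "i < dim_row F'" "j < dim_col F'"
    then have ij: "i < n" "j < m" using F' by auto
    have "col (snoc_col F v) j = col F j"
      using F ij by (intro eq_vecI) (auto simp: snoc_col_def)
    moreover have "dim_col (snoc_col F v) = Suc m" using F by (simp add: snoc_col_def)
    ultimately have "(A * F) $$ (i, j) = (A * snoc_col F v) $$ (i, j)"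
      using Ac F ij by simp
    also have "\<dots> = F' $$ (i, j)" unfolding A(2) using F' ij by (simp add: snoc_col_def)
    finally show "(A * F) $$ (i, j) = F' $$ (i, j)" .
  qed (use Ac F F' in auto)
  then show ?case using A by blast
qed

end

section \<open>Polynomials acting on vectors and on sequences\<close>

text \<open>Horner evaluation of \<open>p\<close> at \<open>A\<close>. The explicit dimension fixes
  the value at the zero polynomial.\<close>

definition mat_poly :: "nat \<Rightarrow> 'a :: field mat \<Rightarrow> 'a poly \<Rightarrow> 'a mat" where
  "mat_poly n A p = fold_coeffs (\<lambda>c M. c \<cdot>\<^sub>m 1\<^sub>m n + A * M) p (0\<^sub>m n n)"

lemma mat_poly_0 [simp]: "mat_poly n A 0 = 0\<^sub>m n n"
  by (simp add: mat_poly_def)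

lemma mat_poly_pCons:
  assumes "A \<in> carrier_mat n n"
  shows "mat_poly n A (pCons a p) = a \<cdot>\<^sub>m 1\<^sub>m n + A * mat_poly n A p"
proof (cases "p = 0 \<and> a = 0")
  case True
  then show ?thesis using assms by (auto intro!: eq_matI)
next
  case False
  then show ?thesis by (auto simp: mat_poly_def)
qed

lemma mat_poly_carrier [simp]:
  assumes "A \<in> carrier_mat n n"
  shows "mat_poly n A p \<in> carrier_mat n n"
  using assms by (induction p) (auto simp: mat_poly_pCons)

lemma mat_poly_dim [simp]:
  assumes "A \<in> carrier_mat n n"
  shows "dim_row (mat_poly n A p) = n" "dim_col (mat_poly n A p) = n"
  using mat_poly_carrier[OF assms, of p] by auto

lemma mat_poly_add:
  assumes "A \<in> carrier_mat n n"
  shows "mat_poly n A (p + r) = mat_poly n A p + mat_poly n A r"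
proof (induction p r rule: poly_induct2)
  case (pCons a p b r)
  have eq: "A * (mat_poly n A p + mat_poly n A r) = A * mat_poly n A p + A * mat_poly n A r"
    by (rule mult_add_distrib_mat[OF assms mat_poly_carrier[OF assms] mat_poly_carrier[OF assms]])
  show ?case
    using assms by (simp add: mat_poly_pCons pCons.IH eq) (intro eq_matI, auto simp: algebra_simps)
qed auto

lemma mat_poly_smult:
  assumes "A \<in> carrier_mat n n"
  shows "mat_poly n A (Polynomial.smult c p) = c \<cdot>\<^sub>m mat_poly n A p"
proof (induction p)
  case (pCons a p)
  have "A * (c \<cdot>\<^sub>m mat_poly n A p) = c \<cdot>\<^sub>m (A * mat_poly n A p)"
    by (rule mult_smult_distrib[OF assms mat_poly_carrier[OF assms]])
  then show ?case
    using assms by (simp add: mat_poly_pCons pCons.IH) (intro eq_matI, auto simp: algebra_simps)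
qed auto

lemma mat_poly_1 [simp]:
  assumes "A \<in> carrier_mat n n"
  shows "mat_poly n A 1 = 1\<^sub>m n"
  using mat_poly_pCons[OF assms, of 1 0] assms by (auto simp: one_pCons intro!: eq_matI)

lemma mat_poly_mult:
  assumes "A \<in> carrier_mat n n"
  shows "mat_poly n A (p * r) = mat_poly n A p * mat_poly n A r"
proof (induction p)
  case (pCons a p)
  have "mat_poly n A (pCons a p * r) = a \<cdot>\<^sub>m mat_poly n A r + A * (mat_poly n A p * mat_poly n A r)"
    using assms by (simp add: mult_pCons_left mat_poly_add mat_poly_smult mat_poly_pCons pCons.IH)
      (intro eq_matI, auto)
  also have "A * (mat_poly n A p * mat_poly n A r) = (A * mat_poly n A p) * mat_poly n A r"
    using assms by (intro assoc_mult_mat[symmetric]) auto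
  also have "a \<cdot>\<^sub>m mat_poly n A r = (a \<cdot>\<^sub>m 1\<^sub>m n) * mat_poly n A r"
    using assms by (subst mult_smult_assoc_mat[of _ n n _ n]) auto
  also have "\<dots> + (A * mat_poly n A p) * mat_poly n A r = (a \<cdot>\<^sub>m 1\<^sub>m n + A * mat_poly n A p) * mat_poly n A r"
    using assms by (intro add_mult_distrib_mat[symmetric]) auto
  also have "\<dots> = mat_poly n A (pCons a p) * mat_poly n A r"
    using assms by (simp add: mat_poly_pCons)
  finally show ?case .
qed (use assms in auto)

lemma mat_poly_mult_vec:
  assumes "A \<in> carrier_mat n n" "v \<in> carrier_vec n"
  shows "mat_poly n A (p * r) *\<^sub>v v = mat_poly n A p *\<^sub>v (mat_poly n A r *\<^sub>v v)"
  using assms by (simp add: mat_poly_mult assoc_mult_mat_vec[of _ n n _ n])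

text \<open>The extra factor \<open>A\<close> of \<open>mat_poly_pCons\<close> is moved next to the
  vector; this is the recursion used by inductions that generalize over \<open>v\<close>.\<close>

lemma mat_poly_pCons_vec:
  assumes "A \<in> carrier_mat n n" "v \<in> carrier_vec n"
  shows "mat_poly n A (pCons a p) *\<^sub>v v = a \<cdot>\<^sub>v v + mat_poly n A p *\<^sub>v (A *\<^sub>v v)"
proof -
  have "pCons a p = [:a:] + p * [:0, 1:]" by simp
  moreover have "mat_poly n A [:a:] = a \<cdot>\<^sub>m 1\<^sub>m n"
    using assms by (auto simp: mat_poly_pCons)
  moreover have "mat_poly n A [:0, 1:] = A"
    using assms by (auto simp: mat_poly_pCons intro!: eq_matI)
  ultimately have "mat_poly n A (pCons a p) = a \<cdot>\<^sub>m 1\<^sub>m n + mat_poly n A p * A"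
    using mat_poly_add[OF assms(1), of "[:a:]" "p * [:0, 1:]"] mat_poly_mult[OF assms(1), of p "[:0, 1:]"]
    by simp
  then have "mat_poly n A (pCons a p) *\<^sub>v v = (a \<cdot>\<^sub>m 1\<^sub>m n) *\<^sub>v v + (mat_poly n A p * A) *\<^sub>v v"
    by (simp only:) (rule add_mult_distrib_mat_vec[of _ n n], use assms in auto)
  moreover have "(a \<cdot>\<^sub>m 1\<^sub>m n) *\<^sub>v v = a \<cdot>\<^sub>v v"
    using assms by (intro eq_vecI) (auto simp: scalar_prod_def if_distrib if_distribR cong: if_cong)
  ultimately show ?thesis using assms by (simp add: assoc_mult_mat_vec[of _ n n _ n])
qed

primrec orbit :: "'a :: semiring_0 mat \<Rightarrow> 'a vec \<Rightarrow> nat \<Rightarrow> 'a vec" where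
  "orbit A v 0 = v"
| "orbit A v (Suc k) = A *\<^sub>v orbit A v k"

lemma orbit_carrier [simp]:
  "A \<in> carrier_mat n n \<Longrightarrow> v \<in> carrier_vec n \<Longrightarrow> orbit A v k \<in> carrier_vec n"
  by (induction k) auto

lemma orbit_add: "orbit A v (i + k) = orbit A (orbit A v i) k"
  by (induction k) auto

lemma orbit_Suc_shift: "orbit A v (Suc k) = orbit A (A *\<^sub>v v) k"
  using orbit_add[of A v 1 k] by simp

lemma mat_poly_vec_index:
  assumes "A \<in> carrier_mat n n" "v \<in> carrier_vec n" "i < n" "degree p \<le> N"
  shows "(mat_poly n A p *\<^sub>v v) $ i = (\<Sum>k\<le>N. coeff p k * orbit A v k $ i)"
  using assms(2,4)
proof (induction p arbitrary: v N)
  case 0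
  then show ?case using assms by simp
next
  case (pCons a p)
  have Av: "A *\<^sub>v v \<in> carrier_vec n" using assms pCons.prems by auto
  have "(mat_poly n A (pCons a p) *\<^sub>v v) $ i = a * v $ i + (mat_poly n A p *\<^sub>v (A *\<^sub>v v)) $ i"
    using mat_poly_pCons_vec[OF assms(1) pCons.prems(1)] assms pCons.prems Av
    by (simp del: index_mult_mat_vec)
  also have "\<dots> = (\<Sum>k\<le>N. coeff (pCons a p) k * orbit A v k $ i)"
  proof (cases "p = 0")
    case True
    have "(\<Sum>k\<le>N. coeff (pCons a p) k * orbit A v k $ i) = (\<Sum>k\<le>N. if k = 0 then a * v $ i else 0)"
      using True by (intro sum.cong) (auto simp: coeff_pCons split: nat.splits)
    then show ?thesis using True assms Av by simp
  next
    case False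
    then obtain M where M: "N = Suc M" "degree p \<le> M" using pCons.prems(2) by (cases N) auto
    have "(mat_poly n A p *\<^sub>v (A *\<^sub>v v)) $ i = (\<Sum>k\<le>M. coeff p k * orbit A (A *\<^sub>v v) k $ i)"
      by (rule pCons.IH[OF Av M(2)])
    moreover have "(\<Sum>k\<le>Suc M. coeff (pCons a p) k * orbit A v k $ i)
        = a * v $ i + (\<Sum>k\<le>M. coeff p k * orbit A v (Suc k) $ i)"
      by (subst sum.atMost_Suc_shift) simp
    ultimately show ?thesis unfolding M(1) by (simp only: orbit_Suc_shift)
  qed
  finally show ?case .
qed

definition krylov :: "nat \<Rightarrow> 'a :: semiring_0 mat \<Rightarrow> 'a vec \<Rightarrow> nat \<Rightarrow> 'a mat" where
  "krylov n A v m = mat n m (\<lambda>(i, j). orbit A v j $ i)"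

lemma krylov_carrier [simp]: "krylov n A v m \<in> carrier_mat n m"
  by (simp add: krylov_def)

lemma krylov_mult_vec_index:
  assumes "c \<in> carrier_vec m" "i < n"
  shows "(krylov n A v m *\<^sub>v c) $ i = (\<Sum>j<m. orbit A v j $ i * c $ j)"
  using assms by (simp add: krylov_def scalar_prod_def lessThan_atLeast0)

text \<open>Combinations of Krylov columns are the vectors \<open>r(A) v\<close> with
  \<open>r\<close> of degree below \<open>m\<close>. Full column rank thus says that no nonzero such
  \<open>r\<close> kills \<open>v\<close>.\<close>

lemma krylov_mult_vec_poly:
  assumes "A \<in> carrier_mat n n" "v \<in> carrier_vec n" "c \<in> carrier_vec m"
  shows "krylov n A v m *\<^sub>v c = mat_poly n A (\<Sum>j<m. monom (c $ j) j) *\<^sub>v v"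
proof (cases m)
  case 0
  then show ?thesis using assms by (intro eq_vecI) (auto simp: krylov_def scalar_prod_def)
next
  case (Suc M)
  let ?p = "\<Sum>j<m. monom (c $ j) j"
  have co: "coeff ?p k = (if k < m then c $ k else 0)" for k
    by (simp add: coeff_sum)
  have "coeff ?p k = 0" if "M < k" for k unfolding co using that Suc by simp
  then have "degree ?p \<le> M" by (intro degree_le) blast
  show ?thesis
  proof (rule eq_vecI)
    fix i assume "i < dim_vec (mat_poly n A ?p *\<^sub>v v)"
    then have i: "i < n" using mat_poly_carrier[OF assms(1), of ?p] by simp
    show "(krylov n A v m *\<^sub>v c) $ i = (mat_poly n A ?p *\<^sub>v v) $ i"
    proof -
      have "(\<Sum>k\<le>M. coeff ?p k * orbit A v k $ i) = (\<Sum>k\<le>M. c $ k * orbit A v k $ i)"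
        unfolding co using Suc by (intro sum.cong) auto
      then show ?thesis
        unfolding mat_poly_vec_index[OF assms(1,2) i \<open>degree ?p \<le> M\<close>] krylov_mult_vec_index[OF assms(3) i]
        by (simp add: Suc lessThan_Suc_atMost mult.commute)
    qed
  qed (use mat_poly_carrier[OF assms(1), of ?p] in \<open>simp add: krylov_def\<close>)
qed

text \<open>Polynomials act on two-sided sequences with \<open>X\<close> as the shift by one, so
  that annihilation by \<open>f\<close> is a linear recurrence and a product of polynomials acts as
  a composition.\<close>

definition seq_act :: "'a :: field poly \<Rightarrow> (int \<Rightarrow> 'a) \<Rightarrow> int \<Rightarrow> 'a" where
  "seq_act p g = fold_coeffs (\<lambda>c G l. c * g l + G (l + 1)) p (\<lambda>_. 0)"

lemma seq_act_0 [simp]: "seq_act 0 g = (\<lambda>_. 0)"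
  by (simp add: seq_act_def)

lemma seq_act_pCons [simp]: "seq_act (pCons a p) g l = a * g l + seq_act p g (l + 1)"
  by (cases "p = 0 \<and> a = 0") (auto simp: seq_act_def)

lemma seq_act_add: "seq_act (p + r) g l = seq_act p g l + seq_act r g l"
  by (induction p r arbitrary: l rule: poly_induct2) (auto simp: algebra_simps)

lemma seq_act_smult: "seq_act (Polynomial.smult c p) g l = c * seq_act p g l"
  by (induction p arbitrary: l) (auto simp: algebra_simps)

lemma seq_act_zero_seq [simp]: "seq_act p (\<lambda>_. 0) = (\<lambda>_. 0)"
proof
  show "seq_act p (\<lambda>_. 0) l = 0" for l by (induction p arbitrary: l) auto
qed

lemma seq_act_mult: "seq_act (p * r) g l = seq_act p (seq_act r g) l"
  by (induction p arbitrary: l) (auto simp: mult_pCons_left seq_act_add seq_act_smult)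

lemma seq_act_sum: "degree p \<le> N \<Longrightarrow> seq_act p g l = (\<Sum>i\<le>N. coeff p i * g (l + int i))"
proof (induction p arbitrary: l N)
  case (pCons a p)
  show ?case
  proof (cases "p = 0")
    case True
    have "(\<Sum>i\<le>N. coeff (pCons a p) i * g (l + int i)) = (\<Sum>i\<le>N. if i = 0 then a * g l else 0)"
      using True by (intro sum.cong) (auto simp: coeff_pCons split: nat.splits)
    then show ?thesis using True by simp
  next
    case False
    then obtain M where M: "N = Suc M" "degree p \<le> M" using pCons.prems by (cases N) auto
    have "(\<Sum>i\<le>Suc M. coeff (pCons a p) i * g (l + int i))
      = a * g l + (\<Sum>i\<le>M. coeff p i * g (l + 1 + int i))"
      by (subst sum.atMost_Suc_shift) (simp add: algebra_simps)
    then show ?thesis using pCons.IH[OF M(2), of "l + 1"] M(1) by simp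
  qed
qed auto

section \<open>Counting pairs of an isometry and a cyclic vector\<close>

context unitary_field
begin

lemma unitary_carrier: "A \<in> unitary_group n q \<Longrightarrow> A \<in> carrier_mat n n"
  by (simp add: unitary_group_def)

lemma unitary_form:
  "A \<in> unitary_group n q \<Longrightarrow> x \<in> carrier_vec n \<Longrightarrow> y \<in> carrier_vec n \<Longrightarrow>
    form n (A *\<^sub>v x) (A *\<^sub>v y) = form n x y"
  by (simp add: unitary_group_def)

lemma unitary_inverse:
  assumes "(A :: 'a mat) \<in> unitary_group n q"
  obtains B where "B \<in> carrier_mat n n" "A * B = 1\<^sub>m n" "B * A = 1\<^sub>m n"
proof -
  have A: "A \<in> carrier_mat n n" "invertible_mat A" using assms by (auto simp: unitary_group_def)
  then obtain B where B: "A * B = 1\<^sub>m n" "B * A = 1\<^sub>m (dim_row B)"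
    by (auto simp: invertible_mat_def inverts_mat_def)
  have "dim_col B = n" using arg_cong[OF B(1), of dim_col] by simp
  moreover have "dim_row B = n" using arg_cong[OF B(2), of dim_col] A by simp
  ultimately show thesis using that[of B] B by auto
qed

lemma unitary_finite: "finite (unitary_group n q :: 'a mat set)"
  by (rule finite_subset[OF _ finite_carrier_mat[of n n]]) (auto simp: unitary_group_def)

lemma unitary_nonempty: "(unitary_group n q :: 'a mat set) \<noteq> {}"
proof -
  have "invertible_mat (1\<^sub>m n :: 'a mat)"
    by (rule invertible_mat_of_inverse[of _ n "1\<^sub>m n"]) auto
  then have "(1\<^sub>m n :: 'a mat) \<in> unitary_group n q" by (auto simp: unitary_group_def)
  then show ?thesis by blast
qed

lemma orbit_form_shift:
  assumes A: "A \<in> unitary_group n q" and "x \<in> carrier_vec n" "y \<in> carrier_vec n"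
  shows "form n (orbit A x (i + k)) (orbit A y (j + k)) = form n (orbit A x i) (orbit A y j)"
proof (induction k)
  case (Suc k)
  then show ?case using unitary_form[OF A] unitary_carrier[OF A] assms by simp
qed simp

text \<open>For an isometry the product of \<open>A^i v\<close> and \<open>A^j v\<close> depends
  only on \<open>i - j\<close>. As \<open>nat\<close> truncates at 0, one of the two exponents here
  is always 0.\<close>

definition gram_seq :: "nat \<Rightarrow> 'a mat \<Rightarrow> 'a vec \<Rightarrow> int \<Rightarrow> 'a" where
  "gram_seq n A v k = form n (orbit A v (nat k)) (orbit A v (nat (- k)))"

lemma gram_seq_eq:
  assumes A: "A \<in> unitary_group n q" and v: "v \<in> carrier_vec n"
  shows "form n (orbit A v i) (orbit A v j) = gram_seq n A v (int i - int j)"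
proof (cases "j \<le> i")
  case True
  then show ?thesis
    using orbit_form_shift[OF A v v, of "i - j" j 0] by (simp add: gram_seq_def nat_diff_distrib')
next
  case False
  then show ?thesis
    using orbit_form_shift[OF A v v, of 0 i "j - i"] by (simp add: gram_seq_def nat_diff_distrib')
qed

lemma gram_seq_conj: "gram_seq n A v (- k) ^ q = gram_seq n A v k"
  unfolding gram_seq_def using form_conj[of n "orbit A v (nat k)" "orbit A v (nat (- k))"] by simp

text \<open>The first recurrence comes from \<open>f(A) v = 0\<close> in the first argument of the
  form. The second comes from the second argument, which conjugates the coefficients and reverses
  the direction; after a shift it is the recurrence of the conjugate reciprocal of \<open>f\<close>
  (see \<open>recurrent_seq_act\<close>).\<close>

definition recurrent :: "'a poly \<Rightarrow> (int \<Rightarrow> 'a) set" where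
  "recurrent f = {g. (\<forall>l. (\<Sum>i\<le>degree f. coeff f i * g (l + int i)) = 0) \<and>
     (\<forall>l. (\<Sum>i\<le>degree f. coeff f i ^ q * g (l - int i)) = 0)}"

definition hermitian_recurrent :: "'a poly \<Rightarrow> (int \<Rightarrow> 'a) set" where
  "hermitian_recurrent f = {g \<in> recurrent f. (\<lambda>k. g (- k) ^ q) = g}"

lemma mat_poly_form:
  assumes "A \<in> carrier_mat n n" "v \<in> carrier_vec n"
  shows "form n (mat_poly n A p *\<^sub>v v) w = (\<Sum>k\<le>degree p. coeff p k * form n (orbit A v k) w)"
proof -
  have "form n (mat_poly n A p *\<^sub>v v) w
    = (\<Sum>i<n. \<Sum>k\<le>degree p. coeff p k * orbit A v k $ i * (w $ i) ^ q)"
    unfolding skew_form_def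
    by (intro sum.cong refl) (simp add: mat_poly_vec_index[OF assms _ order_refl] sum_distrib_right del: index_mult_mat_vec)
  also have "\<dots> = (\<Sum>k\<le>degree p. coeff p k * form n (orbit A v k) w)"
    unfolding skew_form_def by (subst sum.swap) (simp add: sum_distrib_left mult.assoc)
  finally show ?thesis .
qed

lemma mat_poly_orbit:
  assumes "A \<in> carrier_mat n n" "v \<in> carrier_vec n" "mat_poly n A p *\<^sub>v v = 0\<^sub>v n"
  shows "mat_poly n A p *\<^sub>v orbit A v k = 0\<^sub>v n"
proof (induction k)
  case (Suc k)
  have X: "mat_poly n A [:0, 1:] = A"
    using assms by (auto simp: mat_poly_pCons intro!: eq_matI)
  have w: "orbit A v k \<in> carrier_vec n" using assms by simp
  have "mat_poly n A p *\<^sub>v (A *\<^sub>v orbit A v k) = mat_poly n A (p * [:0, 1:]) *\<^sub>v orbit A v k"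
    using mat_poly_mult_vec[OF assms(1) w, of p "[:0, 1:]"] X by simp
  also have "p * [:0, 1:] = [:0, 1:] * p" by (simp only: mult.commute)
  also have "mat_poly n A ([:0, 1:] * p) *\<^sub>v orbit A v k = A *\<^sub>v (mat_poly n A p *\<^sub>v orbit A v k)"
    using mat_poly_mult_vec[OF assms(1) w, of "[:0, 1:]" p] X by simp
  also have "\<dots> = 0\<^sub>v n" unfolding Suc using assms(1) by (intro eq_vecI) auto
  finally show ?case by simp
qed (use assms in simp)

lemma gram_seq_hermitian_recurrent:
  assumes A: "A \<in> unitary_group n q" and v: "v \<in> carrier_vec n"
    and f: "mat_poly n A f *\<^sub>v v = 0\<^sub>v n"
  shows "gram_seq n A v \<in> hermitian_recurrent f"
proof -
  note Ac = unitary_carrier[OF A]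
  have z: "(\<Sum>k\<le>degree f. coeff f k * form n (orbit A v (i + k)) w) = 0" for i w
  proof -
    have "(\<Sum>k\<le>degree f. coeff f k * form n (orbit A (orbit A v i) k) w)
      = form n (mat_poly n A f *\<^sub>v orbit A v i) w"
      using mat_poly_form[OF Ac, of "orbit A v i" f w] Ac v by simp
    also have "\<dots> = 0" using mat_poly_orbit[OF Ac v f, of i] by simp
    finally show ?thesis by (simp add: orbit_add)
  qed
  have "(\<Sum>i\<le>degree f. coeff f i * gram_seq n A v (l + int i)) = 0" for l
  proof -
    \<comment> \<open>Shifting both exponents by \<open>N\<close> makes them natural numbers also
      for negative \<open>l\<close>.\<close>
    define N where "N = nat \<bar>l\<bar>"
    have "gram_seq n A v (l + int i) = form n (orbit A v (nat (l + int N) + i)) (orbit A v N)" for i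
      unfolding gram_seq_eq[OF A v] by (rule arg_cong[where f = "gram_seq n A v"]) (auto simp: N_def)
    then show ?thesis using z by simp
  qed
  moreover have "(\<Sum>i\<le>degree f. coeff f i ^ q * gram_seq n A v (l - int i)) = 0" for l
  proof -
    define N where "N = nat \<bar>l\<bar>"
    have "gram_seq n A v (l - int i) = form n (orbit A v (N + i)) (orbit A v (nat (l + int N))) ^ q" for i
    proof -
      have "gram_seq n A v (l - int i) = form n (orbit A v (nat (l + int N))) (orbit A v (N + i))"
        unfolding gram_seq_eq[OF A v] by (rule arg_cong[where f = "gram_seq n A v"]) (auto simp: N_def)
      then show ?thesis by (simp only: form_conj[symmetric])
    qed
    then have "(\<Sum>i\<le>degree f. coeff f i ^ q * gram_seq n A v (l - int i))
      = (\<Sum>i\<le>degree f. coeff f i * form n (orbit A v (N + i)) (orbit A v (nat (l + int N)))) ^ q"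
      by (simp add: frob_sum power_mult_distrib)
    then show ?thesis using z by simp
  qed
  ultimately show ?thesis
    unfolding hermitian_recurrent_def recurrent_def using gram_seq_conj by auto
qed

lemma krylov_form:
  assumes A: "A \<in> unitary_group n q" and v: "v \<in> carrier_vec n"
    and ab: "a \<in> carrier_vec m" "b \<in> carrier_vec m"
  shows "form n (krylov n A v m *\<^sub>v a) (krylov n A v m *\<^sub>v b) =
    (\<Sum>i<m. \<Sum>j<m. a $ i * (b $ j) ^ q * gram_seq n A v (int i - int j))"
proof -
  have "form n (krylov n A v m *\<^sub>v a) (krylov n A v m *\<^sub>v b)
    = (\<Sum>k<n. \<Sum>i<m. \<Sum>j<m. (orbit A v i $ k * a $ i) * ((orbit A v j $ k) ^ q * (b $ j) ^ q))"
    unfolding skew_form_def using ab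
    by (intro sum.cong refl)
      (simp add: krylov_mult_vec_index frob_sum power_mult_distrib sum_product del: index_mult_mat_vec)
  also have "\<dots> = (\<Sum>i<m. \<Sum>k<n. \<Sum>j<m. (orbit A v i $ k * a $ i) * ((orbit A v j $ k) ^ q * (b $ j) ^ q))"
    by (rule sum.swap)
  also have "\<dots> = (\<Sum>i<m. \<Sum>j<m. a $ i * (b $ j) ^ q * form n (orbit A v i) (orbit A v j))"
    unfolding skew_form_def
    by (rule sum.cong[OF refl], subst sum.swap) (simp add: sum_distrib_left algebra_simps)
  finally show ?thesis by (simp only: gram_seq_eq[OF A v])
qed

text \<open>The rank condition says that no proper divisor of \<open>f\<close> annihilates \<open>v\<close>, i.e. \<open>f\<close> is the
  minimal polynomial of \<open>v\<close> under \<open>A\<close>.\<close>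

definition cyclic_vecs :: "nat \<Rightarrow> 'a mat \<Rightarrow> 'a poly \<Rightarrow> 'a vec set" where
  "cyclic_vecs n A f = {v \<in> carrier_vec n. mat_poly n A f *\<^sub>v v = 0\<^sub>v n \<and>
     full_col_rank (krylov n A v (degree f))}"

lemma unitary_cancel:
  assumes "A \<in> carrier_mat n n" "A' \<in> carrier_mat n n" "(H :: 'a mat) \<in> unitary_group n q" "A * H = A' * H"
  shows "A = A'"
proof -
  obtain B where B: "B \<in> carrier_mat n n" "H * B = 1\<^sub>m n" using unitary_inverse[OF assms(3)] by blast
  have H: "H \<in> carrier_mat n n" by (rule unitary_carrier[OF assms(3)])
  have "X * H * B = X" if "X \<in> carrier_mat n n" for X
    using that B H by (simp add: assoc_mult_mat[of _ n n _ n _ n])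
  then show ?thesis using assms by metis
qed

lemma unitary_mult:
  assumes "A \<in> unitary_group n q" "(H :: 'a mat) \<in> unitary_group n q"
  shows "A * H \<in> unitary_group n q"
proof -
  note c = unitary_carrier[OF assms(1)] unitary_carrier[OF assms(2)]
  obtain B where B: "B \<in> carrier_mat n n" "A * B = 1\<^sub>m n" "B * A = 1\<^sub>m n"
    using unitary_inverse[OF assms(1)] by blast
  obtain C where C: "C \<in> carrier_mat n n" "H * C = 1\<^sub>m n" "C * H = 1\<^sub>m n"
    using unitary_inverse[OF assms(2)] by blast
  have 1: "(A * H) * (C * B) = 1\<^sub>m n"
  proof -
    have "(A * H) * (C * B) = A * ((H * C) * B)"
      using c B(1) C(1) by (simp add: assoc_mult_mat[of _ n n _ n _ n])
    then show ?thesis using B C by simp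
  qed
  have 2: "(C * B) * (A * H) = 1\<^sub>m n"
  proof -
    have "(C * B) * (A * H) = C * ((B * A) * H)"
      using c B(1) C(1) by (simp add: assoc_mult_mat[of _ n n _ n _ n])
    then show ?thesis using B C c by simp
  qed
  have inv: "invertible_mat (A * H)"
    by (rule invertible_mat_of_inverse[OF _ _ 1 2]) (use c B C in auto)
  have "form n (A * H *\<^sub>v x) (A * H *\<^sub>v y) = form n x y" if "x \<in> carrier_vec n" "y \<in> carrier_vec n" for x y
  proof -
    have "A * H *\<^sub>v z = A *\<^sub>v (H *\<^sub>v z)" if "z \<in> carrier_vec n" for z
      by (rule assoc_mult_mat_vec[OF c that])
    then show ?thesis using that unitary_form[OF assms(1)] unitary_form[OF assms(2)] c by simp
  qed
  then show ?thesis using inv c by (simp add: unitary_group_def)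
qed

text \<open>Fix one frame \<open>F\<^sub>0\<close> with the given Gram matrix, and for every other such frame \<open>F\<close> an isometry
  \<open>h F\<close> mapping \<open>F\<^sub>0\<close> to \<open>F\<close>. If \<open>F\<close> is the Krylov frame of \<open>(A, v)\<close>, then \<open>A * h F\<close> maps \<open>F\<^sub>0\<close> to \<open>A * F\<close>, from
  which the recurrence of \<open>f\<close> recovers \<open>v\<close>; so \<open>(A, v) \<mapsto> A * h F\<close> is injective.\<close>

lemma card_cyclic_pairs_gram:
  assumes f: "coeff f 0 \<noteq> 0"
  shows "card {(A, v). A \<in> unitary_group n q \<and> v \<in> cyclic_vecs n A f \<and> gram_seq n A v = g}
    \<le> card (unitary_group n q :: 'a mat set)" (is "card ?S \<le> _")
proof (cases "?S = {}")
  case False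
  let ?m = "degree f"
  obtain A0 v0 where 0: "A0 \<in> unitary_group n q" "v0 \<in> cyclic_vecs n A0 f" "gram_seq n A0 v0 = g"
    using False by auto
  define F0 where "F0 = krylov n A0 v0 ?m"
  have F0: "F0 \<in> carrier_mat n ?m" by (simp add: F0_def)
  have ex: "\<exists>H \<in> unitary_group n q. H * F0 = krylov n A v ?m" if "(A, v) \<in> ?S" for A v
    unfolding F0_def
  proof (rule witt_extension[where m = ?m])
    fix a b :: "'a vec" assume ab: "a \<in> carrier_vec ?m" "b \<in> carrier_vec ?m"
    show "form n (krylov n A0 v0 ?m *\<^sub>v a) (krylov n A0 v0 ?m *\<^sub>v b)
      = form n (krylov n A v ?m *\<^sub>v a) (krylov n A v ?m *\<^sub>v b)"
      using that 0 ab krylov_form[of A n v a ?m b] krylov_form[of A0 n v0 a ?m b]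
      by (simp add: cyclic_vecs_def)
  qed (use that 0 in \<open>auto simp: cyclic_vecs_def\<close>)
  define h where "h F = (SOME H. H \<in> unitary_group n q \<and> H * F0 = F)" for F :: "'a mat"
  have h: "h (krylov n A v ?m) \<in> unitary_group n q" "h (krylov n A v ?m) * F0 = krylov n A v ?m"
    if "(A, v) \<in> ?S" for A v
    using someI_ex[of "\<lambda>H. H \<in> unitary_group n q \<and> H * F0 = krylov n A v ?m"] ex[OF that]
    by (auto simp: h_def)
  let ?\<psi> = "\<lambda>(A, v). A * h (krylov n A v ?m)"
  show ?thesis
  proof (rule card_inj_on_le[where f = ?\<psi>])
    show "inj_on ?\<psi> ?S"
    proof (rule inj_onI)
      fix X Y assume XY: "X \<in> ?S" "Y \<in> ?S" "?\<psi> X = ?\<psi> Y"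
      obtain A v B w where X: "X = (A, v)" and Y: "Y = (B, w)" by (cases X, cases Y) blast
      have A: "(A, v) \<in> ?S" and B: "(B, w) \<in> ?S"
        and eq: "A * h (krylov n A v ?m) = B * h (krylov n B w ?m)"
        using XY X Y by auto
      have Ac: "A \<in> carrier_mat n n" "B \<in> carrier_mat n n" "v \<in> carrier_vec n" "w \<in> carrier_vec n"
        using A B unitary_carrier by (auto simp: cyclic_vecs_def)
      have cols: "(A * (h (krylov n A v ?m) * F0)) $$ (i, j) = orbit A v (Suc j) $ i"
        if "(A, v) \<in> ?S" "A \<in> carrier_mat n n" "v \<in> carrier_vec n" "i < n" "j < ?m" for A v i j
      proof -
        have "col (krylov n A v ?m) j = orbit A v j"
        proof (rule eq_vecI)
          have d: "dim_vec (orbit A v j) = n" by (rule carrier_vecD[OF orbit_carrier[OF that(2,3)]])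
          show "dim_vec (col (krylov n A v ?m) j) = dim_vec (orbit A v j)"
            unfolding d by (simp add: krylov_def)
          fix k assume "k < dim_vec (orbit A v j)"
          then show "col (krylov n A v ?m) j $ k = orbit A v j $ k"
            unfolding d using that by (simp add: krylov_def)
        qed
        then show ?thesis unfolding h(2)[OF that(1)] using that by (simp add: krylov_def)
      qed
      have "A * (h (krylov n A v ?m) * F0) = B * (h (krylov n B w ?m) * F0)"
        unfolding assoc_mult_mat[OF Ac(1) unitary_carrier[OF h(1)[OF A]] F0, symmetric]
          assoc_mult_mat[OF Ac(2) unitary_carrier[OF h(1)[OF B]] F0, symmetric] eq ..
      then have orb_i: "orbit A v (Suc j) $ i = orbit B w (Suc j) $ i" if "i < n" "j < ?m" for i j
        using cols[OF A Ac(1,3) that] cols[OF B Ac(2,4) that] by simp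
      have orb: "orbit A v (Suc j) = orbit B w (Suc j)" if "j < ?m" for j
      proof (rule eq_vecI)
        have d: "dim_vec (orbit A v (Suc j)) = n" "dim_vec (orbit B w (Suc j)) = n"
          using carrier_vecD[OF orbit_carrier[OF Ac(1,3)]] carrier_vecD[OF orbit_carrier[OF Ac(2,4)]]
          by blast+
        show "dim_vec (orbit A v (Suc j)) = dim_vec (orbit B w (Suc j))" unfolding d ..
        show "orbit A v (Suc j) $ i = orbit B w (Suc j) $ i" if "i < dim_vec (orbit B w (Suc j))" for i
          using that orb_i[OF _ \<open>j < ?m\<close>] unfolding d by blast
      qed
      have vi: "coeff f 0 * u $ i = - (\<Sum>k=1..?m. coeff f k * orbit C u k $ i)"
        if "(C, u) \<in> ?S" "C \<in> carrier_mat n n" "u \<in> carrier_vec n" "i < n" for C u i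
      proof -
        have "0 = (\<Sum>k\<le>?m. coeff f k * orbit C u k $ i)"
          using that mat_poly_vec_index[OF that(2,3,4), of f ?m] by (simp add: cyclic_vecs_def del: index_mult_mat_vec)
        also have "\<dots> = coeff f 0 * u $ i + (\<Sum>k=1..?m. coeff f k * orbit C u k $ i)"
          by (simp add: atMost_atLeast0 sum.atLeast_Suc_atMost)
        finally show ?thesis by (simp add: eq_neg_iff_add_eq_0)
      qed
      have sums: "(\<Sum>k=1..?m. coeff f k * orbit A v k $ i) = (\<Sum>k=1..?m. coeff f k * orbit B w k $ i)" for i
      proof (rule sum.cong[OF refl])
        fix k assume "k \<in> {1..?m}"
        then obtain j where "k = Suc j" "j < ?m" by (cases k) auto
        then show "coeff f k * orbit A v k $ i = coeff f k * orbit B w k $ i" using orb[of j] by simp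
      qed
      have "v $ i = w $ i" if "i < n" for i
      proof -
        have "coeff f 0 * v $ i = coeff f 0 * w $ i"
          unfolding vi[OF A Ac(1,3) that] vi[OF B Ac(2,4) that] sums ..
        then show ?thesis using f by simp
      qed
      then have vw: "v = w" using Ac by (intro eq_vecI) auto
      have "orbit A v j $ i = orbit B w j $ i" if "j < ?m" for i j
        using vw orb[of "j - 1"] that by (cases j) auto
      then have kr: "krylov n A v ?m = krylov n B w ?m" by (intro eq_matI) (auto simp: krylov_def)
      then have "A = B" using unitary_cancel[OF Ac(1,2) h(1)[OF A]] eq by simp
      then show "X = Y" using X Y vw by simp
    qed
    show "?\<psi> ` ?S \<subseteq> unitary_group n q" using h(1) unitary_mult by auto
  qed (rule unitary_finite)
next
  case True
  then show ?thesis by (simp only: card.empty le0)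
qed

text \<open>The pairs are partitioned by their Gram sequences, all of which lie in
  \<open>hermitian_recurrent f\<close>.\<close>

lemma card_cyclic_pairs:
  assumes f: "coeff f 0 \<noteq> 0" and fin: "finite (hermitian_recurrent f)"
  shows "(\<Sum>A \<in> unitary_group n q. card (cyclic_vecs n A f))
    \<le> card (unitary_group n q :: 'a mat set) * card (hermitian_recurrent f)"
proof -
  let ?U = "unitary_group n q :: 'a mat set"
  let ?S = "\<lambda>g. {(A, v). A \<in> ?U \<and> v \<in> cyclic_vecs n A f \<and> gram_seq n A v = g}"
  have fin_c: "finite (cyclic_vecs n A f)" for A
    by (rule finite_subset[OF _ finite_carrier_vec[of n]]) (auto simp: cyclic_vecs_def)
  have "(\<Sum>A\<in>?U. card (cyclic_vecs n A f)) = card (SIGMA A:?U. cyclic_vecs n A f)"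
    using unitary_finite fin_c by (simp add: card_SigmaI)
  also have "(SIGMA A:?U. cyclic_vecs n A f) = (\<Union>g \<in> hermitian_recurrent f. ?S g)"
    using gram_seq_hermitian_recurrent by (auto simp: cyclic_vecs_def)
  also have "card \<dots> \<le> (\<Sum>g \<in> hermitian_recurrent f. card (?S g))"
    by (rule card_UN_le[OF fin])
  also have "\<dots> \<le> (\<Sum>g \<in> hermitian_recurrent f. card ?U)"
    by (intro sum_mono card_cyclic_pairs_gram f)
  finally show ?thesis by (simp add: mult.commute)
qed

end

section \<open>Counting the Hermitian solutions of the recurrences\<close>

context unitary_field
begin

lemma recurrent_lin:
  assumes "x \<in> recurrent f" "y \<in> recurrent f"
  shows "(\<lambda>i. a * x i + b * y i) \<in> recurrent f"
proof -
  have "(\<Sum>i\<le>degree f. c i * (a * x (t i) + b * y (t i))) =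
     a * (\<Sum>i\<le>degree f. c i * x (t i)) + b * (\<Sum>i\<le>degree f. c i * y (t i))" for c and t :: "nat \<Rightarrow> int"
    by (simp add: sum_distrib_left sum.distrib[symmetric] algebra_simps)
  then show ?thesis using assms by (simp add: recurrent_def)
qed

text \<open>The window of zeros grows by one place in each direction: the leading coefficient is
  invertible, which propagates it upwards, and so is the constant one, which propagates it
  downwards.\<close>

lemma recurrent_zero_of_window:
  assumes f: "coeff f 0 \<noteq> 0" and g: "g \<in> recurrent f"
    and z: "\<And>k. 0 \<le> k \<Longrightarrow> k < int (degree f) \<Longrightarrow> g k = 0"
  shows "g = (\<lambda>_. 0)"
proof -
  let ?m = "degree f"
  have lead: "coeff f ?m \<noteq> 0" using f by (metis coeff_0 leading_coeff_0_iff)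
  have rec: "(\<Sum>i\<le>?m. coeff f i * g (l + int i)) = 0" for l
    using g by (simp add: recurrent_def)
  have all: "\<forall>k. - int N \<le> k \<and> k < int N + int ?m \<longrightarrow> g k = 0" for N
  proof (induction N)
    case 0
    then show ?case using z by simp
  next
    case (Suc N)
    have up: "g (int N + int ?m) = 0"
    proof -
      have "0 = (\<Sum>i\<le>?m. coeff f i * g (int N + int i))" using rec by simp
      also have "\<dots> = (\<Sum>i\<in>{?m}. coeff f i * g (int N + int i))"
        using Suc by (intro sum.mono_neutral_right) auto
      finally show ?thesis using lead by simp
    qed
    have down: "g (- int N - 1) = 0"
    proof -
      have "0 = (\<Sum>i\<le>?m. coeff f i * g (- int N - 1 + int i))" using rec by simp
      also have "\<dots> = (\<Sum>i\<in>{0}. coeff f i * g (- int N - 1 + int i))"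
      proof (intro sum.mono_neutral_right ballI)
        fix i assume "i \<in> {..?m} - {0}"
        then have "- int N \<le> - int N - 1 + int i" "- int N - 1 + int i < int N + int ?m" by auto
        then show "coeff f i * g (- int N - 1 + int i) = 0" using Suc by simp
      qed auto
      finally show ?thesis using f by simp
    qed
    show ?case
    proof (intro allI impI)
      fix k assume k: "- int (Suc N) \<le> k \<and> k < int (Suc N) + int ?m"
      then consider "k = int N + int ?m" | "k = - int N - 1" | "- int N \<le> k \<and> k < int N + int ?m"
        by linarith
      then show "g k = 0" using up down Suc by cases auto
    qed
  qed
  have "g k = 0" for k
  proof -
    have "- int (nat \<bar>k\<bar> + 1) \<le> k \<and> k < int (nat \<bar>k\<bar> + 1) + int ?m" by auto
    then show ?thesis using all by blast
  qed
  then show ?thesis by auto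
qed

lemma recurrent_card:
  assumes f: "coeff f 0 \<noteq> 0"
  shows "finite (recurrent f)" "card (recurrent f) \<le> CARD('a) ^ degree f"
proof -
  let ?m = "degree f"
  let ?r = "\<lambda>g. restrict (\<lambda>i. g (int i)) {..<?m}"
  have inj: "inj_on ?r (recurrent f)"
  proof (rule inj_onI)
    fix g g' assume g: "g \<in> recurrent f" "g' \<in> recurrent f" and eq: "?r g = ?r g'"
    have "(\<lambda>i. 1 * g i + (- 1) * g' i) = (\<lambda>_. 0)"
    proof (rule recurrent_zero_of_window[OF f recurrent_lin[OF g]])
      fix k assume "0 \<le> k" "k < int ?m"
      then have "g k = g' k" using fun_cong[OF eq, of "nat k"] by (simp split: if_splits)
      then show "1 * g k + (- 1) * g' k = 0" by simp
    qed
    then show "g = g'" by (auto simp: fun_eq_iff)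
  qed
  have img: "?r ` recurrent f \<subseteq> PiE {..<?m} (\<lambda>_. UNIV)"
    by (intro image_subsetI) (simp add: restrict_PiE_iff)
  have fin: "finite (PiE {..<?m} (\<lambda>_. UNIV :: 'a set))" by (simp add: finite_PiE)
  show "finite (recurrent f)" using inj_on_finite[OF inj img fin] .
  show "card (recurrent f) \<le> CARD('a) ^ degree f"
    using card_inj_on_le[OF inj img fin] by (simp add: card_PiE)
qed

text \<open>The semilinear involution \<open>g \<mapsto> (\<lambda>k. g (- k) ^ q)\<close> exchanges
  the two defining recurrences, so it preserves \<open>recurrent f\<close>. By
  \<open>real_form_card\<close> its fixed points number the square root of a cardinality that is at
  most \<open>q ^ (2 * degree f)\<close>.\<close>

lemma hermitian_recurrent_card:
  assumes f: "coeff f 0 \<noteq> 0"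
  shows "finite (hermitian_recurrent f)" "card (hermitian_recurrent f) \<le> q ^ degree f"
proof -
  show fin: "finite (hermitian_recurrent f)"
    by (rule finite_subset[OF _ recurrent_card(1)[OF f]]) (auto simp: hermitian_recurrent_def)
  have "card (hermitian_recurrent f) ^ 2 = card (recurrent f)"
    unfolding hermitian_recurrent_def
  proof (rule real_form_card[OF recurrent_card(1)[OF f]])
    fix x assume x: "x \<in> recurrent f"
    have "(\<Sum>i\<le>degree f. coeff f i * x (- (l + int i)) ^ q) = 0" for l
    proof -
      have "(\<Sum>i\<le>degree f. coeff f i * x (- (l + int i)) ^ q)
        = (\<Sum>i\<le>degree f. coeff f i ^ q * x (- l - int i)) ^ q"
        by (simp add: frob_sum power_mult_distrib)
      also have "\<dots> = 0" using x by (simp add: recurrent_def)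
      finally show ?thesis .
    qed
    moreover have "(\<Sum>i\<le>degree f. coeff f i ^ q * x (- (l - int i)) ^ q) = 0" for l
    proof -
      have "(\<Sum>i\<le>degree f. coeff f i ^ q * x (- (l - int i)) ^ q)
        = (\<Sum>i\<le>degree f. coeff f i * x (- l + int i)) ^ q"
        by (simp add: frob_sum power_mult_distrib)
      also have "(\<Sum>i\<le>degree f. coeff f i * x (- l + int i)) = 0"
        using x unfolding recurrent_def by blast
      finally show ?thesis by simp
    qed
    ultimately show "(\<lambda>k. x (- k) ^ q) \<in> recurrent f" unfolding recurrent_def by blast
  qed (auto simp: recurrent_lin frob_add power_mult_distrib)
  also have "\<dots> \<le> (q ^ degree f) ^ 2"
    using recurrent_card(2)[OF f] by (simp add: card_field power_mult[symmetric] mult.commute)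
  finally show "card (hermitian_recurrent f) \<le> q ^ degree f"
    using power2_nat_le_eq_le by blast
qed

text \<open>This is the \<open>f\<^sup>*\<close> of the overview. If
  \<open>coeff f 0 \<noteq> 0\<close>, its roots in an algebraic closure are the inverses of the
  \<open>q\<close>-th powers of the roots of \<open>f\<close>.\<close>

definition conj_reflect :: "'a poly \<Rightarrow> 'a poly" where
  "conj_reflect f = reflect_poly (map_poly (\<lambda>c. c ^ q) f)"

lemma coeff_map_frob [simp]: "coeff (map_poly (\<lambda>c. c ^ q) f) i = (coeff f i :: 'a) ^ q"
  by (simp add: coeff_map_poly)

lemma degree_map_frob [simp]: "degree (map_poly (\<lambda>c. (c :: 'a) ^ q) f) = degree f"
  by (rule degree_map_poly) simp

lemma coeff_conj_reflect:
  "coeff (conj_reflect f) i = (if i \<le> degree f then coeff f (degree f - i) ^ q else 0)"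
  by (simp add: conj_reflect_def coeff_reflect_poly)

lemma recurrent_seq_act:
  assumes "g \<in> recurrent f"
  shows "seq_act f g = (\<lambda>_. 0)" "seq_act (conj_reflect f) g = (\<lambda>_. 0)"
proof -
  show "seq_act f g = (\<lambda>_. 0)"
    using assms by (auto simp: recurrent_def seq_act_sum[OF order_refl])
  show "seq_act (conj_reflect f) g = (\<lambda>_. 0)"
  proof
    fix l
    have "degree (conj_reflect f) \<le> degree f" by (rule degree_le) (simp add: coeff_conj_reflect)
    then have "seq_act (conj_reflect f) g l = (\<Sum>i\<le>degree f. coeff f (degree f - i) ^ q * g (l + int i))"
      by (simp add: seq_act_sum coeff_conj_reflect)
    also have "\<dots> = (\<Sum>i\<le>degree f. coeff f i ^ q * g (l + int (degree f) - int i))"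
      by (rule sum.reindex_bij_witness[where i = "\<lambda>i. degree f - i" and j = "\<lambda>i. degree f - i"])
        (auto simp: of_nat_diff algebra_simps)
    also have "\<dots> = 0" using assms by (simp add: recurrent_def)
    finally show "seq_act (conj_reflect f) g l = 0" .
  qed
qed

text \<open>Both summands of the Bezout identity kill a recurrent sequence, while the constant 1
  acts as the identity.\<close>

lemma hermitian_recurrent_trivial:
  assumes "a * f + b * conj_reflect f = 1"
  shows "hermitian_recurrent f = {\<lambda>_. 0}"
proof
  show "hermitian_recurrent f \<subseteq> {\<lambda>_. 0}"
  proof
    fix g assume "g \<in> hermitian_recurrent f"
    then have g: "g \<in> recurrent f" by (simp add: hermitian_recurrent_def)
    have "g l = 0" for l
    proof -
      have "g l = seq_act 1 g l" by (simp add: one_pCons)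
      also have "\<dots> = seq_act a (seq_act f g) l + seq_act b (seq_act (conj_reflect f) g) l"
        unfolding assms[symmetric] by (simp add: seq_act_add seq_act_mult)
      also have "\<dots> = 0" by (simp add: recurrent_seq_act[OF g])
      finally show ?thesis .
    qed
    then show "g \<in> {\<lambda>_. 0}" by auto
  qed
  show "{\<lambda>_. 0} \<subseteq> hermitian_recurrent f"
    by (auto simp: hermitian_recurrent_def recurrent_def)
qed

text \<open>With only the zero Gram sequence available, the Krylov vectors of \<open>v\<close> span
  an isotropic subspace of dimension \<open>degree f\<close>.\<close>

lemma cyclic_vecs_isotropic:
  assumes A: "A \<in> unitary_group n q" and v: "v \<in> cyclic_vecs n A f"
    and triv: "hermitian_recurrent f = {\<lambda>_. 0}"
  shows "2 * degree f \<le> n"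
proof (rule isotropic_frame_le)
  have v': "v \<in> carrier_vec n" "mat_poly n A f *\<^sub>v v = 0\<^sub>v n" using v by (auto simp: cyclic_vecs_def)
  have g: "gram_seq n A v = (\<lambda>_. 0)"
    using gram_seq_hermitian_recurrent[OF A v'] triv by simp
  show "form n (krylov n A v (degree f) *\<^sub>v a) (krylov n A v (degree f) *\<^sub>v b) = 0"
    if "a \<in> carrier_vec (degree f)" "b \<in> carrier_vec (degree f)" for a b
    using krylov_form[OF A v'(1) that] g by simp
qed (use v in \<open>auto simp: cyclic_vecs_def\<close>)

end

section \<open>Irreducible factors of the characteristic polynomial\<close>

text \<open>Euclid's algorithm. The \<open>Suc\<close> in the measure separates a nonzero constant
  \<open>g\<close> from \<open>g = 0\<close>.\<close>

lemma poly_bezout: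
  fixes f g :: "'a :: field poly"
  shows "\<exists>a b h. a * f + b * g = h \<and> h dvd f \<and> h dvd g"
proof (induction "if g = 0 then 0 else Suc (degree g)" arbitrary: f g rule: less_induct)
  case less
  show ?case
  proof (cases "g = 0")
    case True
    then have "1 * f + 0 * g = f \<and> f dvd f \<and> f dvd g" by simp
    then show ?thesis by blast
  next
    case False
    have "(if f mod g = 0 then 0 else Suc (degree (f mod g))) < (if g = 0 then 0 else Suc (degree g))"
      using False degree_mod_less'[of g f] by auto
    from less[OF this] obtain a b h where h: "a * g + b * (f mod g) = h" "h dvd g" "h dvd f mod g"
      by blast
    have "b * f + (a - b * (f div g)) * g = a * g + b * (f - f div g * g)"
      by (simp add: algebra_simps)
    also have "f - f div g * g = f mod g" by (rule minus_div_mult_eq_mod)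
    finally have "b * f + (a - b * (f div g)) * g = h" using h(1) by simp
    moreover have "h dvd f" using h(2,3) by (simp add: dvd_mod_iff)
    ultimately show ?thesis using h(2) by blast
  qed
qed

lemma irreducible_bezout:
  fixes \<phi> s :: "'a :: field poly"
  assumes "irreducible \<phi>" "\<not> \<phi> dvd s"
  shows "\<exists>a b. a * s + b * \<phi> = 1"
proof -
  obtain a b h where h: "a * s + b * \<phi> = h" "h dvd s" "h dvd \<phi>" using poly_bezout by blast
  from h(3) obtain c where c: "\<phi> = h * c" by blast
  have "h dvd 1"
  proof (rule ccontr)
    assume "\<not> h dvd 1"
    then have "c dvd 1" using irreducibleD[OF assms(1) c] by blast
    then obtain e where "c * e = 1" by (metis dvdE)
    then have "h = \<phi> * e" unfolding c by (simp add: mult.assoc)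
    then have "\<phi> dvd s" using h(2) dvd_mult_left by blast
    then show False using assms(2) by simp
  qed
  then obtain e where "h * e = 1" by (metis dvdE)
  then have "(e * a) * s + (e * b) * \<phi> = 1"
    using h(1) by (metis distrib_left mult.assoc mult.commute)
  then show ?thesis by blast
qed

text \<open>Coprimality is carried as an explicit identity. This step and the next two lemmas pass
  it on to products and powers.\<close>

lemma bezout_mult:
  fixes s f g :: "'a :: comm_ring_1"
  assumes "a * s + b * f = 1" "a' * s + b' * g = 1"
  shows "(a + a' * b * f) * s + (b * b') * (f * g) = 1"
proof -
  have "(a + a' * b * f) * s + (b * b') * (f * g) = a * s + b * f * (a' * s + b' * g)"
    by (simp add: algebra_simps)
  then show ?thesis using assms by simp
qed

lemma bezout_power:
  fixes s f :: "'a :: comm_ring_1"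
  assumes "a * s + b * f = 1"
  shows "\<exists>a' b'. a' * s + b' * f ^ j = 1"
proof (induction j)
  case 0
  have "0 * s + 1 * f ^ 0 = 1" by simp
  then show ?case by blast
next
  case (Suc j)
  then obtain a' b' where "a' * s + b' * f ^ j = 1" by blast
  from bezout_mult[OF assms this] show ?case by (simp only: power_Suc) blast
qed

lemma bezout_powers:
  fixes s f :: "'a :: comm_ring_1"
  assumes "a * s + b * f = 1"
  shows "\<exists>a' b'. a' * s ^ j + b' * f ^ j = 1"
proof -
  obtain a1 b1 where 1: "a1 * s + b1 * f ^ j = 1" using bezout_power[OF assms] by blast
  then have "b1 * f ^ j + a1 * s = 1" by (simp add: add.commute)
  then obtain a2 b2 where "a2 * f ^ j + b2 * s ^ j = 1" using bezout_power by blast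
  then have "b2 * s ^ j + a2 * f ^ j = 1" by (simp add: add.commute)
  then show ?thesis by blast
qed

lemma degree_irreducible_pos:
  fixes \<phi> :: "'a :: field poly"
  assumes "irreducible \<phi>"
  shows "degree \<phi> > 0"
proof (rule ccontr)
  assume "\<not> ?thesis"
  moreover have "\<phi> \<noteq> 0" using assms by auto
  ultimately have "is_unit \<phi>" by (simp add: is_unit_iff_degree)
  then show False using assms by (simp add: irreducible_def)
qed

text \<open>Suppose a nonzero \<open>r\<close> of too small a degree kills \<open>v\<close>, and
  write \<open>r = \<phi>^i * s\<close> with \<open>s\<close> prime to \<phi>. The degree forces
  \<open>i \<le> j\<close>, and a Bezout identity for \<open>s\<close> and
  \<open>\<phi> ^ Suc j\<close> writes \<open>\<phi> ^ j\<close> as a combination of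
  \<open>r\<close> and \<open>\<phi> ^ Suc j\<close>. Hence \<open>\<phi> ^ j\<close> would kill
  \<open>v\<close> as well.\<close>

lemma krylov_full_rank_minimal:
  fixes A :: "'a :: field mat"
  assumes A: "A \<in> carrier_mat n n" and v: "v \<in> carrier_vec n" and irr: "irreducible \<phi>"
    and z: "mat_poly n A (\<phi> ^ Suc j) *\<^sub>v v = 0\<^sub>v n" and nz: "mat_poly n A (\<phi> ^ j) *\<^sub>v v \<noteq> 0\<^sub>v n"
  shows "full_col_rank (krylov n A v (degree (\<phi> ^ Suc j)))"
  unfolding full_col_rank_def
proof (intro ballI impI)
  let ?m = "degree (\<phi> ^ Suc j)"
  fix c assume c: "c \<in> carrier_vec (dim_col (krylov n A v ?m))"
    and 0: "krylov n A v ?m *\<^sub>v c = 0\<^sub>v (dim_row (krylov n A v ?m))"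
  have c': "c \<in> carrier_vec ?m" using c by (simp add: krylov_def)
  define r where "r = (\<Sum>j<?m. monom (c $ j) j)"
  have co: "coeff r k = (if k < ?m then c $ k else 0)" for k
    by (simp add: r_def coeff_sum)
  have rv: "mat_poly n A r *\<^sub>v v = 0\<^sub>v n"
    using krylov_mult_vec_poly[OF A v c'] 0 by (simp add: r_def krylov_def)
  have kill: "mat_poly n A (p * r') *\<^sub>v v = 0\<^sub>v n" if "mat_poly n A r' *\<^sub>v v = 0\<^sub>v n" for p r'
    using mat_poly_mult_vec[OF A v, of p r'] that A by auto
  have "r = 0"
  proof (rule ccontr)
    assume r: "r \<noteq> 0"
    have d: "degree \<phi> > 0" by (rule degree_irreducible_pos[OF irr])
    have deg_r: "degree r < ?m"
    proof (rule ccontr)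
      assume "\<not> ?thesis"
      then have "coeff r (degree r) = 0" unfolding co by simp
      then show False using r by simp
    qed
    have "\<exists>i s. r = \<phi> ^ i * s \<and> \<not> \<phi> dvd s"
      using r
    proof (induction "degree r" arbitrary: r rule: less_induct)
      case less
      show ?case
      proof (cases "\<phi> dvd r")
        case True
        then obtain s where s: "r = \<phi> * s" by blast
        then have "s \<noteq> 0" "degree s < degree r"
          using less.prems irr d by (auto simp: degree_mult_eq)
        then obtain i u where "s = \<phi> ^ i * u" "\<not> \<phi> dvd u" using less.hyps by blast
        then have "r = \<phi> ^ Suc i * u \<and> \<not> \<phi> dvd u" using s by (simp add: mult.assoc)
        then show ?thesis by blast
      next
        case False
        then have "r = \<phi> ^ 0 * r \<and> \<not> \<phi> dvd r" by simp
        then show ?thesis by blast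
      qed
    qed
    then obtain i s where s: "r = \<phi> ^ i * s" "\<not> \<phi> dvd s" by blast
    have "s \<noteq> 0" "\<phi> \<noteq> 0" using s r irr by auto
    then have "i * degree \<phi> \<le> degree r"
      unfolding s(1) by (simp add: degree_mult_eq degree_power_eq)
    then have "i * degree \<phi> < Suc j * degree \<phi>"
      using deg_r \<open>\<phi> \<noteq> 0\<close> by (simp add: degree_power_eq algebra_simps del: power_Suc)
    then have ij: "i \<le> j" using d by (metis less_Suc_eq_le mult_less_cancel2)
    obtain a b where ab: "a * s + b * \<phi> ^ Suc j = 1"
      using irreducible_bezout[OF irr s(2)] bezout_power by metis
    have "\<phi> ^ j = a * s * \<phi> ^ j + b * \<phi> ^ Suc j * \<phi> ^ j"
      using ab by (metis distrib_right mult_1)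
    also have "a * s * \<phi> ^ j = (a * \<phi> ^ (j - i)) * r"
      unfolding s(1) using ij by (simp add: power_add[symmetric] mult.assoc mult.left_commute flip: power_add)
    also have "b * \<phi> ^ Suc j * \<phi> ^ j = (b * \<phi> ^ j) * \<phi> ^ Suc j" by (simp add: algebra_simps)
    finally have eq: "\<phi> ^ j = (a * \<phi> ^ (j - i)) * r + (b * \<phi> ^ j) * \<phi> ^ Suc j" .
    have "mat_poly n A (\<phi> ^ j) *\<^sub>v v
      = mat_poly n A ((a * \<phi> ^ (j - i)) * r) *\<^sub>v v + mat_poly n A ((b * \<phi> ^ j) * \<phi> ^ Suc j) *\<^sub>v v"
      by (subst eq, subst mat_poly_add[OF A], rule add_mult_distrib_mat_vec[of _ n n]) (use A v in auto)
    also have "\<dots> = 0\<^sub>v n" unfolding kill[OF rv] kill[OF z] by simp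
    finally show False using nz by simp
  qed
  then have "c $ k = 0" if "k < ?m" for k using co[of k] that by simp
  then show "c = 0\<^sub>v (dim_col (krylov n A v ?m))"
    using c' by (intro eq_vecI) (auto simp: krylov_def)
qed

section \<open>Divisors of the characteristic polynomial and kernels\<close>

lemma const_poly_sum: "(\<Sum>k\<in>S. [:f k:]) = [:\<Sum>k\<in>S. f k:]"
  by (induction S rule: infinite_finite_induct) auto

lemma char_poly_matrix_mult_index:
  fixes A :: "'a :: field mat"
  assumes "A \<in> carrier_mat n n" "M \<in> carrier_mat n n" "i < n" "j < n"
  shows "(char_poly_matrix A * M) $$ (i, j)
    = [:0, 1:] * M $$ (i, j) - (\<Sum>k<n. [:A $$ (i, k):] * M $$ (k, j))"
proof -
  have "(char_poly_matrix A * M) $$ (i, j)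
    = (\<Sum>k<n. ((if i = k then [:0, 1:] else 0) - [:A $$ (i, k):]) * M $$ (k, j))"
    using assms unfolding char_poly_matrix_def
    by (auto simp: scalar_prod_def lessThan_atLeast0 intro!: sum.cong)
  also have "\<dots> = (\<Sum>k<n. if i = k then [:0, 1:] * M $$ (k, j) else 0) - (\<Sum>k<n. [:A $$ (i, k):] * M $$ (k, j))"
    unfolding sum_subtractf[symmetric] by (intro sum.cong refl) (auto simp: algebra_simps)
  also have "(\<Sum>k<n. if i = k then [:0, 1:] * M $$ (k, j) else 0) = [:0, 1:] * M $$ (i, j)"
    using assms by simp
  finally show ?thesis .
qed

text \<open>\<open>X - A\<close> divides \<open>p(X) - p(A)\<close>.\<close>

lemma char_poly_matrix_factor:
  fixes A :: "'a :: field mat"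
  assumes A: "A \<in> carrier_mat n n"
  shows "\<exists>N \<in> carrier_mat n n. \<forall>i<n. \<forall>j<n.
    (char_poly_matrix A * N) $$ (i, j) = (if i = j then p else 0) - [:mat_poly n A p $$ (i, j):]"
proof (induction p)
  case 0
  show ?case
    by (rule bexI[of _ "0\<^sub>m n n"]) (simp_all add: right_mult_zero_mat[OF char_poly_matrix_closed[OF A]])
next
  case (pCons a p)
  then obtain N where N: "N \<in> carrier_mat n n" "\<And>i j. i < n \<Longrightarrow> j < n \<Longrightarrow>
    (char_poly_matrix A * N) $$ (i, j) = (if i = j then p else 0) - [:mat_poly n A p $$ (i, j):]"
    by blast
  define P where "P = mat_poly n A p"
  have P: "P \<in> carrier_mat n n" using A by (simp add: P_def)
  define N' where "N' = mat n n (\<lambda>(i, j). [:0, 1:] * N $$ (i, j) + [:P $$ (i, j):])"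
  have N': "N' \<in> carrier_mat n n" by (simp add: N'_def)
  have "(char_poly_matrix A * N') $$ (i, j)
    = (if i = j then pCons a p else 0) - [:mat_poly n A (pCons a p) $$ (i, j):]"
    if ij: "i < n" "j < n" for i j
  proof -
    have "(\<Sum>k<n. [:A $$ (i, k):] * N' $$ (k, j))
      = [:0, 1:] * (\<Sum>k<n. [:A $$ (i, k):] * N $$ (k, j)) + (\<Sum>k<n. [:A $$ (i, k):] * [:P $$ (k, j):])"
      unfolding sum_distrib_left sum.distrib[symmetric]
      by (intro sum.cong refl) (use ij in \<open>simp add: N'_def algebra_simps\<close>)
    also have "(\<Sum>k<n. [:A $$ (i, k):] * [:P $$ (k, j):]) = [:(A * P) $$ (i, j):]"
      using A P ij by (simp add: scalar_prod_def lessThan_atLeast0 const_poly_sum mult.commute)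
    finally have S: "(\<Sum>k<n. [:A $$ (i, k):] * N' $$ (k, j))
      = [:0, 1:] * (\<Sum>k<n. [:A $$ (i, k):] * N $$ (k, j)) + [:(A * P) $$ (i, j):]" .
    have "(char_poly_matrix A * N') $$ (i, j)
      = [:0, 1:] * ([:0, 1:] * N $$ (i, j) - (\<Sum>k<n. [:A $$ (i, k):] * N $$ (k, j)))
        + [:0, 1:] * [:P $$ (i, j):] - [:(A * P) $$ (i, j):]"
      unfolding char_poly_matrix_mult_index[OF A N' ij] S
      using ij by (simp add: N'_def algebra_simps)
    also have "[:0, 1:] * N $$ (i, j) - (\<Sum>k<n. [:A $$ (i, k):] * N $$ (k, j))
      = (if i = j then p else 0) - [:P $$ (i, j):]"
      using N(2)[OF ij] unfolding char_poly_matrix_mult_index[OF A N(1) ij] P_def .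
    also have "[:0, 1:] * ((if i = j then p else 0) - [:P $$ (i, j):]) + [:0, 1:] * [:P $$ (i, j):] - [:(A * P) $$ (i, j):]
      = [:0, 1:] * (if i = j then p else 0) - [:(A * P) $$ (i, j):]"
      by (simp only: algebra_simps)
    also have "\<dots> = (if i = j then pCons a p else 0) - [:mat_poly n A (pCons a p) $$ (i, j):]"
      using ij A P unfolding mat_poly_pCons[OF A] P_def[symmetric] by auto
    finally show ?thesis .
  qed
  then show ?case using N' by blast
qed

text \<open>Substitute \<open>p\<close> for the variable in the characteristic matrix of
  \<open>B = p(A)\<close>. The result \<open>p - p(A)\<close> is a multiple of \<open>X - A\<close>,
  so taking determinants shows that \<open>char_poly A\<close>, and with it \<open>p\<close>,
  divides \<open>char_poly B\<close> composed with \<open>p\<close>. Modulo \<open>p\<close> that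
  composition is the constant term of \<open>char_poly B\<close>, which must vanish because
  \<open>p\<close> is nonconstant. So 0 is an eigenvalue of \<open>p(A)\<close>.\<close>

lemma dvd_char_poly_kernel:
  fixes A :: "'a :: field mat"
  assumes A: "A \<in> carrier_mat n n" and deg: "degree p > 0" and dvd: "p dvd char_poly A"
  obtains v where "v \<in> carrier_vec n" "v \<noteq> 0\<^sub>v n" "mat_poly n A p *\<^sub>v v = 0\<^sub>v n"
proof -
  let ?B = "mat_poly n A p"
  have B: "?B \<in> carrier_mat n n" using A by simp
  obtain N where N: "N \<in> carrier_mat n n" "\<And>i j. i < n \<Longrightarrow> j < n \<Longrightarrow>
    (char_poly_matrix A * N) $$ (i, j) = (if i = j then p else 0) - [:?B $$ (i, j):]"
    using char_poly_matrix_factor[OF A, of p] by blast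
  have hom: "comm_ring_hom (\<lambda>r. r \<circ>\<^sub>p p)"
    by unfold_locales (auto simp: pcompose_add pcompose_mult pcompose_1)
  have "map_mat (\<lambda>r. r \<circ>\<^sub>p p) (char_poly_matrix ?B) = char_poly_matrix A * N"
  proof (rule eq_matI)
    fix i j assume "i < dim_row (char_poly_matrix A * N)" "j < dim_col (char_poly_matrix A * N)"
    then have ij: "i < n" "j < n" using A N(1) by (auto simp: char_poly_matrix_def)
    then show "map_mat (\<lambda>r. r \<circ>\<^sub>p p) (char_poly_matrix ?B) $$ (i, j) = (char_poly_matrix A * N) $$ (i, j)"
      unfolding N(2)[OF ij] using A by (auto simp: char_poly_matrix_def pcompose_pCons)
  qed (use A N in \<open>auto simp: char_poly_matrix_def\<close>)
  then have "char_poly ?B \<circ>\<^sub>p p = det (char_poly_matrix A * N)"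
    using comm_ring_hom.hom_det[OF hom, of "char_poly_matrix ?B"] by (simp only: char_poly_def)
  also have "\<dots> = char_poly A * det N"
    unfolding char_poly_def by (rule det_mult) (use A N in auto)
  finally have "p dvd char_poly ?B \<circ>\<^sub>p p" using dvd by simp
  obtain c r where cr: "char_poly ?B = pCons c r" by (cases "char_poly ?B")
  have "char_poly ?B \<circ>\<^sub>p p = [:c:] + p * (r \<circ>\<^sub>p p)" unfolding cr by (simp add: pcompose_pCons)
  then have "p dvd [:c:]" using \<open>p dvd char_poly ?B \<circ>\<^sub>p p\<close> by (simp add: dvd_add_left_iff)
  then have "c = 0"
    using deg by (metis degree_pCons_0 dvd_imp_degree_le leD pCons_eq_0_iff)
  then have "poly (char_poly ?B) 0 = 0" using cr by simp
  then have "eigenvalue ?B 0" using eigenvalue_root_char_poly[OF B] by simp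
  then obtain v where "v \<in> carrier_vec n" "v \<noteq> 0\<^sub>v n" "?B *\<^sub>v v = 0 \<cdot>\<^sub>v v"
    using B by (auto simp: eigenvalue_def eigenvector_def)
  moreover from this(1) have "0 \<cdot>\<^sub>v v = 0\<^sub>v n" by (intro eq_vecI) auto
  ultimately show thesis using that[of v] by simp
qed

lemma mat_poly_conj_vec:
  fixes A :: "'a :: field mat"
  assumes A: "A \<in> carrier_mat n n" and B: "B \<in> carrier_mat n n" and P: "P \<in> carrier_mat n n"
    and eq: "A * P = P * B" and x: "x \<in> carrier_vec n"
  shows "mat_poly n A p *\<^sub>v (P *\<^sub>v x) = P *\<^sub>v (mat_poly n B p *\<^sub>v x)"
  using x
proof (induction p arbitrary: x)
  case 0
  have "P *\<^sub>v 0\<^sub>v n = 0\<^sub>v n" using P by (intro eq_vecI) auto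
  moreover have "0\<^sub>m n n *\<^sub>v y = 0\<^sub>v n" if "y \<in> carrier_vec n" for y :: "'a vec"
    using that by (intro eq_vecI) auto
  ultimately show ?case using 0 P by simp
next
  case (pCons a p)
  note x = pCons.prems
  have Px: "P *\<^sub>v x \<in> carrier_vec n" using P x by simp
  have "A *\<^sub>v (P *\<^sub>v x) = P *\<^sub>v (B *\<^sub>v x)"
    using assoc_mult_mat_vec[OF A P x] assoc_mult_mat_vec[OF P B x] eq by simp
  then have "mat_poly n A (pCons a p) *\<^sub>v (P *\<^sub>v x)
    = a \<cdot>\<^sub>v (P *\<^sub>v x) + P *\<^sub>v (mat_poly n B p *\<^sub>v (B *\<^sub>v x))"
    using mat_poly_pCons_vec[OF A Px] pCons.IH[of "B *\<^sub>v x"] B x by simp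
  also have "a \<cdot>\<^sub>v (P *\<^sub>v x) = P *\<^sub>v (a \<cdot>\<^sub>v x)" by (rule mult_mat_vec[symmetric, OF P x])
  also have "P *\<^sub>v (a \<cdot>\<^sub>v x) + P *\<^sub>v (mat_poly n B p *\<^sub>v (B *\<^sub>v x))
    = P *\<^sub>v (a \<cdot>\<^sub>v x + mat_poly n B p *\<^sub>v (B *\<^sub>v x))"
    by (rule mult_add_distrib_mat_vec[symmetric, OF P])
      (use x mult_mat_vec_carrier[OF mat_poly_carrier[OF B] mult_mat_vec_carrier[OF B x]] in auto)
  also have "\<dots> = P *\<^sub>v (mat_poly n B (pCons a p) *\<^sub>v x)" by (simp only: mat_poly_pCons_vec[OF B x])
  finally show ?case .
qed

text \<open>In a block triangular matrix the lower component evolves by \<open>D\<close> alone. The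
  upper component is left existential: the kernel count uses just that it stays in the first
  block.\<close>

lemma mat_poly_block_vec:
  fixes C :: "'a :: field mat"
  assumes C: "C \<in> carrier_mat d d" and E: "E \<in> carrier_mat d e" and D: "D \<in> carrier_mat e e"
    and u: "u \<in> carrier_vec d" and w: "w \<in> carrier_vec e"
  shows "\<exists>y \<in> carrier_vec d.
    mat_poly (d + e) (four_block_mat C E (0\<^sub>m e d) D) p *\<^sub>v (u @\<^sub>v w) = y @\<^sub>v (mat_poly e D p *\<^sub>v w)"
  using u w
proof (induction p arbitrary: u w)
  case 0
  have "mat_poly (d + e) (four_block_mat C E (0\<^sub>m e d) D) 0 *\<^sub>v (u @\<^sub>v w) = 0\<^sub>v d @\<^sub>v (mat_poly e D 0 *\<^sub>v w)"
    using 0 by (intro eq_vecI) auto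
  then show ?case by (intro bexI) auto
next
  case (pCons a p)
  note u = pCons.prems(1) and w = pCons.prems(2)
  let ?A = "four_block_mat C E (0\<^sub>m e d) D"
  have A: "?A \<in> carrier_mat (d + e) (d + e)" using four_block_carrier_mat[OF C D] .
  have uw: "u @\<^sub>v w \<in> carrier_vec (d + e)" using u w by simp
  have "0\<^sub>m e d *\<^sub>v u + D *\<^sub>v w = D *\<^sub>v w" using u w D by (intro eq_vecI) auto
  then have "?A *\<^sub>v (u @\<^sub>v w) = (C *\<^sub>v u + E *\<^sub>v w) @\<^sub>v (D *\<^sub>v w)"
    using four_block_mat_mult_vec[OF C E zero_carrier_mat D u w] by simp
  moreover obtain y where y: "y \<in> carrier_vec d"
    "mat_poly (d + e) ?A p *\<^sub>v ((C *\<^sub>v u + E *\<^sub>v w) @\<^sub>v (D *\<^sub>v w)) = y @\<^sub>v (mat_poly e D p *\<^sub>v (D *\<^sub>v w))"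
    using pCons.IH[of "C *\<^sub>v u + E *\<^sub>v w" "D *\<^sub>v w"] C D E u w by auto
  ultimately have "mat_poly (d + e) ?A (pCons a p) *\<^sub>v (u @\<^sub>v w)
    = a \<cdot>\<^sub>v (u @\<^sub>v w) + (y @\<^sub>v (mat_poly e D p *\<^sub>v (D *\<^sub>v w)))"
    using mat_poly_pCons_vec[OF A uw] by simp
  also have "a \<cdot>\<^sub>v (u @\<^sub>v w) = (a \<cdot>\<^sub>v u) @\<^sub>v (a \<cdot>\<^sub>v w)" by (intro eq_vecI) auto
  also have "((a \<cdot>\<^sub>v u) @\<^sub>v (a \<cdot>\<^sub>v w)) + (y @\<^sub>v (mat_poly e D p *\<^sub>v (D *\<^sub>v w)))
    = (a \<cdot>\<^sub>v u + y) @\<^sub>v (a \<cdot>\<^sub>v w + mat_poly e D p *\<^sub>v (D *\<^sub>v w))"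
    using u w y mult_mat_vec_carrier[OF mat_poly_carrier[OF D] mult_mat_vec_carrier[OF D w], of p]
    by (intro append_vec_add[of _ d _ _ e]) auto
  also have "a \<cdot>\<^sub>v w + mat_poly e D p *\<^sub>v (D *\<^sub>v w) = mat_poly e D (pCons a p) *\<^sub>v w"
    by (simp only: mat_poly_pCons_vec[OF D w])
  finally show ?case using u y(1) by (intro bexI[of _ "a \<cdot>\<^sub>v u + y"]) auto
qed

lemma char_poly_block:
  fixes C :: "'a :: field mat"
  assumes C: "C \<in> carrier_mat d d" and E: "E \<in> carrier_mat d e" and D: "D \<in> carrier_mat e e"
  shows "char_poly (four_block_mat C E (0\<^sub>m e d) D) = char_poly C * char_poly D"
proof -
  have "char_poly_matrix (four_block_mat C E (0\<^sub>m e d) D)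
    = four_block_mat (char_poly_matrix C) (map_mat (\<lambda>a. [:- a:]) E) (0\<^sub>m e d) (char_poly_matrix D)"
    using assms by (intro eq_matI) (auto simp: char_poly_matrix_def)
  then show ?thesis
    unfolding char_poly_def using assms
    by (simp add: det_four_block_mat_lower_left_zero[of _ d _ e])
qed

text \<open>A factor of degree at most \<open>degree \<phi>\<close> absorbs at most one \<phi>: it
  is either a constant multiple of \<phi> or prime to it. It is applied to the characteristic
  polynomial of a block of size \<open>degree \<phi>\<close>.\<close>

lemma irreducible_power_dvd_cancel:
  fixes \<phi> f g :: "'a :: field poly"
  assumes irr: "irreducible \<phi>" and f: "f \<noteq> 0" "degree f \<le> degree \<phi>" and dvd: "\<phi> ^ Suc k dvd f * g"
  shows "\<phi> ^ k dvd g"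
proof (cases "\<phi> dvd f")
  case True
  then obtain c where c: "f = \<phi> * c" by blast
  have "\<phi> \<noteq> 0" "c \<noteq> 0" using f c by auto
  then have "degree c = 0" using f c by (simp add: degree_mult_eq)
  then have "c dvd 1" using \<open>c \<noteq> 0\<close> by (simp add: is_unit_iff_degree)
  moreover have "\<phi> ^ k dvd c * g"
    using dvd \<open>\<phi> \<noteq> 0\<close> unfolding c by (simp add: mult.assoc)
  ultimately show ?thesis by (metis dvd_mult_unit_iff' mult.commute)
next
  case False
  obtain a b where ab: "a * f + b * \<phi> ^ k = 1"
    using irreducible_bezout[OF irr False] bezout_power by metis
  have "\<phi> ^ k dvd f * g" using dvd by (rule dvd_trans[rotated]) (simp add: le_imp_power_dvd)
  then have "\<phi> ^ k dvd a * (f * g) + (b * g) * \<phi> ^ k" by simp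
  also have "a * (f * g) + (b * g) * \<phi> ^ k = (a * f + b * \<phi> ^ k) * g" by (simp add: algebra_simps)
  finally show ?thesis using ab by simp
qed

text \<open>The Krylov vectors of a \<open>v\<close> killed by \<phi>(A) span an invariant subspace
  of dimension \<open>degree \<phi>\<close>; a basis \<open>P\<close> that starts with them makes
  \<open>A\<close> block triangular. The last property identifies the first block with the vectors
  \<open>r(A) v\<close>, all of which \<phi>(A) kills.\<close>

lemma invariant_block_form:
  fixes A :: "'a :: {finite, field} mat"
  assumes A: "A \<in> carrier_mat n n" and v: "v \<in> carrier_vec n" "v \<noteq> 0\<^sub>v n"
    and irr: "irreducible \<phi>" and z: "mat_poly n A \<phi> *\<^sub>v v = 0\<^sub>v n"
  obtains e P C E D where "n = degree \<phi> + e" "P \<in> carrier_mat n n" "det P \<noteq> 0"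
    "C \<in> carrier_mat (degree \<phi>) (degree \<phi>)" "E \<in> carrier_mat (degree \<phi>) e" "D \<in> carrier_mat e e"
    "A * P = P * four_block_mat C E (0\<^sub>m e (degree \<phi>)) D"
    "\<And>y. y \<in> carrier_vec (degree \<phi>) \<Longrightarrow> P *\<^sub>v (y @\<^sub>v 0\<^sub>v e) = krylov n A v (degree \<phi>) *\<^sub>v y"
proof -
  let ?d = "degree \<phi>" and ?K = "krylov n A v (degree \<phi>)"
  have K: "full_col_rank ?K"
    using krylov_full_rank_minimal[OF A v(1) irr, of 0] z v A by simp
  have dn: "?d \<le> n" by (rule full_col_rank_le[OF K krylov_carrier])
  define e where "e = n - ?d"
  have n: "n = ?d + e" using dn by (simp add: e_def)
  obtain P where P: "P \<in> carrier_mat n n" "det P \<noteq> 0"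
    "\<And>i j. i < n \<Longrightarrow> j < ?d \<Longrightarrow> P $$ (i, j) = ?K $$ (i, j)"
    using full_col_rank_extend[OF K krylov_carrier] by blast
  obtain B where B: "B \<in> carrier_mat n n" "P * B = 1\<^sub>m n" "B * P = 1\<^sub>m n"
    using det_nonzero_inverse[OF P(1,2)] by blast
  have PK: "P *\<^sub>v (y @\<^sub>v 0\<^sub>v e) = ?K *\<^sub>v y" if y: "y \<in> carrier_vec ?d" for y
  proof (rule eq_vecI)
    fix i assume "i < dim_vec (?K *\<^sub>v y)"
    then have i: "i < n" by (simp add: krylov_def)
    have "(P *\<^sub>v (y @\<^sub>v 0\<^sub>v e)) $ i = (\<Sum>j<?d + e. P $$ (i, j) * (y @\<^sub>v 0\<^sub>v e) $ j)"
      using P(1) i y n by (simp add: scalar_prod_def lessThan_atLeast0)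
    also have "\<dots> = (\<Sum>j<?d. P $$ (i, j) * (y @\<^sub>v 0\<^sub>v e) $ j)"
      by (rule sum.mono_neutral_right) (use y in auto)
    also have "\<dots> = (\<Sum>j<?d. ?K $$ (i, j) * y $ j)"
      using y P(3)[OF i] by (intro sum.cong) auto
    also have "\<dots> = (?K *\<^sub>v y) $ i"
      using i y by (simp add: krylov_mult_vec_index) (simp add: krylov_def)
    finally show "(P *\<^sub>v (y @\<^sub>v 0\<^sub>v e)) $ i = (?K *\<^sub>v y) $ i" .
  qed (use P in \<open>simp add: krylov_def\<close>)
  define M where "M = B * (A * P)"
  have M: "M \<in> carrier_mat n n" using A B P by (simp add: M_def)
  have "P * M = (P * B) * (A * P)"
    unfolding M_def by (rule assoc_mult_mat[symmetric, OF P(1) B(1)]) (use A P in auto)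
  then have PM: "A * P = P * M" using A B P by simp
  have span: "\<exists>y \<in> carrier_vec ?d. orbit A v (Suc j) = ?K *\<^sub>v y" if j: "j < ?d" for j
  proof -
    \<comment> \<open>As \<phi>(A) kills \<open>v\<close>, the next orbit vector equals
      \<open>r(A) v\<close> for the remainder \<open>r\<close>, whose coefficients are its
      coordinates in the Krylov frame.\<close>
    define r where "r = monom 1 (Suc j) mod \<phi>"
    define y where "y = vec ?d (coeff r)"
    have dpos: "?d > 0" by (rule degree_irreducible_pos[OF irr])
    then have "degree r < ?d" unfolding r_def by (metis degree_mod_less' degree_0 irr not_irreducible_zero)
    then have r_eq: "(\<Sum>j<?d. monom (y $ j) j) = r"
      by (intro poly_eqI) (auto simp: y_def coeff_sum coeff_eq_0)
    have "orbit A v (Suc j) = mat_poly n A (monom 1 (Suc j)) *\<^sub>v v"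
    proof (rule eq_vecI)
      fix i assume "i < dim_vec (mat_poly n A (monom 1 (Suc j)) *\<^sub>v v)"
      then have i: "i < n" using A by simp
      have "(mat_poly n A (monom 1 (Suc j)) *\<^sub>v v) $ i
        = (\<Sum>k\<le>Suc j. (if k = Suc j then orbit A v k $ i else 0))"
        unfolding mat_poly_vec_index[OF A v(1) i degree_monom_le]
        by (intro sum.cong) auto
      then show "orbit A v (Suc j) $ i = (mat_poly n A (monom 1 (Suc j)) *\<^sub>v v) $ i" by simp
    qed (use A carrier_vecD[OF orbit_carrier[OF A v(1), of "Suc j"]] in simp)
    also have "monom 1 (Suc j) = monom 1 (Suc j) div \<phi> * \<phi> + r" by (simp add: r_def)
    also have "mat_poly n A (monom 1 (Suc j) div \<phi> * \<phi> + r) *\<^sub>v v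
      = mat_poly n A (monom 1 (Suc j) div \<phi> * \<phi>) *\<^sub>v v + mat_poly n A r *\<^sub>v v"
      unfolding mat_poly_add[OF A] by (rule add_mult_distrib_mat_vec[of _ n n]) (use A v in auto)
    also have "mat_poly n A (monom 1 (Suc j) div \<phi> * \<phi>) *\<^sub>v v = 0\<^sub>v n"
      unfolding mat_poly_mult_vec[OF A v(1)] z using A by (intro eq_vecI) auto
    also have "0\<^sub>v n + mat_poly n A r *\<^sub>v v = mat_poly n A r *\<^sub>v v" using A by (intro eq_vecI) auto
    also have "\<dots> = ?K *\<^sub>v y"
      using krylov_mult_vec_poly[OF A v(1), of y ?d] r_eq by (simp add: y_def)
    finally show ?thesis by (intro bexI[of _ y]) (auto simp: y_def)
  qed
  have zero: "M $$ (i, j) = 0" if ij: "?d \<le> i" "i < n" "j < ?d" for i j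
  proof -
    obtain y where y: "y \<in> carrier_vec ?d" "orbit A v (Suc j) = ?K *\<^sub>v y" using span[OF ij(3)] by blast
    have dj: "dim_vec (orbit A v j) = n" by (rule carrier_vecD[OF orbit_carrier[OF A v(1)]])
    have "col P j = orbit A v j"
    proof (rule eq_vecI)
      fix k assume "k < dim_vec (orbit A v j)"
      then show "col P j $ k = orbit A v j $ k"
        unfolding dj using P(1) P(3)[of k j] ij n by (simp add: krylov_def)
    qed (use P dj in simp)
    then have "col M j = B *\<^sub>v (A *\<^sub>v orbit A v j)"
    proof -
      have j: "j < n" using ij n by simp
      have "col M j = B *\<^sub>v col (A * P) j"
        unfolding M_def by (rule col_mult2[OF B(1) _ j]) (use A P in simp)
      also have "col (A * P) j = A *\<^sub>v col P j" by (rule col_mult2[OF A P(1) j])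
      finally show ?thesis using \<open>col P j = orbit A v j\<close> by simp
    qed
    also have "A *\<^sub>v orbit A v j = P *\<^sub>v (y @\<^sub>v 0\<^sub>v e)" using y PK by simp
    also have "B *\<^sub>v (P *\<^sub>v (y @\<^sub>v 0\<^sub>v e)) = (B * P) *\<^sub>v (y @\<^sub>v 0\<^sub>v e)"
      by (rule assoc_mult_mat_vec[symmetric, OF B(1) P(1)]) (use y n in simp)
    also have "\<dots> = y @\<^sub>v 0\<^sub>v e" unfolding B(3) by (rule one_mult_mat_vec) (use y n in simp)
    finally have "col M j = y @\<^sub>v 0\<^sub>v e" .
    then have "col M j $ i = (y @\<^sub>v 0\<^sub>v e) $ i" by simp
    then show ?thesis using M ij n y by simp
  qed
  obtain C E Z D where split: "split_block M ?d ?d = (C, E, Z, D)" by (cases "split_block M ?d ?d") auto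
  have dims: "dim_row M = ?d + e" "dim_col M = ?d + e" using M n by auto
  note blk = split_block[OF split dims]
  have "Z = 0\<^sub>m e ?d"
  proof (rule eq_matI)
    fix i j assume "i < dim_row (0\<^sub>m e ?d :: 'a mat)" "j < dim_col (0\<^sub>m e ?d :: 'a mat)"
    then have ij: "i < e" "j < ?d" by auto
    have "Z $$ (i, j) = M $$ (?d + i, j)" using blk ij by simp
    then show "Z $$ (i, j) = 0\<^sub>m e ?d $$ (i, j)" using zero[of "?d + i" j] ij n by simp
  qed (use blk in auto)
  then have "A * P = P * four_block_mat C E (0\<^sub>m e ?d) D" using PM blk(5) by simp
  then show thesis using that[OF n P(1,2) blk(1,2,4) _ PK] by blast
qed

text \<open>Induction on \<open>k\<close>, splitting off one Krylov block. The quotient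
  \<open>D\<close> retains the divisor \<open>\<phi> ^ k\<close>. If \<open>\<phi> ^ k\<close>
  evaluated at \<open>D\<close> kills \<open>w\<close>, then at \<open>A\<close> it maps every
  \<open>P (u @ w)\<close> into the first block, where one more \<phi>(A) gives 0. So each step
  multiplies the count by the \<open>CARD('a) ^ degree \<phi>\<close> choices of
  \<open>u\<close>.\<close>

lemma card_kernel_ge:
  fixes A :: "'a :: {finite, field} mat"
  assumes irr: "irreducible \<phi>" and A: "A \<in> carrier_mat n n" and dvd: "\<phi> ^ k dvd char_poly A"
  shows "CARD('a) ^ (k * degree \<phi>) \<le> card {v \<in> carrier_vec n. mat_poly n A (\<phi> ^ k) *\<^sub>v v = 0\<^sub>v n}"
  using A dvd
proof (induction k arbitrary: n A)
  case 0
  have "{0\<^sub>v n} \<subseteq> {v \<in> carrier_vec n. mat_poly n A (\<phi> ^ 0) *\<^sub>v v = 0\<^sub>v n}" using 0 by auto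
  then have "card {0\<^sub>v n :: 'a vec} \<le> card {v \<in> carrier_vec n. mat_poly n A (\<phi> ^ 0) *\<^sub>v v = 0\<^sub>v n}"
    by (rule card_mono[rotated]) (rule finite_subset[OF _ finite_carrier_vec[of n]], auto)
  then show ?case by simp
next
  case (Suc k)
  note A = Suc.prems(1)
  let ?d = "degree \<phi>"
  have "\<phi> dvd char_poly A" using Suc.prems(2) by (metis dvd_mult_left power_Suc)
  then obtain v where v: "v \<in> carrier_vec n" "v \<noteq> 0\<^sub>v n" "mat_poly n A \<phi> *\<^sub>v v = 0\<^sub>v n"
    using dvd_char_poly_kernel[OF A degree_irreducible_pos[OF irr]] by blast
  obtain e P C E D where blk: "n = ?d + e" "P \<in> carrier_mat n n" "det P \<noteq> 0"
    "C \<in> carrier_mat ?d ?d" "E \<in> carrier_mat ?d e" "D \<in> carrier_mat e e"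
    "A * P = P * four_block_mat C E (0\<^sub>m e ?d) D"
    "\<And>y. y \<in> carrier_vec ?d \<Longrightarrow> P *\<^sub>v (y @\<^sub>v 0\<^sub>v e) = krylov n A v ?d *\<^sub>v y"
    using invariant_block_form[OF A v(1,2) irr v(3)] by metis
  let ?M = "four_block_mat C E (0\<^sub>m e ?d) D"
  have M: "?M \<in> carrier_mat n n" unfolding blk(1) by (rule four_block_carrier_mat[OF blk(4,6)])
  obtain B where B: "B \<in> carrier_mat n n" "P * B = 1\<^sub>m n" "B * P = 1\<^sub>m n"
    using det_nonzero_inverse[OF blk(2,3)] by blast
  have "A = P * ?M * B"
  proof -
    have "P * ?M * B = A * (P * B)"
      unfolding blk(7)[symmetric] by (rule assoc_mult_mat[OF A blk(2) B(1)])
    then show ?thesis using A B by simp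
  qed
  then have "similar_mat A ?M"
    by (intro similar_matI[of _ _ P B n] B) (use A M blk(2) B in auto)
  then have "char_poly A = char_poly C * char_poly D"
    using char_poly_similar[of A ?M] char_poly_block[OF blk(4,5,6)] by simp
  then have "\<phi> ^ k dvd char_poly D"
    using irreducible_power_dvd_cancel[OF irr, of "char_poly C" k "char_poly D"]
      degree_monic_char_poly[OF blk(4)] Suc.prems(2) by fastforce
  then have IH: "CARD('a) ^ (k * ?d) \<le> card {w \<in> carrier_vec e. mat_poly e D (\<phi> ^ k) *\<^sub>v w = 0\<^sub>v e}"
    (is "_ \<le> card ?W") using Suc.IH[OF blk(6)] by blast
  let ?V = "{v \<in> carrier_vec n. mat_poly n A (\<phi> ^ Suc k) *\<^sub>v v = 0\<^sub>v n}"
  let ?g = "\<lambda>(u, w). P *\<^sub>v (u @\<^sub>v w)"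
  have "inj_on ?g (carrier_vec ?d \<times> ?W)"
  proof (rule inj_onI, clarify)
    fix u w u' w' :: "'a vec" assume uw: "u \<in> carrier_vec ?d" "w \<in> carrier_vec e" "u' \<in> carrier_vec ?d" "w' \<in> carrier_vec e"
      and eq: "P *\<^sub>v (u @\<^sub>v w) = P *\<^sub>v (u' @\<^sub>v w')"
    have "B *\<^sub>v (P *\<^sub>v x) = x" if "x \<in> carrier_vec n" for x
      using assoc_mult_mat_vec[OF B(1) blk(2) that] B(3) that by simp
    then have "u @\<^sub>v w = u' @\<^sub>v w'" using eq uw blk(1) by (metis append_carrier_vec)
    then show "u = u' \<and> w = w'" using append_vec_eq[OF uw(1,3)] by simp
  qed
  moreover have "?g ` (carrier_vec ?d \<times> ?W) \<subseteq> ?V"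
  proof clarify
    fix u w :: "'a vec" assume u: "u \<in> carrier_vec ?d" and w: "w \<in> carrier_vec e" "mat_poly e D (\<phi> ^ k) *\<^sub>v w = 0\<^sub>v e"
    have uw: "u @\<^sub>v w \<in> carrier_vec n" using u w blk(1) by simp
    obtain y where y: "y \<in> carrier_vec ?d" "mat_poly n ?M (\<phi> ^ k) *\<^sub>v (u @\<^sub>v w) = y @\<^sub>v 0\<^sub>v e"
      using mat_poly_block_vec[OF blk(4,5,6) u w(1), of "\<phi> ^ k"] w(2) blk(1) by auto
    have x: "P *\<^sub>v (u @\<^sub>v w) \<in> carrier_vec n" using blk(2) uw by simp
    have "mat_poly n A (\<phi> ^ Suc k) *\<^sub>v (P *\<^sub>v (u @\<^sub>v w))
      = mat_poly n A \<phi> *\<^sub>v (mat_poly n A (\<phi> ^ k) *\<^sub>v (P *\<^sub>v (u @\<^sub>v w)))"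
      using mat_poly_mult_vec[OF A x, of \<phi> "\<phi> ^ k"] by simp
    also have "mat_poly n A (\<phi> ^ k) *\<^sub>v (P *\<^sub>v (u @\<^sub>v w)) = krylov n A v ?d *\<^sub>v y"
      using mat_poly_conj_vec[OF A M blk(2,7) uw, of "\<phi> ^ k"] y blk(8) by simp
    also have "\<dots> = mat_poly n A (\<Sum>j<?d. monom (y $ j) j) *\<^sub>v v" (is "_ = mat_poly n A ?r *\<^sub>v v")
      by (rule krylov_mult_vec_poly[OF A v(1) y(1)])
    also have "mat_poly n A \<phi> *\<^sub>v (mat_poly n A ?r *\<^sub>v v) = mat_poly n A (?r * \<phi>) *\<^sub>v v"
      using mat_poly_mult_vec[OF A v(1), of \<phi> ?r] by (simp only: mult.commute)
    also have "\<dots> = mat_poly n A ?r *\<^sub>v 0\<^sub>v n"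
      using mat_poly_mult_vec[OF A v(1), of ?r \<phi>] v(3) by simp
    also have "\<dots> = 0\<^sub>v n" using A by (intro eq_vecI) auto
    finally show "P *\<^sub>v (u @\<^sub>v w) \<in> carrier_vec n \<and> mat_poly n A (\<phi> ^ Suc k) *\<^sub>v (P *\<^sub>v (u @\<^sub>v w)) = 0\<^sub>v n"
      using x by blast
  qed
  moreover have "finite ?V" by (rule finite_subset[OF _ finite_carrier_vec[of n]]) auto
  ultimately have "card ((carrier_vec ?d :: 'a vec set) \<times> ?W) \<le> card ?V" by (rule card_inj_on_le)
  moreover have "CARD('a) ^ (Suc k * ?d) \<le> CARD('a) ^ ?d * card ?W"
    using IH by (simp add: power_add)
  ultimately show ?case by (simp add: card_cartesian_product card_carrier_vec)
qed

section \<open>Expected multiplicities\<close>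

text \<open>The maximum becomes a sum of indicators over a range independent of the polynomial,
  which can then be averaged over the group. The exponents that divide form an initial segment, of
  length at most \<open>degree p\<close>.\<close>

lemma poly_multiplicity_eq_card:
  fixes \<phi> p :: "'a :: field poly"
  assumes "p \<noteq> 0" "degree \<phi> > 0" "degree p \<le> N"
  shows "poly_multiplicity \<phi> p = card {k \<in> {1..N}. \<phi> ^ k dvd p}"
proof -
  define m where "m = poly_multiplicity \<phi> p"
  have bound: "k \<le> degree p" if "\<phi> ^ k dvd p" for k
  proof -
    have "k * 1 \<le> k * degree \<phi>" using assms(2) by (intro mult_le_mono) auto
    also have "\<dots> = degree (\<phi> ^ k)" using assms(2) by (subst degree_power_eq) auto
    also have "\<dots> \<le> degree p" using that assms(1) by (rule dvd_imp_degree_le)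
    finally show ?thesis by simp
  qed
  have fin: "finite {k. \<phi> ^ k dvd p}"
    by (rule finite_subset[of _ "{..degree p}"]) (use bound in auto)
  have "0 \<in> {k. \<phi> ^ k dvd p}" by simp
  then have "{k. \<phi> ^ k dvd p} \<noteq> {}" by blast
  then have "m \<in> {k. \<phi> ^ k dvd p}"
    unfolding m_def poly_multiplicity_def by (intro Max_in fin)
  then have m: "\<phi> ^ m dvd p" by simp
  have "{k \<in> {1..N}. \<phi> ^ k dvd p} = {1..m}"
  proof (intro equalityI subsetI)
    fix k assume "k \<in> {k \<in> {1..N}. \<phi> ^ k dvd p}"
    then show "k \<in> {1..m}"
      unfolding m_def poly_multiplicity_def using Max_ge[OF fin, of k] by auto
  next
    fix k assume "k \<in> {1..m}"
    then have k: "1 \<le> k" "k \<le> m" by auto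
    have "\<phi> ^ k dvd p" using m le_imp_power_dvd[OF k(2)] dvd_trans by blast
    then show "k \<in> {k \<in> {1..N}. \<phi> ^ k dvd p}" using bound[of k] assms(3) k by auto
  qed
  then show ?thesis by (simp add: m_def)
qed

text \<open>The least \<open>j\<close> for which \<open>\<phi> ^ j\<close> kills \<open>v\<close>
  makes \<open>\<phi> ^ j\<close> its minimal polynomial; so the nonzero kernel vectors are covered
  by the sets \<open>cyclic_vecs\<close>.\<close>

lemma kernel_subset_minimal:
  fixes A :: "'a :: field mat"
  assumes A: "A \<in> carrier_mat n n" and v: "v \<in> carrier_vec n" "v \<noteq> 0\<^sub>v n" and irr: "irreducible \<phi>"
    and z: "mat_poly n A (\<phi> ^ k) *\<^sub>v v = 0\<^sub>v n"
  shows "\<exists>j\<in>{1..k}. mat_poly n A (\<phi> ^ j) *\<^sub>v v = 0\<^sub>v n \<and> full_col_rank (krylov n A v (degree (\<phi> ^ j)))"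
proof -
  define j where "j = (LEAST j. mat_poly n A (\<phi> ^ j) *\<^sub>v v = 0\<^sub>v n)"
  have j: "mat_poly n A (\<phi> ^ j) *\<^sub>v v = 0\<^sub>v n" unfolding j_def by (rule LeastI, rule z)
  have jk: "j \<le> k" unfolding j_def by (rule Least_le, rule z)
  have "j \<noteq> 0" using j v A by (intro notI) simp
  then obtain i where i: "j = Suc i" by (cases j) auto
  have "mat_poly n A (\<phi> ^ i) *\<^sub>v v \<noteq> 0\<^sub>v n"
    using not_less_Least[of i "\<lambda>j. mat_poly n A (\<phi> ^ j) *\<^sub>v v = 0\<^sub>v n"] i j_def by auto
  then show ?thesis
    using krylov_full_rank_minimal[OF A v(1) irr j[unfolded i]] j jk i by (intro bexI[of _ j]) auto
qed

lemma geometric_tail: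
  fixes t :: real
  assumes "0 \<le> t" "t \<le> 1 / 2"
  shows "(\<Sum>k=2..n. t ^ k) \<le> 2 * t ^ 2"
proof (cases "n = 0")
  case False
  then have "1 \<le> n" by simp
  \<comment> \<open>The added term \<open>2 * t ^ Suc n\<close> bounds the rest of the series and
    makes the induction close, as \<open>2 * t \<le> 1\<close>.\<close>
  then have "(\<Sum>k=2..n. t ^ k) + 2 * t ^ Suc n \<le> 2 * t ^ 2"
  proof (induction n rule: dec_induct)
    case (step m)
    have "2 * t * t ^ Suc m \<le> 1 * t ^ Suc m" using assms by (intro mult_right_mono) auto
    moreover have "(\<Sum>k=2..Suc m. t ^ k) = (\<Sum>k=2..m. t ^ k) + t ^ Suc m" using step by simp
    ultimately show ?case using step.IH by (simp add: mult.assoc)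
  qed (simp add: power2_eq_square)
  then show ?thesis using assms by (smt (verit) zero_le_power)
qed (use assms in simp)

lemma nat_le_two_power: "real k * 2 \<le> 2 ^ k" if "k \<ge> 1"
  using that
proof (induction k rule: dec_induct)
  case (step m)
  have "(2 :: real) \<le> 2 ^ m" using step by (simp add: self_le_power)
  then show ?case using step.IH by (simp add: algebra_simps)
qed simp

section \<open>Expected multiplicity of a single irreducible polynomial\<close>

context unitary_field
begin

lemma map_frob_mult: "map_poly (\<lambda>c. (c :: 'a) ^ q) (f * g) = map_poly (\<lambda>c. c ^ q) f * map_poly (\<lambda>c. c ^ q) g"
  by (rule poly_eqI) (simp add: coeff_mult frob_sum power_mult_distrib)

lemma conj_reflect_mult: "conj_reflect (f * g) = conj_reflect f * conj_reflect g"
  by (simp add: conj_reflect_def map_frob_mult reflect_poly_mult)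

lemma conj_reflect_1 [simp]: "conj_reflect 1 = 1"
  by (rule poly_eqI) (auto simp: coeff_conj_reflect)

lemma conj_reflect_power: "conj_reflect (f ^ k) = conj_reflect f ^ k"
  by (induction k) (auto simp: conj_reflect_mult)

text \<open>If \<open>coeff \<phi> 0 \<noteq> 0\<close>, both polynomials have the same degree, so
  divisibility means proportionality.\<close>

definition self_dual :: "'a poly \<Rightarrow> bool" where
  "self_dual \<phi> \<longleftrightarrow> \<phi> dvd conj_reflect \<phi>"

lemma hermitian_recurrent_not_self_dual:
  assumes "irreducible \<phi>" "\<not> self_dual \<phi>"
  shows "hermitian_recurrent (\<phi> ^ j) = {\<lambda>_. 0}"
proof -
  obtain a b where "a * conj_reflect \<phi> + b * \<phi> = 1"
    using irreducible_bezout[OF assms(1)] assms(2) unfolding self_dual_def by blast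
  then obtain a' b' where "a' * conj_reflect \<phi> ^ j + b' * \<phi> ^ j = 1"
    using bezout_powers by blast
  then have "b' * \<phi> ^ j + a' * conj_reflect (\<phi> ^ j) = 1"
    by (simp add: conj_reflect_power add.commute)
  then show ?thesis by (rule hermitian_recurrent_trivial)
qed

text \<open>A vanishing constant term would make 0 an eigenvalue of an invertible matrix.\<close>

lemma unitary_dvd_char_poly_coeff_0:
  assumes A: "(A :: 'a mat) \<in> unitary_group n q" and dvd: "\<phi> dvd char_poly A"
  shows "coeff \<phi> 0 \<noteq> 0"
proof
  assume "coeff \<phi> 0 = 0"
  note Ac = unitary_carrier[OF A]
  have "poly (char_poly A) 0 = 0" using dvd \<open>coeff \<phi> 0 = 0\<close> by (auto simp: poly_0_coeff_0 coeff_mult elim!: dvdE)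
  then have "eigenvalue A 0" using eigenvalue_root_char_poly[OF Ac] by simp
  then obtain v where v: "v \<in> carrier_vec n" "v \<noteq> 0\<^sub>v n" "A *\<^sub>v v = 0 \<cdot>\<^sub>v v"
    using Ac by (auto simp: eigenvalue_def eigenvector_def)
  have z: "0 \<cdot>\<^sub>v v = 0\<^sub>v n" using v(1) by (intro eq_vecI) auto
  obtain B where B: "B \<in> carrier_mat n n" "B * A = 1\<^sub>m n" using unitary_inverse[OF A] by blast
  have "v = (B * A) *\<^sub>v v" using B(2) v(1) by simp
  also have "\<dots> = B *\<^sub>v (A *\<^sub>v v)" by (rule assoc_mult_mat_vec[OF B(1) Ac v(1)])
  also have "\<dots> = 0\<^sub>v n" unfolding v(3) z using B(1) by (intro eq_vecI) auto
  finally show False using v(2) by simp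
qed

definition dvd_count :: "nat \<Rightarrow> 'a poly \<Rightarrow> nat" where
  "dvd_count n p = card {A \<in> unitary_group n q. p dvd char_poly (A :: 'a mat)}"

text \<open>Markov's inequality in counting form. Each \<open>A\<close> on the left has at least
  \<open>q ^ (2 * k * degree \<phi>) - 1\<close> nonzero vectors in the kernel of
  \<open>\<phi> ^ k\<close> at \<open>A\<close>, each with minimal polynomial
  \<open>\<phi> ^ j\<close> for some \<open>j\<close> from 1 to \<open>k\<close>; the pairs formed
  with such vectors are bounded by \<open>card_cyclic_pairs\<close>.\<close>

lemma dvd_count_bound:
  assumes irr: "irreducible \<phi>" and c0: "coeff \<phi> 0 \<noteq> 0"
  shows "dvd_count n (\<phi> ^ k) * (q ^ (2 * k * degree \<phi>) - 1)
    \<le> card (unitary_group n q :: 'a mat set) * (\<Sum>j=1..k. card (hermitian_recurrent (\<phi> ^ j)))"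
proof -
  let ?U = "unitary_group n q :: 'a mat set"
  let ?S = "{A \<in> ?U. \<phi> ^ k dvd char_poly A}"
  have fin: "finite (cyclic_vecs n A f)" for A f
    by (rule finite_subset[OF _ finite_carrier_vec[of n]]) (auto simp: cyclic_vecs_def)
  have one: "q ^ (2 * k * degree \<phi>) - 1 \<le> (\<Sum>j=1..k. card (cyclic_vecs n A (\<phi> ^ j)))" if A: "A \<in> ?S" for A
  proof -
    have Ac: "A \<in> carrier_mat n n" using A unitary_carrier by blast
    let ?K = "{v \<in> carrier_vec n. mat_poly n A (\<phi> ^ k) *\<^sub>v v = 0\<^sub>v n}"
    have "CARD('a) ^ (k * degree \<phi>) \<le> card ?K"
      using card_kernel_ge[OF irr Ac] A by blast
    moreover have "CARD('a) ^ (k * degree \<phi>) = q ^ (2 * k * degree \<phi>)"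
      by (simp add: card_field power_mult[symmetric] mult.assoc)
    moreover have "?K \<subseteq> insert (0\<^sub>v n) (\<Union>j\<in>{1..k}. cyclic_vecs n A (\<phi> ^ j))"
      using kernel_subset_minimal[OF Ac _ _ irr] by (auto simp: cyclic_vecs_def)
    then have "card ?K \<le> card (insert (0\<^sub>v n) (\<Union>j\<in>{1..k}. cyclic_vecs n A (\<phi> ^ j)))"
      using fin by (intro card_mono) auto
    moreover have "\<dots> \<le> Suc (card (\<Union>j\<in>{1..k}. cyclic_vecs n A (\<phi> ^ j)))"
      by (rule card_insert_le_m1) auto
    moreover have "card (\<Union>j\<in>{1..k}. cyclic_vecs n A (\<phi> ^ j)) \<le> (\<Sum>j=1..k. card (cyclic_vecs n A (\<phi> ^ j)))"
      by (rule card_UN_le) simp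
    ultimately show ?thesis by linarith
  qed
  have "dvd_count n (\<phi> ^ k) * (q ^ (2 * k * degree \<phi>) - 1) = (\<Sum>A\<in>?S. q ^ (2 * k * degree \<phi>) - 1)"
    by (simp add: dvd_count_def)
  also have "\<dots> \<le> (\<Sum>A\<in>?S. \<Sum>j=1..k. card (cyclic_vecs n A (\<phi> ^ j)))"
    by (rule sum_mono) (rule one)
  also have "\<dots> \<le> (\<Sum>A\<in>?U. \<Sum>j=1..k. card (cyclic_vecs n A (\<phi> ^ j)))"
    by (rule sum_mono2) (auto intro: unitary_finite)
  also have "\<dots> = (\<Sum>j=1..k. \<Sum>A\<in>?U. card (cyclic_vecs n A (\<phi> ^ j)))" by (rule sum.swap)
  also have "\<dots> \<le> (\<Sum>j=1..k. card ?U * card (hermitian_recurrent (\<phi> ^ j)))"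
  proof (rule sum_mono)
    fix j
    have "coeff (\<phi> ^ j) 0 \<noteq> 0" using c0 by (simp add: coeff_0_power)
    then show "(\<Sum>A\<in>?U. card (cyclic_vecs n A (\<phi> ^ j))) \<le> card ?U * card (hermitian_recurrent (\<phi> ^ j))"
      by (intro card_cyclic_pairs hermitian_recurrent_card)
  qed
  finally show ?thesis by (simp add: sum_distrib_left)
qed

text \<open>The degree of \<phi> or of the product of \<phi> with its conjugate reciprocal,
  whichever is self-dual. With this exponent \<open>wt\<close> is the \<open>w\<close> of the
  overview in both cases.\<close>

definition dual_size :: "'a poly \<Rightarrow> nat" where
  "dual_size \<phi> = (if self_dual \<phi> then degree \<phi> else 2 * degree \<phi>)"

lemma dvd_char_poly_size:
  assumes A: "(A :: 'a mat) \<in> unitary_group n q" and irr: "irreducible \<phi>" and dvd: "\<phi> dvd char_poly A"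
  shows "dual_size \<phi> \<le> n"
proof (cases "self_dual \<phi>")
  case True
  have "degree (char_poly A) = n" "char_poly A \<noteq> 0"
    using degree_monic_char_poly[OF unitary_carrier[OF A]] by auto
  then show ?thesis using True dvd_imp_degree_le[OF dvd] by (simp add: dual_size_def)
next
  case False
  note Ac = unitary_carrier[OF A]
  obtain v where v: "v \<in> carrier_vec n" "v \<noteq> 0\<^sub>v n" "mat_poly n A \<phi> *\<^sub>v v = 0\<^sub>v n"
    using dvd_char_poly_kernel[OF Ac degree_irreducible_pos[OF irr] dvd] by blast
  then have "v \<in> cyclic_vecs n A \<phi>"
    using kernel_subset_minimal[OF Ac v(1,2) irr, of 1] by (auto simp: cyclic_vecs_def)
  then have "2 * degree \<phi> \<le> n"
    using cyclic_vecs_isotropic[OF A] hermitian_recurrent_not_self_dual[OF irr False, of 1] by simp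
  then show ?thesis using False by (simp add: dual_size_def)
qed

definition wt :: "'a poly \<Rightarrow> real" where
  "wt \<phi> = 1 / real q ^ dual_size \<phi>"

text \<open>By \<open>sum_multiplicity\<close> this is the mean of
  \<open>poly_multiplicity \<phi> (char_poly A)\<close> for \<phi> in
  \<open>irr_upto n\<close>.\<close>

definition expected_mult :: "nat \<Rightarrow> 'a poly \<Rightarrow> real" where
  "expected_mult n \<phi> = (\<Sum>k=1..n. real (dvd_count n (\<phi> ^ k))) / real (card (unitary_group n q :: 'a mat set))"

lemma card_unitary_pos: "card (unitary_group n q :: 'a mat set) > 0"
  using unitary_finite unitary_nonempty by (simp add: card_gt_0_iff)

lemma wt_bounds:
  assumes "degree \<phi> > 0"
  shows "0 < wt \<phi>" "wt \<phi> \<le> 1 / 2"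
proof -
  show "0 < wt \<phi>" using q_pos by (simp add: wt_def)
  have "2 ^ 1 \<le> (2 :: real) ^ dual_size \<phi>"
    using assms by (intro power_increasing) (auto simp: dual_size_def)
  also have "\<dots> \<le> real q ^ dual_size \<phi>" using q_ge_2 by (intro power_mono) auto
  finally show "wt \<phi> \<le> 1 / 2" by (simp add: wt_def field_simps)
qed

lemma dvd_count_frac_bound:
  assumes irr: "irreducible \<phi>" and c0: "coeff \<phi> 0 \<noteq> 0" and k: "k \<ge> 1"
  shows "real (dvd_count n (\<phi> ^ k)) / real (card (unitary_group n q :: 'a mat set))
    \<le> real (\<Sum>j=1..k. card (hermitian_recurrent (\<phi> ^ j))) / (real q ^ (2 * k * degree \<phi>) - 1)"
proof -
  have d: "degree \<phi> > 0" by (rule degree_irreducible_pos[OF irr])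
  have "(1 :: nat) < q ^ (2 * k * degree \<phi>)" using q_ge_2 d k by (intro one_less_power) auto
  moreover from this have "1 < real q ^ (2 * k * degree \<phi>)" by (metis of_nat_1 of_nat_less_iff of_nat_power)
  moreover have "real (dvd_count n (\<phi> ^ k) * (q ^ (2 * k * degree \<phi>) - 1))
    \<le> real (card (unitary_group n q :: 'a mat set) * (\<Sum>j=1..k. card (hermitian_recurrent (\<phi> ^ j))))"
    by (rule of_nat_mono[OF dvd_count_bound[OF irr c0]])
  ultimately show ?thesis
    using card_unitary_pos[of n] by (simp add: field_simps of_nat_diff del: of_nat_sum)
qed

text \<open>The constant is 2 times 2: the geometric sum is at most twice its last term, and the
  denominator is at least half of \<open>x ^ (2 * k)\<close>.\<close>

lemma self_dual_frac_bound:
  fixes x :: real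
  assumes "x \<ge> 2" "k \<ge> 1"
  shows "(\<Sum>j=1..k. x ^ j) / (x ^ (2 * k) - 1) \<le> 4 * (1 / x) ^ k"
proof -
  have s: "(\<Sum>j=1..k. x ^ j) \<le> 2 * x ^ k"
  proof (induction k)
    case (Suc k)
    have "2 * x ^ k \<le> x * x ^ k" using assms by (intro mult_right_mono) auto
    then show ?case using Suc by simp
  qed simp
  have "2 ^ 1 \<le> (2 :: real) ^ (2 * k)" using assms by (intro power_increasing) auto
  also have "\<dots> \<le> x ^ (2 * k)" using assms by (intro power_mono) auto
  finally have d: "x ^ (2 * k) - 1 \<ge> x ^ (2 * k) / 2" "x ^ (2 * k) > 0" by auto
  have "(\<Sum>j=1..k. x ^ j) / (x ^ (2 * k) - 1) \<le> (2 * x ^ k) / (x ^ (2 * k) / 2)"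
    using s d assms by (intro frac_le) auto
  also have "\<dots> = 4 * (1 / x) ^ k"
  proof -
    have "x ^ k > 0" "x ^ (2 * k) = x ^ k * x ^ k" using assms by (auto simp: mult_2 power_add)
    then show ?thesis by (simp add: power_divide)
  qed
  finally show ?thesis .
qed

text \<open>The term \<open>k = 1\<close> is estimated sharply, since it supplies the main term
  \<open>wt \<phi>\<close>, with an error of \<open>2 * wt \<phi> ^ 2\<close>. The terms from
  \<open>k = 2\<close> on may lose constants and add \<open>8 * wt \<phi> ^ 2\<close>, as 4 times 2
  in the self-dual case and as 2 times the square of 2 otherwise.\<close>

lemma expected_mult_bound:
  assumes irr: "irreducible \<phi>" and c0: "coeff \<phi> 0 \<noteq> 0"
  shows "expected_mult n \<phi> \<le> wt \<phi> + 10 * wt \<phi> ^ 2"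
proof -
  define d where "d = degree \<phi>"
  have dpos: "d > 0" unfolding d_def by (rule degree_irreducible_pos[OF irr])
  let ?U = "real (card (unitary_group n q :: 'a mat set))"
  let ?P = "\<lambda>k. real (dvd_count n (\<phi> ^ k)) / ?U"
  have w: "0 < wt \<phi>" "wt \<phi> \<le> 1 / 2" using wt_bounds dpos by (auto simp: d_def)
  have "?P 1 \<le> wt \<phi> + 2 * wt \<phi> ^ 2 \<and> (\<Sum>k=2..n. ?P k) \<le> 8 * wt \<phi> ^ 2"
  proof (cases "self_dual \<phi>")
    case True
    define x where "x = real q ^ d"
    have wx: "wt \<phi> = 1 / x" using True by (simp add: wt_def dual_size_def x_def d_def)
    have x2: "x \<ge> 2" using w wx by (simp add: field_simps)
    have P: "?P k \<le> (\<Sum>j=1..k. x ^ j) / (x ^ (2 * k) - 1)" if "k \<ge> 1" for k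
    proof -
      have c: "coeff (\<phi> ^ j) 0 \<noteq> 0" for j using c0 by (simp add: coeff_0_power)
      have "real (card (hermitian_recurrent (\<phi> ^ j))) \<le> x ^ j" for j
      proof -
        have "card (hermitian_recurrent (\<phi> ^ j)) \<le> q ^ degree (\<phi> ^ j)" by (rule hermitian_recurrent_card(2)[OF c])
        also have "degree (\<phi> ^ j) = d * j" using irr by (subst degree_power_eq) (auto simp: d_def)
        finally show ?thesis unfolding x_def power_mult[symmetric] by (metis of_nat_mono of_nat_power)
      qed
      then have "real (\<Sum>j=1..k. card (hermitian_recurrent (\<phi> ^ j))) \<le> (\<Sum>j=1..k. x ^ j)"
        by (simp add: sum_mono)
      moreover have "real q ^ (2 * k * degree \<phi>) = x ^ (2 * k)"
        unfolding x_def d_def by (simp add: power_mult[symmetric] mult.commute mult.left_commute)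
      moreover have "x ^ (2 * k) \<ge> 1" using x2 by simp
      ultimately show ?thesis
        using dvd_count_frac_bound[OF irr c0 that, of n] by (smt (verit) divide_right_mono)
    qed
    have "?P 1 \<le> x / (x ^ 2 - 1)" using P[of 1] by simp
    also have "\<dots> \<le> 1 / x + 2 * (1 / x) ^ 2"
    proof -
      have xx: "2 * x \<le> x * x" using x2 by (intro mult_right_mono) auto
      then have pos: "x ^ 2 - 1 > 0" "x ^ 2 > 0" using x2 unfolding power2_eq_square by linarith+
      have "x * x ^ 2 \<le> (x + 2) * (x ^ 2 - 1)"
      proof -
        have "(x + 2) * (x ^ 2 - 1) - x * x ^ 2 = 2 * (x * x) - x - 2"
          by (simp add: power2_eq_square algebra_simps)
        then show ?thesis using x2 xx by linarith
      qed
      then have "x \<le> ((x + 2) * (x ^ 2 - 1)) / x ^ 2" using pos by (simp add: pos_le_divide_eq)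
      then have "x / (x ^ 2 - 1) \<le> (x + 2) / x ^ 2" using pos by (simp add: pos_divide_le_eq)
      also have "\<dots> = 1 / x + 2 * (1 / x) ^ 2" using x2 by (simp add: power2_eq_square field_simps)
      finally show ?thesis .
    qed
    finally have 1: "?P 1 \<le> wt \<phi> + 2 * wt \<phi> ^ 2" by (simp only: wx)
    have "(\<Sum>k=2..n. ?P k) \<le> (\<Sum>k=2..n. 4 * (1 / x) ^ k)"
      by (rule sum_mono, rule order_trans[OF P self_dual_frac_bound[OF x2]]) auto
    also have "\<dots> = 4 * (\<Sum>k=2..n. wt \<phi> ^ k)" by (simp add: sum_distrib_left wx)
    also have "\<dots> \<le> 4 * (2 * wt \<phi> ^ 2)" using w by (intro mult_left_mono geometric_tail) auto
    finally show ?thesis using 1 by simp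
  next
    case False
    define y where "y = real q ^ (2 * d)"
    have wy: "wt \<phi> = 1 / y" using False by (simp add: wt_def dual_size_def y_def d_def)
    have "2 ^ 2 \<le> (2 :: real) ^ (2 * d)" using dpos by (intro power_increasing) auto
    also have "\<dots> \<le> y" unfolding y_def using q_ge_2 by (intro power_mono) auto
    finally have y4: "y \<ge> 4" by simp
    have P: "?P k \<le> real k / (y ^ k - 1)" if "k \<ge> 1" for k
    proof -
      have "real (\<Sum>j=1..k. card (hermitian_recurrent (\<phi> ^ j))) = real k"
        by (simp add: hermitian_recurrent_not_self_dual[OF irr False])
      moreover have "real q ^ (2 * k * degree \<phi>) = y ^ k"
        unfolding y_def d_def by (simp add: power_mult[symmetric] mult.commute mult.left_commute)
      ultimately show ?thesis
        using dvd_count_frac_bound[OF irr c0 that, of n] by (simp del: of_nat_sum)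
    qed
    have "?P 1 \<le> 1 / (y - 1)" using P[of 1] by simp
    also have "\<dots> \<le> (y + 2) / (y * y)" using y4 by (simp add: divide_le_eq le_divide_eq field_simps)
    also have "\<dots> = wt \<phi> + 2 * wt \<phi> ^ 2" using y4 by (simp add: wy power2_eq_square field_simps)
    finally have 1: "?P 1 \<le> wt \<phi> + 2 * wt \<phi> ^ 2" .
    \<comment> \<open>The numerator \<open>k\<close> counts one Gram sequence for each
      \<open>j\<close> up to \<open>k\<close>. It is absorbed by doubling the ratio, which stays
      below 1/2 because \<open>y \<ge> 4\<close>.\<close>
    have P2: "?P k \<le> (2 * wt \<phi>) ^ k" if "k \<ge> 1" for k
    proof -
      have "2 ^ 1 \<le> (2 :: real) ^ k" using that by (intro power_increasing) auto
      also have "\<dots> \<le> y ^ k" using y4 by (intro power_mono) auto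
      finally have yk: "y ^ k - 1 \<ge> y ^ k / 2" "y ^ k > 0" by auto
      have "real k / (y ^ k - 1) \<le> real k / (y ^ k / 2)"
        using yk by (intro divide_left_mono mult_pos_pos) auto
      also have "\<dots> = (real k * 2) * (1 / y) ^ k" using yk by (simp add: power_divide)
      also have "\<dots> \<le> 2 ^ k * (1 / y) ^ k"
        using nat_le_two_power[OF that] y4 by (intro mult_right_mono) auto
      also have "\<dots> = (2 * wt \<phi>) ^ k" by (simp add: wy power_divide)
      finally show ?thesis using P[OF that] by linarith
    qed
    have "(\<Sum>k=2..n. ?P k) \<le> (\<Sum>k=2..n. (2 * wt \<phi>) ^ k)" by (rule sum_mono, rule P2) auto
    also have "\<dots> \<le> 2 * (2 * wt \<phi>) ^ 2" using y4 by (intro geometric_tail) (auto simp: wy field_simps)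
    finally show ?thesis using 1 by (simp add: power_mult_distrib)
  qed
  moreover have "expected_mult n \<phi> \<le> ?P 1 + (\<Sum>k=2..n. ?P k)"
  proof (cases "n = 0")
    case False
    then have "(\<Sum>k=1..n. ?P k) = ?P 1 + (\<Sum>k=2..n. ?P k)"
      by (subst sum.atLeast_Suc_atMost) (auto simp: numeral_2_eq_2)
    then show ?thesis by (simp add: expected_mult_def sum_divide_distrib)
  qed (simp add: expected_mult_def)
  ultimately show ?thesis by linarith
qed

lemma expected_mult_eq_0:
  assumes "irreducible \<phi>" "dual_size \<phi> > n \<or> coeff \<phi> 0 = 0"
  shows "expected_mult n \<phi> = 0"
proof -
  have "dvd_count n (\<phi> ^ k) = 0" if "k \<in> {1..n}" for k
  proof -
    have "\<phi> dvd \<phi> ^ k" using that by (intro dvd_power) auto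
    then have "\<not> \<phi> ^ k dvd char_poly A" if "A \<in> unitary_group n q" for A
      using dvd_char_poly_size[OF that assms(1)] unitary_dvd_char_poly_coeff_0[OF that] assms(2) dvd_trans
      by (meson leD)
    then have "{A \<in> unitary_group n q. \<phi> ^ k dvd char_poly (A :: 'a mat)} = {}" by blast
    then show ?thesis unfolding dvd_count_def by (simp only: card.empty)
  qed
  then show ?thesis by (simp add: expected_mult_def)
qed

end

section \<open>Counting polynomials\<close>

text \<open>A nonconstant divisor of least degree cannot split further; scaling makes it
  monic.\<close>

lemma ex_monic_irreducible_factor:
  fixes f :: "'a :: field poly"
  assumes "degree f > 0"
  obtains \<phi> where "monic \<phi>" "irreducible \<phi>" "\<phi> dvd f"
proof -
  define m where "m = (LEAST m. \<exists>g. g dvd f \<and> degree g = m \<and> m > 0)"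
  have "\<exists>g. g dvd f \<and> degree g = m \<and> m > 0"
    unfolding m_def by (rule LeastI[of _ "degree f"], rule exI[of _ f]) (use assms in auto)
  then obtain g where g: "g dvd f" "degree g = m" "m > 0" by blast
  have min: "m \<le> degree h" if "h dvd f" "degree h > 0" for h
    unfolding m_def by (rule Least_le) (use that in auto)
  have g0: "g \<noteq> 0" using g by auto
  have irr: "irreducible g"
  proof (rule irreducibleI)
    show "\<not> g dvd 1" using g g0 by (simp add: is_unit_iff_degree)
    fix a b assume ab: "g = a * b"
    have ne: "a \<noteq> 0" "b \<noteq> 0" using g0 ab by auto
    have sum: "degree a + degree b = m" using g ne by (simp add: ab degree_mult_eq)
    have "a dvd f" "b dvd f" using g(1) ab by (auto intro: dvd_mult_left dvd_mult_right)
    then have "degree a = 0 \<or> degree b = 0" using min[of a] min[of b] sum g(3) by linarith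
    then show "a dvd 1 \<or> b dvd 1" using ne by (auto simp: is_unit_iff_degree)
  qed (rule g0)
  let ?c = "inverse (lead_coeff g)"
  have c: "?c \<noteq> 0" using g0 by simp
  show thesis
  proof (rule that[of "Polynomial.smult ?c g"])
    show "irreducible (Polynomial.smult ?c g)" using irr c by simp
    show "Polynomial.smult ?c g dvd f" using g c by (simp add: smult_dvd_iff)
  qed (use g0 in simp)
qed

lemma monic_irreducible_coprime:
  fixes \<phi> \<psi> :: "'a :: field poly"
  assumes "monic \<phi>" "irreducible \<phi>" "monic \<psi>" "irreducible \<psi>" "\<phi> \<noteq> \<psi>"
  shows "\<not> \<phi> dvd \<psi>"
proof
  assume "\<phi> dvd \<psi>"
  then obtain c where c: "\<psi> = \<phi> * c" by blast
  then have "\<phi> dvd 1 \<or> c dvd 1" using irreducibleD[OF assms(4)] by blast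
  then have u: "c dvd 1" using assms(2) by (auto simp: irreducible_def)
  have "c \<noteq> 0" using c assms(4) by auto
  then have "degree c = 0" using u by (simp add: is_unit_iff_degree)
  moreover have "lead_coeff c = 1" using c assms(1,3) by (simp add: lead_coeff_mult)
  ultimately have "c = 1" by (metis degree_0_id one_pCons)
  then show False using c assms(5) by simp
qed

text \<open>If the two polynomials agree, the admissible exponents shift by one; otherwise a Bezout
  identity cancels \<psi>.\<close>

lemma poly_multiplicity_mult_irreducible:
  fixes \<phi> \<psi> g :: "'a :: field poly"
  assumes \<phi>: "monic \<phi>" "irreducible \<phi>" and \<psi>: "monic \<psi>" "irreducible \<psi>" and g: "g \<noteq> 0"
  shows "poly_multiplicity \<phi> (\<psi> * g) = poly_multiplicity \<phi> g + (if \<phi> = \<psi> then 1 else 0)"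
proof -
  have dp: "degree \<phi> > 0" "degree \<psi> > 0" using degree_irreducible_pos \<phi> \<psi> by auto
  have ne: "\<psi> \<noteq> 0" "\<psi> * g \<noteq> 0" using \<psi> g by auto
  define N where "N = degree g"
  have dg: "degree (\<psi> * g) = degree \<psi> + N" using ne g by (simp add: degree_mult_eq N_def)
  show ?thesis
  proof (cases "\<phi> = \<psi>")
    case True
    have "poly_multiplicity \<phi> (\<psi> * g) = card {k \<in> {1..Suc (degree \<psi> + N)}. \<phi> ^ k dvd \<psi> * g}"
      using dg ne dp by (intro poly_multiplicity_eq_card) auto
    also have "{k \<in> {1..Suc (degree \<psi> + N)}. \<phi> ^ k dvd \<psi> * g}
      = insert 1 (Suc ` {k \<in> {1..degree \<psi> + N}. \<phi> ^ k dvd g})" (is "?L = ?R")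
    proof (intro equalityI subsetI)
      fix k assume k: "k \<in> ?L"
      show "k \<in> ?R"
      proof (cases "k = 1")
        case False
        then obtain j where j: "k = Suc j" "j \<ge> 1" using k by (cases k) auto
        then have "\<phi> ^ j dvd g" using k True ne by auto
        then show ?thesis using j k by auto
      qed simp
    next
      fix k assume "k \<in> ?R"
      then show "k \<in> ?L" using True by (auto intro: mult_dvd_mono)
    qed
    also have "card \<dots> = Suc (card {k \<in> {1..degree \<psi> + N}. \<phi> ^ k dvd g})"
      by (subst card_insert_disjoint) (auto simp: card_image)
    also have "card {k \<in> {1..degree \<psi> + N}. \<phi> ^ k dvd g} = poly_multiplicity \<phi> g"
      using g dp by (intro poly_multiplicity_eq_card[symmetric]) (auto simp: N_def)
    finally show ?thesis using True by simp
  next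
    case False
    have "\<phi> ^ k dvd \<psi> * g \<longleftrightarrow> \<phi> ^ k dvd g" for k
    proof
      assume d: "\<phi> ^ k dvd \<psi> * g"
      obtain a b where ab: "a * \<psi> + b * \<phi> ^ k = 1"
        using irreducible_bezout[OF \<phi>(2) monic_irreducible_coprime[OF \<phi> \<psi> False]] bezout_power by metis
      have "\<phi> ^ k dvd a * (\<psi> * g) + (b * g) * \<phi> ^ k" using d by simp
      also have "a * (\<psi> * g) + (b * g) * \<phi> ^ k = (a * \<psi> + b * \<phi> ^ k) * g" by (simp add: algebra_simps)
      finally show "\<phi> ^ k dvd g" using ab by simp
    qed simp
    then show ?thesis using False by (simp add: poly_multiplicity_def)
  qed
qed

definition irr_upto :: "nat \<Rightarrow> 'a :: field poly set" where
  "irr_upto n = {\<phi>. monic \<phi> \<and> irreducible \<phi> \<and> degree \<phi> \<le> n}"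

definition monics :: "nat \<Rightarrow> 'a :: field poly set" where
  "monics n = {f. monic f \<and> degree f = n}"

lemma bij_betw_coeffs_monics:
  "bij_betw (\<lambda>f. restrict (coeff f) {..<n}) (monics n :: 'a :: field poly set) (PiE {..<n} (\<lambda>_. UNIV))"
  unfolding bij_betw_def
proof
  show "inj_on (\<lambda>f. restrict (coeff f) {..<n}) (monics n :: 'a poly set)"
  proof (rule inj_onI)
    fix f g :: "'a poly"
    assume fg: "f \<in> monics n" "g \<in> monics n" and eq: "restrict (coeff f) {..<n} = restrict (coeff g) {..<n}"
    show "f = g"
    proof (rule poly_eqI)
      fix i
      show "coeff f i = coeff g i"
      proof (cases i n rule: linorder_cases)
        case less
        then show ?thesis using fun_cong[OF eq, of i] by simp
      next
        case equal
        then show ?thesis using fg by (auto simp: monics_def)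
      next
        case greater
        then show ?thesis using fg by (auto simp: monics_def coeff_eq_0)
      qed
    qed
  qed
  show "(\<lambda>f. restrict (coeff f) {..<n}) ` (monics n :: 'a poly set) = PiE {..<n} (\<lambda>_. UNIV)"
  proof (intro equalityI subsetI)
    fix x :: "nat \<Rightarrow> 'a" assume x: "x \<in> PiE {..<n} (\<lambda>_. UNIV)"
    define f where "f = monom 1 n + (\<Sum>i<n. monom (x i) i)"
    have co: "coeff f i = (if i = n then 1 else if i < n then x i else 0)" for i
      by (auto simp: f_def coeff_sum)
    have "degree f = n" by (rule antisym, rule degree_le, simp add: co, rule le_degree, simp add: co)
    then have "f \<in> monics n" by (simp add: monics_def co)
    moreover have "restrict (coeff f) {..<n} = x"
      using x by (auto simp: fun_eq_iff restrict_def co PiE_def extensional_def)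
    ultimately show "x \<in> (\<lambda>f. restrict (coeff f) {..<n}) ` monics n" by blast
  next
    fix x assume "x \<in> (\<lambda>f. restrict (coeff f) {..<n}) ` (monics n :: 'a poly set)"
    then obtain f :: "'a poly" where "x = restrict (coeff f) {..<n}" by blast
    then show "x \<in> PiE {..<n} (\<lambda>_. UNIV)" by (simp only: restrict_PiE_iff) simp
  qed
qed

lemma card_monics: "card (monics n :: 'a :: {finite, field} poly set) = CARD('a) ^ n"
  using bij_betw_same_card[OF bij_betw_coeffs_monics[where ?'a = 'a and n = n]]
  by (simp only: card_PiE[OF finite_lessThan] prod_constant card_lessThan)

lemma finite_monics: "finite (monics n :: 'a :: {finite, field} poly set)"
proof -
  have "finite (PiE {..<n} (\<lambda>_. UNIV :: 'a set))" by (rule finite_PiE) auto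
  then show ?thesis
    using bij_betw_finite[OF bij_betw_coeffs_monics[where ?'a = 'a and n = n]] by blast
qed

lemma finite_irr_upto: "finite (irr_upto n :: 'a :: {finite, field} poly set)"
  by (rule finite_subset[of _ "\<Union>d\<in>{..n}. monics d"]) (auto simp: irr_upto_def monics_def finite_monics[unfolded monics_def])

text \<open>Unique factorization enters in this numerical form, proved by peeling off one monic
  irreducible factor at a time.\<close>

lemma sum_degree_multiplicity:
  fixes f :: "'a :: {finite, field} poly"
  assumes "monic f" "degree f \<le> N"
  shows "(\<Sum>\<phi>\<in>irr_upto N. degree \<phi> * poly_multiplicity \<phi> f) = degree f"
  using assms
proof (induction "degree f" arbitrary: f rule: less_induct)
  case less
  show ?case
  proof (cases "degree f = 0")
    case True
    then have f1: "f = 1" using less.prems by (metis degree_0_id one_pCons)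
    have "poly_multiplicity \<phi> f = 0" if "\<phi> \<in> irr_upto N" for \<phi>
    proof -
      have "degree \<phi> > 0" using that degree_irreducible_pos by (auto simp: irr_upto_def)
      then show ?thesis using poly_multiplicity_eq_card[of f \<phi> 0] f1 by simp
    qed
    then show ?thesis using True by simp
  next
    case False
    then obtain \<psi> where \<psi>: "monic \<psi>" "irreducible \<psi>" "\<psi> dvd f"
      using ex_monic_irreducible_factor by blast
    obtain g where g: "f = \<psi> * g" using \<psi>(3) by blast
    have g0: "g \<noteq> 0" "\<psi> \<noteq> 0" using less.prems g by auto
    have deg: "degree f = degree \<psi> + degree g" using g g0 by (simp add: degree_mult_eq)
    have dpos: "degree \<psi> > 0" using degree_irreducible_pos \<psi> by blast
    have gm: "monic g" using less.prems(1) \<psi>(1) g by (simp add: lead_coeff_mult)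
    have in_irr: "\<psi> \<in> irr_upto N" using \<psi> deg less.prems by (simp add: irr_upto_def)
    have "(\<Sum>\<phi>\<in>irr_upto N. degree \<phi> * poly_multiplicity \<phi> f)
      = (\<Sum>\<phi>\<in>irr_upto N. degree \<phi> * poly_multiplicity \<phi> g + (if \<phi> = \<psi> then degree \<psi> else 0))"
      using \<psi> g0 unfolding g
      by (intro sum.cong refl) (auto simp: irr_upto_def poly_multiplicity_mult_irreducible)
    also have "\<dots> = degree g + degree \<psi>"
      using less.hyps[of g] gm deg dpos less.prems in_irr
      by (simp add: sum.distrib finite_irr_upto)
    finally show ?thesis using deg by simp
  qed
qed

lemma card_monic_multiples:
  fixes g :: "'a :: {finite, field} poly"
  assumes g: "monic g" "degree g \<le> n"
  shows "card {f \<in> monics n. g dvd f} = CARD('a) ^ (n - degree g)"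
proof -
  have g0: "g \<noteq> 0" using g by auto
  have "{f \<in> monics n. g dvd f} = (\<lambda>h. g * h) ` monics (n - degree g)"
  proof (intro equalityI subsetI)
    fix f assume "f \<in> {f \<in> monics n. g dvd f}"
    then have f: "g dvd f" "monic f" "degree f = n" by (auto simp: monics_def)
    from f(1) obtain h where "f = g * h" by blast
    note h = this f(2,3)
    then have "h \<noteq> 0" by auto
    then have "degree h = n - degree g"
      using h g g0 by (auto simp: degree_mult_eq)
    moreover have "monic h" using lead_coeff_mult[of g h] h g by simp
    ultimately
    show "f \<in> (\<lambda>h. g * h) ` monics (n - degree g)" using h by (auto simp: monics_def)
  next
    fix f assume "f \<in> (\<lambda>h. g * h) ` monics (n - degree g)"
    then obtain h where h0: "f = g * h" "h \<in> monics (n - degree g)" by blast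
    then have h: "f = g * h" "monic h" "degree h = n - degree g" by (auto simp: monics_def)
    then have "h \<noteq> 0" by auto
    then have "degree f = n" using h g g0 by (simp add: degree_mult_eq)
    moreover have "monic f" using h g lead_coeff_mult[of g h] by simp
    ultimately show "f \<in> {f \<in> monics n. g dvd f}" using h by (auto simp: monics_def)
  qed
  moreover have "inj_on (\<lambda>h. g * h) (monics (n - degree g))" using g0 by (auto intro: inj_onI)
  ultimately show ?thesis by (simp add: card_image card_monics)
qed

text \<open>Double counting of the pairs \<open>\<phi>\<^sup>k dvd f\<close> with \<open>f\<close> monic of degree \<open>n\<close>.\<close>

lemma irr_mangoldt:
  fixes ty :: "'a :: {finite, field} itself"
  shows "(\<Sum>\<phi>\<in>(irr_upto n :: 'a poly set). \<Sum>k\<in>{k \<in> {1..n}. k * degree \<phi> \<le> n}.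
     real (degree \<phi>) / real CARD('a) ^ (k * degree \<phi>)) = real n"
proof -
  let ?I = "irr_upto n :: 'a poly set" and ?Q = "real CARD('a)"
  have Q: "?Q > 0" by (simp add: finite_UNIV_card_ge_0)
  have card: "real (card {f \<in> monics n. \<phi> ^ k dvd f}) = (if k * degree \<phi> \<le> n then ?Q ^ n / ?Q ^ (k * degree \<phi>) else 0)"
    if "\<phi> \<in> ?I" for \<phi> k
  proof -
    have \<phi>: "monic \<phi>" "\<phi> \<noteq> 0" using that by (auto simp: irr_upto_def)
    have deg: "degree (\<phi> ^ k) = k * degree \<phi>" using \<phi> by (simp add: degree_power_eq)
    have mon: "monic (\<phi> ^ k)" using \<phi> by (simp add: lead_coeff_power)
    show ?thesis
    proof (cases "k * degree \<phi> \<le> n")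
      case True
      have "card {f \<in> monics n. \<phi> ^ k dvd f} = CARD('a) ^ (n - k * degree \<phi>)"
        using card_monic_multiples[OF mon, of n] deg True by simp
      then have "real (card {f \<in> monics n. \<phi> ^ k dvd f}) = ?Q ^ (n - k * degree \<phi>)"
        by (simp only: of_nat_power)
      then show ?thesis using True Q power_diff[of ?Q, OF _ True] by simp
    next
      case False
      have "\<not> \<phi> ^ k dvd f" if "f \<in> monics n" for f
      proof
        assume "\<phi> ^ k dvd f"
        moreover have "f \<noteq> 0" using that by (auto simp: monics_def)
        ultimately have "degree (\<phi> ^ k) \<le> degree f" by (rule dvd_imp_degree_le)
        then show False using False deg that by (simp add: monics_def)
      qed
      then have "{f \<in> monics n. \<phi> ^ k dvd f} = {}" by blast
      with False show ?thesis by (simp only: if_False card.empty of_nat_0)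
    qed
  qed
  have "?Q ^ n * real n = (\<Sum>f\<in>(monics n :: 'a poly set). real (degree f))"
    using card_monics[where ?'a = 'a and n = n] by (simp add: monics_def)
  also have "\<dots> = (\<Sum>f\<in>(monics n :: 'a poly set). \<Sum>\<phi>\<in>?I. \<Sum>k\<in>{1..n}. real (degree \<phi>) * (if \<phi> ^ k dvd f then 1 else 0))"
  proof (rule sum.cong[OF refl])
    fix f :: "'a poly" assume f: "f \<in> monics n"
    have mult: "real (poly_multiplicity \<phi> f) = (\<Sum>k\<in>{1..n}. if \<phi> ^ k dvd f then 1 else 0)" if "\<phi> \<in> ?I" for \<phi>
    proof -
      have "degree \<phi> > 0" using that degree_irreducible_pos by (auto simp: irr_upto_def)
      then have "poly_multiplicity \<phi> f = card {k \<in> {1..n}. \<phi> ^ k dvd f}"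
        using f by (intro poly_multiplicity_eq_card) (auto simp: monics_def)
      then show ?thesis by (simp add: sum.If_cases Int_def)
    qed
    have "degree f = (\<Sum>\<phi>\<in>?I. degree \<phi> * poly_multiplicity \<phi> f)"
      by (rule sum_degree_multiplicity[symmetric]) (use f in \<open>auto simp: monics_def\<close>)
    then have "real (degree f) = (\<Sum>\<phi>\<in>?I. real (degree \<phi>) * real (poly_multiplicity \<phi> f))" by simp
    then show "real (degree f) = (\<Sum>\<phi>\<in>?I. \<Sum>k\<in>{1..n}. real (degree \<phi>) * (if \<phi> ^ k dvd f then 1 else 0))"
      by (simp add: mult sum_distrib_left cong: sum.cong)
  qed
  also have "\<dots> = (\<Sum>\<phi>\<in>?I. \<Sum>k\<in>{1..n}. real (degree \<phi>) * real (card {f \<in> monics n. \<phi> ^ k dvd f}))"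
    by (subst sum.swap, rule sum.cong[OF refl], subst sum.swap)
      (simp add: sum_distrib_left[symmetric] sum.If_cases Int_def finite_monics)
  also have "\<dots> = (\<Sum>\<phi>\<in>?I. \<Sum>k\<in>{1..n}. if k * degree \<phi> \<le> n then ?Q ^ n * (real (degree \<phi>) / ?Q ^ (k * degree \<phi>)) else 0)"
    by (intro sum.cong refl) (simp add: card)
  also have "\<dots> = ?Q ^ n * (\<Sum>\<phi>\<in>?I. \<Sum>k\<in>{k \<in> {1..n}. k * degree \<phi> \<le> n}. real (degree \<phi>) / ?Q ^ (k * degree \<phi>))"
    by (simp add: sum.inter_filter[symmetric] sum_distrib_left)
  finally show ?thesis using Q by simp
qed

lemma sum_irr_by_degree:
  "(\<Sum>\<phi>\<in>(irr_upto n :: 'a :: {finite, field} poly set). g \<phi>)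
    = (\<Sum>d=1..n. \<Sum>\<phi>\<in>{\<phi> \<in> irr_upto n. degree \<phi> = d}. g \<phi>)"
proof -
  have "degree ` (irr_upto n :: 'a poly set) \<subseteq> {1..n}"
    using degree_irreducible_pos by (auto simp: irr_upto_def Suc_le_eq)
  from sum.group[OF finite_irr_upto finite_atLeastAtMost this, of g] show ?thesis by simp
qed

lemma card_irr_degree: "card {\<phi> \<in> (irr_upto n :: 'a :: {finite, field} poly set). degree \<phi> = d} \<le> CARD('a) ^ d"
  unfolding card_monics[symmetric]
  by (rule card_mono[OF finite_monics]) (auto simp: monics_def irr_upto_def)

lemma sum_linear_half_powers: "(\<Sum>d=1..n. real d / 2 ^ d) \<le> 2"
proof -
  have "(\<Sum>d=1..n. real d / 2 ^ d) = 2 - (real n + 2) / 2 ^ n"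
  proof (induction n)
    case (Suc n)
    then show ?case by (simp add: field_simps)
  qed simp
  then show ?thesis by simp
qed

text \<open>Only the terms \<open>k = 1\<close> of \<open>irr_mangoldt\<close> are kept.\<close>

lemma irr_weight_upper:
  "(\<Sum>\<phi>\<in>(irr_upto n :: 'a :: {finite, field} poly set). real (degree \<phi>) / real CARD('a) ^ degree \<phi>) \<le> real n"
proof -
  have "(\<Sum>\<phi>\<in>(irr_upto n :: 'a poly set). real (degree \<phi>) / real CARD('a) ^ degree \<phi>)
    \<le> (\<Sum>\<phi>\<in>(irr_upto n :: 'a poly set). \<Sum>k\<in>{k \<in> {1..n}. k * degree \<phi> \<le> n}.
     real (degree \<phi>) / real CARD('a) ^ (k * degree \<phi>))"
  proof (rule sum_mono)
    fix \<phi> :: "'a poly" assume "\<phi> \<in> irr_upto n"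
    then have d: "0 < degree \<phi>" "degree \<phi> \<le> n" using degree_irreducible_pos by (auto simp: irr_upto_def)
    have "(\<Sum>k\<in>{1}. real (degree \<phi>) / real CARD('a) ^ (k * degree \<phi>))
      \<le> (\<Sum>k\<in>{k \<in> {1..n}. k * degree \<phi> \<le> n}. real (degree \<phi>) / real CARD('a) ^ (k * degree \<phi>))"
      using d by (intro sum_mono2) auto
    then show "real (degree \<phi>) / real CARD('a) ^ degree \<phi>
      \<le> (\<Sum>k\<in>{k \<in> {1..n}. k * degree \<phi> \<le> n}. real (degree \<phi>) / real CARD('a) ^ (k * degree \<phi>))" by simp
  qed
  then show ?thesis unfolding irr_mangoldt .
qed

text \<open>In \<open>irr_mangoldt\<close> the terms with \<open>k \<ge> 2\<close> form a geometric
  tail of size at most \<open>2 * degree \<phi> / CARD('a) ^ (2 * degree \<phi>)\<close>. With at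
  most \<open>CARD('a) ^ d\<close> polynomials of degree \<open>d\<close> they total at most twice
  the sum of \<open>d / 2 ^ d\<close>, hence 4.\<close>

lemma irr_weight_lower:
  "(\<Sum>\<phi>\<in>(irr_upto n :: 'a :: {finite, field} poly set). real (degree \<phi>) / real CARD('a) ^ degree \<phi>) \<ge> real n - 4"
proof -
  let ?Q = "real CARD('a)"
  have Q2: "?Q \<ge> 2" using card_field_gt_1[where ?'a = 'a] by simp
  have one: "(\<Sum>k\<in>{k \<in> {1..n}. k * degree \<phi> \<le> n}. real (degree \<phi>) / ?Q ^ (k * degree \<phi>))
    \<le> real (degree \<phi>) / ?Q ^ degree \<phi> + 2 * real (degree \<phi>) / ?Q ^ (2 * degree \<phi>)"
    if "\<phi> \<in> irr_upto n" for \<phi> :: "'a poly"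
  proof -
    have d: "0 < degree \<phi>" "degree \<phi> \<le> n" using that degree_irreducible_pos by (auto simp: irr_upto_def)
    define t where "t = 1 / ?Q ^ degree \<phi>"
    have "2 ^ 1 \<le> (2 :: real) ^ degree \<phi>" using d by (intro power_increasing) auto
    also have "\<dots> \<le> ?Q ^ degree \<phi>" using Q2 by (intro power_mono) auto
    finally have t: "0 \<le> t" "t \<le> 1 / 2" by (auto simp: t_def field_simps)
    have tk: "real (degree \<phi>) / ?Q ^ (k * degree \<phi>) = real (degree \<phi>) * t ^ k" for k
      by (simp add: t_def power_divide power_mult[symmetric] mult.commute)
    have "(\<Sum>k\<in>{k \<in> {1..n}. k * degree \<phi> \<le> n}. real (degree \<phi>) * t ^ k) \<le> (\<Sum>k\<in>{1..n}. real (degree \<phi>) * t ^ k)"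
      using t by (intro sum_mono2) auto
    also have "\<dots> = real (degree \<phi>) * (t + (\<Sum>k=2..n. t ^ k))"
      using d by (subst sum.atLeast_Suc_atMost) (auto simp: numeral_2_eq_2 sum_distrib_left distrib_left)
    also have "\<dots> \<le> real (degree \<phi>) * (t + 2 * t ^ 2)"
      using geometric_tail[OF t] by (intro mult_left_mono add_left_mono) auto
    finally show ?thesis
      unfolding tk using tk[of 1] tk[of 2] by (simp add: distrib_left)
  qed
  have upper: "real n \<le> (\<Sum>\<phi>\<in>(irr_upto n :: 'a poly set). real (degree \<phi>) / ?Q ^ degree \<phi>)
    + (\<Sum>\<phi>\<in>(irr_upto n :: 'a poly set). 2 * real (degree \<phi>) / ?Q ^ (2 * degree \<phi>))"
    unfolding sum.distrib[symmetric]
    by (rule ord_eq_le_trans[OF irr_mangoldt[where ?'a = 'a, symmetric]], rule sum_mono) (rule one)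
  have "(\<Sum>\<phi>\<in>(irr_upto n :: 'a poly set). 2 * real (degree \<phi>) / ?Q ^ (2 * degree \<phi>))
    \<le> (\<Sum>d=1..n. 2 * (real d / 2 ^ d))"
    unfolding sum_irr_by_degree
  proof (rule sum_mono)
    fix d
    have "real (card {\<phi> \<in> (irr_upto n :: 'a poly set). degree \<phi> = d}) \<le> ?Q ^ d"
      using card_irr_degree[where ?'a = 'a] by (metis of_nat_mono of_nat_power)
    then have "real (card {\<phi> \<in> (irr_upto n :: 'a poly set). degree \<phi> = d}) * (2 * real d / ?Q ^ (2 * d))
      \<le> ?Q ^ d * (2 * real d / ?Q ^ (2 * d))"
      by (intro mult_right_mono) auto
    also have "\<dots> = 2 * (real d / ?Q ^ d)"
    proof -
      have "?Q ^ (2 * d) = ?Q ^ d * ?Q ^ d" by (simp only: mult_2 power_add)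
      moreover have "?Q ^ d > 0" using Q2 by simp
      ultimately show ?thesis by simp
    qed
    also have "\<dots> \<le> 2 * (real d / 2 ^ d)"
      using Q2 by (intro mult_left_mono divide_left_mono power_mono mult_pos_pos) auto
    finally show "(\<Sum>\<phi>\<in>{\<phi> \<in> (irr_upto n :: 'a poly set). degree \<phi> = d}. 2 * real (degree \<phi>) / ?Q ^ (2 * degree \<phi>))
      \<le> 2 * (real d / 2 ^ d)" by simp
  qed
  also have "(\<Sum>d=1..n. 2 * (real d / 2 ^ d)) = 2 * (\<Sum>d=1..n. real d / 2 ^ d)"
    by (simp only: sum_distrib_left)
  also have "\<dots> \<le> 4" using sum_linear_half_powers[of n] by linarith
  finally show ?thesis using upper by simp
qed

context unitary_field
begin

section \<open>Self-dual polynomials\<close>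

lemma degree_conj_reflect:
  assumes "coeff f 0 \<noteq> 0"
  shows "degree (conj_reflect f) = degree f"
proof (rule antisym)
  show "degree (conj_reflect f) \<le> degree f" by (rule degree_le) (simp add: coeff_conj_reflect)
  show "degree f \<le> degree (conj_reflect f)"
    by (rule le_degree) (use assms in \<open>simp add: coeff_conj_reflect\<close>)
qed

lemma coeff_0_conj_reflect: "coeff (conj_reflect f) 0 = lead_coeff f ^ q"
  by (simp add: coeff_conj_reflect)

lemma lead_coeff_conj_reflect: "coeff f 0 \<noteq> 0 \<Longrightarrow> lead_coeff (conj_reflect f) = coeff f 0 ^ q"
  by (simp add: degree_conj_reflect coeff_conj_reflect)

lemma conj_reflect_conj_reflect:
  assumes "coeff f 0 \<noteq> 0"
  shows "conj_reflect (conj_reflect f) = f"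
proof (rule poly_eqI)
  show "coeff (conj_reflect (conj_reflect f)) i = coeff f i" for i
    using assms by (simp add: coeff_conj_reflect degree_conj_reflect coeff_eq_0)
qed

lemma conj_reflect_smult: "conj_reflect (Polynomial.smult c f) = Polynomial.smult (c ^ q) (conj_reflect f)"
  by (rule poly_eqI) (simp add: coeff_conj_reflect power_mult_distrib)

definition self_dual_monics :: "nat \<Rightarrow> 'a poly set" where
  "self_dual_monics m = {f \<in> monics m. coeff f 0 \<noteq> 0 \<and> conj_reflect f = Polynomial.smult (coeff f 0 ^ q) f}"

lemma finite_self_dual_monics: "finite (self_dual_monics m)"
  by (rule finite_subset[OF _ finite_monics[of m]]) (auto simp: self_dual_monics_def)

lemma self_dual_monics_mult:
  assumes "f \<in> self_dual_monics a" "g \<in> self_dual_monics b"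
  shows "f * g \<in> self_dual_monics (a + b)"
proof -
  have "f \<noteq> 0" "g \<noteq> 0" using assms by (auto simp: self_dual_monics_def)
  then have "degree (f * g) = a + b"
    using assms by (auto simp: self_dual_monics_def monics_def degree_mult_eq)
  moreover have "monic (f * g)"
    using assms lead_coeff_mult[of f g] by (auto simp: self_dual_monics_def monics_def)
  ultimately show ?thesis using assms
    by (auto simp: self_dual_monics_def monics_def conj_reflect_mult coeff_mult power_mult_distrib mult.commute)
qed

text \<open>Up to the leading and the constant term \<open>a\<close>, a self-dual polynomial is a fixed point of
  the semilinear involution \<open>x \<mapsto> a x(m - i)\<^sup>q\<close>.\<close>

lemma card_self_dual_slice:
  assumes a: "(a :: 'a) * a ^ q = 1" and m: "m \<ge> 1"
  shows "card {f \<in> self_dual_monics m. coeff f 0 = a} = q ^ (m - 1)"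
proof -
  \<comment> \<open>The \<open>m - 1\<close> middle coefficients, extended by zero to functions on
    \<open>nat\<close> as \<open>real_form_card\<close> expects.\<close>
  define V where "V = {x :: nat \<Rightarrow> 'a. x 0 = 0 \<and> (\<forall>i\<ge>m. x i = 0)}"
  define \<tau> where "\<tau> x = (\<lambda>i. if i \<le> m then a * x (m - i) ^ q else 0)" for x :: "nat \<Rightarrow> 'a"
  have a0: "a \<noteq> 0" "a ^ q * a = 1" using a by (auto simp: mult.commute)
  have bijV: "bij_betw (\<lambda>x. restrict x {1..<m}) V (PiE {1..<m} (\<lambda>_. UNIV))"
  proof (rule bij_betwI[where g = "\<lambda>x i. if i \<in> {1..<m} then x i else 0"])
    show "(\<lambda>i. if i \<in> {1..<m} then restrict x {1..<m} i else 0) = x" if "x \<in> V" for x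
    proof
      fix i show "(if i \<in> {1..<m} then restrict x {1..<m} i else 0) = x i"
        using that by (cases "i = 0") (auto simp: V_def)
    qed
    show "restrict (\<lambda>i. if i \<in> {1..<m} then y i else 0) {1..<m} = y" if "y \<in> PiE {1..<m} (\<lambda>_. UNIV)" for y :: "nat \<Rightarrow> 'a"
      using that by (auto simp: fun_eq_iff restrict_def PiE_def extensional_def)
  qed (use m in \<open>auto simp: V_def\<close>)
  have finP: "finite (PiE {1..<m} (\<lambda>_. UNIV :: 'a set))" by (rule finite_PiE) auto
  have finV: "finite V" using bij_betw_finite[OF bijV] finP by blast
  have cardV: "card V = CARD('a) ^ (m - 1)"
    using bij_betw_same_card[OF bijV] by (simp add: card_PiE)
  have "card {x \<in> V. \<tau> x = x} ^ 2 = card V"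
  proof (rule real_form_card[OF finV])
    fix x assume x: "x \<in> V"
    show "\<tau> x \<in> V" using x m by (auto simp: V_def \<tau>_def)
    show "\<tau> (\<tau> x) = x"
    proof
      fix i
      have "\<tau> (\<tau> x) i = (if i \<le> m then (a * a ^ q) * x i else 0)"
        by (simp add: \<tau>_def power_mult_distrib mult.assoc)
      then show "\<tau> (\<tau> x) i = x i" using x a by (auto simp: V_def)
    qed
  qed (auto simp: V_def \<tau>_def fun_eq_iff frob_add power_mult_distrib algebra_simps)
  then have "card {x \<in> V. \<tau> x = x} ^ 2 = (q ^ (m - 1)) ^ 2"
    unfolding cardV card_field by (simp add: power_mult[symmetric] mult.commute)
  then have cardH: "card {x \<in> V. \<tau> x = x} = q ^ (m - 1)" by (simp add: power2_eq_iff_nonneg)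
  define P where "P x = monom 1 m + [:a:] + (\<Sum>i<m. monom (x i) i)" for x
  have coP: "coeff (P x) i = (if i = m then 1 else if i = 0 then a else x i)" if "x \<in> V" for x i
    using that m by (cases "i < m") (auto simp: P_def V_def coeff_sum coeff_pCons split: nat.splits)
  have degP: "degree (P x) = m" if "x \<in> V" for x
  proof (rule antisym)
    show "degree (P x) \<le> m" using that by (intro degree_le) (auto simp: coP V_def)
    show "m \<le> degree (P x)" by (rule le_degree) (simp add: coP[OF that])
  qed
  have "bij_betw P {x \<in> V. \<tau> x = x} {f \<in> self_dual_monics m. coeff f 0 = a}"
  proof (rule bij_betwI[where g = "\<lambda>f i. if i \<in> {1..<m} then coeff f i else 0"])
    show "P \<in> {x \<in> V. \<tau> x = x} \<rightarrow> {f \<in> self_dual_monics m. coeff f 0 = a}"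
    proof
      fix x assume "x \<in> {x \<in> V. \<tau> x = x}"
      then have x: "x \<in> V" "\<tau> x = x" by auto
      have c0: "coeff (P x) 0 = a" using coP[OF x(1)] m by simp
      have "conj_reflect (P x) = Polynomial.smult (a ^ q) (P x)"
      proof (rule poly_eqI)
        fix i
        consider "i = 0" | "i = m" | "0 < i" "i < m" | "i > m" by linarith
        then show "coeff (conj_reflect (P x)) i = coeff (Polynomial.smult (a ^ q) (P x)) i"
        proof cases
          case 1
          then show ?thesis using m a0 by (simp add: coeff_conj_reflect degP[OF x(1)] coP[OF x(1)])
        next
          case 2
          then show ?thesis using m by (simp add: coeff_conj_reflect degP[OF x(1)] coP[OF x(1)])
        next
          case 3
          have "x i = a * x (m - i) ^ q" using fun_cong[OF x(2), of i] 3 by (simp add: \<tau>_def)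
          then have "a ^ q * x i = (a ^ q * a) * x (m - i) ^ q" by simp
          then show ?thesis using 3 a0 by (simp add: coeff_conj_reflect degP[OF x(1)] coP[OF x(1)])
        next
          case 4
          then have "x i = 0" using x(1) by (simp add: V_def)
          then show ?thesis using 4 m by (simp add: coeff_conj_reflect degP[OF x(1)] coP[OF x(1)])
        qed
      qed
      then show "P x \<in> {f \<in> self_dual_monics m. coeff f 0 = a}"
        using a0 c0 degP[OF x(1)] coP[OF x(1), of m] by (simp add: self_dual_monics_def monics_def)
    qed
    show "(\<lambda>f i. if i \<in> {1..<m} then coeff f i else 0) \<in> {f \<in> self_dual_monics m. coeff f 0 = a} \<rightarrow> {x \<in> V. \<tau> x = x}"
    proof
      fix f assume "f \<in> {f \<in> self_dual_monics m. coeff f 0 = a}"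
      then have f: "degree f = m" "conj_reflect f = Polynomial.smult (a ^ q) f"
        by (auto simp: self_dual_monics_def monics_def)
      let ?x = "\<lambda>i. if i \<in> {1..<m} then coeff f i else 0"
      have "?x \<in> V" by (auto simp: V_def)
      moreover have "\<tau> ?x i = ?x i" for i
      proof (cases "i \<in> {1..<m}")
        case True
        have "coeff f (m - i) ^ q = a ^ q * coeff f i"
          using arg_cong[OF f(2), of "\<lambda>p. coeff p i"] True f(1) by (simp add: coeff_conj_reflect)
        then have "a * coeff f (m - i) ^ q = (a * a ^ q) * coeff f i" by simp
        then show ?thesis using True a by (auto simp: \<tau>_def)
      next
        case False
        then show ?thesis by (auto simp: \<tau>_def)
      qed
      ultimately show "?x \<in> {x \<in> V. \<tau> x = x}" by auto
    qed
    show "(\<lambda>i. if i \<in> {1..<m} then coeff (P x) i else 0) = x" if "x \<in> {x \<in> V. \<tau> x = x}" for x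
    proof
      fix i show "(if i \<in> {1..<m} then coeff (P x) i else 0) = x i"
        using that coP[of x i] by (cases "i = 0") (auto simp: V_def)
    qed
    show "P (\<lambda>i. if i \<in> {1..<m} then coeff f i else 0) = f" if "f \<in> {f \<in> self_dual_monics m. coeff f 0 = a}" for f
    proof (rule poly_eqI)
      fix i
      have "(\<lambda>i. if i \<in> {1..<m} then coeff f i else 0) \<in> V" by (auto simp: V_def)
      from coP[OF this, of i] show "coeff (P (\<lambda>i. if i \<in> {1..<m} then coeff f i else 0)) i = coeff f i"
        using that by (auto simp: self_dual_monics_def monics_def coeff_eq_0 not_less)
    qed
  qed
  then have "card {x \<in> V. \<tau> x = x} = card {f \<in> self_dual_monics m. coeff f 0 = a}"
    by (rule bij_betw_same_card)
  then show ?thesis using cardH by simp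
qed

text \<open>The possible constant terms: comparing constant coefficients in the defining equation of
  a self-dual monic polynomial gives \<open>1 = a ^ q * a\<close>.\<close>

definition unit_norms :: "'a set" where "unit_norms = {a. a * a ^ q = 1}"

lemma card_self_dual_monics:
  assumes m: "m \<ge> 1"
  shows "card (self_dual_monics m) = card unit_norms * q ^ (m - 1)"
proof -
  have norm: "coeff f 0 \<in> unit_norms" if "f \<in> self_dual_monics m" for f
  proof -
    have f: "conj_reflect f = Polynomial.smult (coeff f 0 ^ q) f" "lead_coeff f = 1"
      using that by (auto simp: self_dual_monics_def monics_def)
    have "coeff (conj_reflect f) 0 = coeff f 0 ^ q * coeff f 0" by (subst f(1)) simp
    then show ?thesis unfolding coeff_0_conj_reflect f(2) by (simp add: unit_norms_def mult.commute)
  qed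
  have "self_dual_monics m = (\<Union>a\<in>unit_norms. {f \<in> self_dual_monics m. coeff f 0 = a})"
    using norm by auto
  then have "card (self_dual_monics m) = card (\<Union>a\<in>unit_norms. {f \<in> self_dual_monics m. coeff f 0 = a})" by simp
  also have "\<dots> = (\<Sum>a\<in>unit_norms. card {f \<in> self_dual_monics m. coeff f 0 = a})"
    by (rule card_UN_disjoint) (auto simp: finite_self_dual_monics)
  also have "\<dots> = (\<Sum>a\<in>unit_norms. q ^ (m - 1))"
    by (rule sum.cong[OF refl]) (use m in \<open>auto simp: unit_norms_def card_self_dual_slice\<close>)
  finally show ?thesis by simp
qed

lemma card_unit_norms: "card unit_norms \<le> q + 1" "card unit_norms > 0"
proof -
  show "card unit_norms \<le> q + 1" unfolding unit_norms_def by (rule card_norm_fiber) simp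
  have "1 \<in> unit_norms" by (simp add: unit_norms_def)
  then show "card unit_norms > 0" by (auto simp: card_gt_0_iff)
qed

text \<open>Equal degrees make the cofactor a constant, which the leading coefficients
  identify.\<close>

lemma self_dual_in_monics:
  assumes "monic \<phi>" "coeff \<phi> 0 \<noteq> 0" "self_dual \<phi>"
  shows "\<phi> \<in> self_dual_monics (degree \<phi>)"
proof -
  obtain u where u: "conj_reflect \<phi> = \<phi> * u" using assms(3) unfolding self_dual_def by blast
  have "conj_reflect \<phi> \<noteq> 0" using assms(2) lead_coeff_conj_reflect[of \<phi>] by auto
  then have "\<phi> \<noteq> 0" "u \<noteq> 0" using u by auto
  then have "degree u = 0" using u degree_conj_reflect[OF assms(2)] by (simp add: degree_mult_eq)
  moreover have "lead_coeff u = coeff \<phi> 0 ^ q"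
    using lead_coeff_conj_reflect[OF assms(2)] assms(1) lead_coeff_mult[of \<phi> u] u by simp
  ultimately have "u = [:coeff \<phi> 0 ^ q:]" by (metis degree_0_id)
  then show ?thesis using assms u by (simp add: self_dual_monics_def monics_def)
qed

text \<open>Multiplication by \<theta> will embed self-dual polynomials into the self-dual multiples
  of \<phi>.\<close>

lemma dual_closure:
  assumes "monic \<phi>" "coeff \<phi> 0 \<noteq> 0"
  obtains \<theta> where "\<theta> \<in> self_dual_monics (dual_size \<phi>)" "\<phi> dvd \<theta>"
proof (cases "self_dual \<phi>")
  case True
  then show thesis using that[of \<phi>] self_dual_in_monics[OF assms True] by (simp add: dual_size_def)
next
  case False
  let ?c = "coeff \<phi> 0 ^ q"
  \<comment> \<open>Dividing by \<open>?c\<close>, the leading coefficient of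
    \<open>conj_reflect \<phi>\<close>, makes the product monic.\<close>
  define \<theta> where "\<theta> = Polynomial.smult (1 / ?c) (\<phi> * conj_reflect \<phi>)"
  have c: "?c \<noteq> 0" using assms by simp
  have ne: "\<phi> \<noteq> 0" "conj_reflect \<phi> \<noteq> 0" using assms lead_coeff_conj_reflect[of \<phi>] by auto
  have "degree \<theta> = 2 * degree \<phi>"
    using c ne degree_conj_reflect[OF assms(2)] by (simp add: \<theta>_def degree_mult_eq)
  moreover have "monic \<theta>"
    using c assms lead_coeff_conj_reflect[OF assms(2)] unfolding \<theta>_def lead_coeff_smult lead_coeff_mult by simp
  moreover have c0: "coeff \<theta> 0 = coeff \<phi> 0 / ?c"
    using assms by (simp add: \<theta>_def coeff_mult coeff_0_conj_reflect)
  moreover have "conj_reflect \<theta> = Polynomial.smult (coeff \<theta> 0 ^ q) \<theta>"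
  proof -
    have "conj_reflect \<theta> = Polynomial.smult (1 / coeff \<phi> 0) (\<phi> * conj_reflect \<phi>)"
      using assms(2) unfolding \<theta>_def conj_reflect_smult conj_reflect_mult
      by (simp add: conj_reflect_conj_reflect power_divide mult.commute)
    also have "\<dots> = Polynomial.smult (coeff \<theta> 0 ^ q) \<theta>"
      unfolding c0 using assms(2) by (simp add: \<theta>_def power_divide)
    finally show ?thesis .
  qed
  ultimately have "\<theta> \<in> self_dual_monics (dual_size \<phi>)"
    using assms c False by (simp add: self_dual_monics_def monics_def dual_size_def)
  moreover have "\<phi> dvd \<theta>" by (simp add: \<theta>_def dvd_smult)
  ultimately show thesis by (rule that)
qed

text \<open>The candidates for irreducible factors in dimension \<open>n\<close>; all others have
  expected multiplicity 0 by \<open>expected_mult_outside\<close>.\<close>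

definition irr_dual :: "nat \<Rightarrow> 'a poly set" where
  "irr_dual n = {\<phi>. monic \<phi> \<and> irreducible \<phi> \<and> coeff \<phi> 0 \<noteq> 0 \<and> dual_size \<phi> \<le> n}"

lemma degree_le_dual_size: "degree \<phi> \<le> dual_size \<phi>"
  by (simp add: dual_size_def)

lemma irr_dual_subset: "irr_dual n \<subseteq> irr_upto n"
  using degree_le_dual_size by (auto simp: irr_dual_def irr_upto_def intro: order_trans)

lemma finite_irr_dual: "finite (irr_dual n)"
  by (rule finite_subset[OF irr_dual_subset finite_irr_upto])

lemma sum_degree_divisors_le:
  fixes f :: "'a poly"
  assumes "f \<in> monics N"
  shows "(\<Sum>\<phi>\<in>{\<phi> \<in> irr_upto N. \<phi> dvd f}. degree \<phi>) \<le> N"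
proof -
  have f: "monic f" "degree f \<le> N" "degree f = N" using assms by (auto simp: monics_def)
  have "(\<Sum>\<phi>\<in>{\<phi> \<in> irr_upto N. \<phi> dvd f}. degree \<phi>)
    \<le> (\<Sum>\<phi>\<in>{\<phi> \<in> irr_upto N. \<phi> dvd f}. degree \<phi> * poly_multiplicity \<phi> f)"
  proof (rule sum_mono)
    fix \<phi> assume \<phi>: "\<phi> \<in> {\<phi> \<in> irr_upto N. \<phi> dvd f}"
    then have d: "0 < degree \<phi>" "degree \<phi> \<le> N" using degree_irreducible_pos by (auto simp: irr_upto_def)
    have f0: "f \<noteq> 0" using f by auto
    have "1 \<in> {k \<in> {1..N}. \<phi> ^ k dvd f}" using \<phi> d by auto
    then have "card {k \<in> {1..N}. \<phi> ^ k dvd f} > 0" by (auto simp: card_gt_0_iff)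
    then have "poly_multiplicity \<phi> f \<ge> 1" using poly_multiplicity_eq_card[OF f0 d(1) f(2)] by simp
    then show "degree \<phi> \<le> degree \<phi> * poly_multiplicity \<phi> f" by simp
  qed
  also have "\<dots> \<le> (\<Sum>\<phi>\<in>irr_upto N. degree \<phi> * poly_multiplicity \<phi> f)"
    by (rule sum_mono2) (auto simp: finite_irr_upto)
  also have "\<dots> = N" using sum_degree_multiplicity[OF f(1,2)] f(3) by simp
  finally show ?thesis .
qed

text \<open>Double counting of pairs \<phi> dividing \<open>f\<close>, with \<open>f\<close>
  self-dual monic of degree \<open>N\<close>, weighted by \<open>degree \<phi>\<close>. Each
  \<open>f\<close> contributes at most \<open>N\<close>, while each \<phi> divides at least the
  products of its self-dual closure with self-dual polynomials of the complementary degree. After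
  division by the number of all \<open>f\<close>, the weights \<open>wt \<phi>\<close>
  appear.\<close>

lemma sum_degree_wt_le: "(\<Sum>\<phi>\<in>irr_dual n. real (degree \<phi>) * wt \<phi>) \<le> real n + 1"
proof -
  \<comment> \<open>One more than \<open>n\<close>, so that the complementary degree
    \<open>N - dual_size \<phi>\<close> is at least 1 and \<open>card_self_dual_monics\<close>
    applies to it; the factor \<open>card unit_norms\<close> then cancels. This is the origin of the
    \<open>+ 1\<close> in the bound.\<close>
  define N where "N = Suc n"
  let ?T = "self_dual_monics N"
  have count: "card unit_norms * q ^ (n - dual_size \<phi>) \<le> card {f \<in> ?T. \<phi> dvd f}" if "\<phi> \<in> irr_dual n" for \<phi>
  proof -
    have \<phi>: "monic \<phi>" "coeff \<phi> 0 \<noteq> 0" "dual_size \<phi> \<le> n" using that by (auto simp: irr_dual_def)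
    obtain \<theta> where \<theta>: "\<theta> \<in> self_dual_monics (dual_size \<phi>)" "\<phi> dvd \<theta>"
      using dual_closure[OF \<phi>(1,2)] by blast
    have \<theta>0: "\<theta> \<noteq> 0" using \<theta>(1) by (auto simp: self_dual_monics_def)
    have "card (self_dual_monics (N - dual_size \<phi>)) \<le> card {f \<in> ?T. \<phi> dvd f}"
    proof (rule card_inj_on_le[where f = "\<lambda>g. \<theta> * g"])
      show "inj_on (\<lambda>g. \<theta> * g) (self_dual_monics (N - dual_size \<phi>))" using \<theta>0 by (auto intro: inj_onI)
      show "(\<lambda>g. \<theta> * g) ` self_dual_monics (N - dual_size \<phi>) \<subseteq> {f \<in> ?T. \<phi> dvd f}"
      proof
        fix f assume "f \<in> (\<lambda>g. \<theta> * g) ` self_dual_monics (N - dual_size \<phi>)"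
        then obtain g where g: "f = \<theta> * g" "g \<in> self_dual_monics (N - dual_size \<phi>)" by blast
        have "f \<in> self_dual_monics (dual_size \<phi> + (N - dual_size \<phi>))"
          unfolding g(1) by (rule self_dual_monics_mult[OF \<theta>(1) g(2)])
        then show "f \<in> {f \<in> ?T. \<phi> dvd f}" using \<phi>(3) \<theta>(2) g(1) by (simp add: N_def dvd_mult2)
      qed
    qed (simp add: finite_self_dual_monics)
    moreover have "card (self_dual_monics (N - dual_size \<phi>)) = card unit_norms * q ^ (n - dual_size \<phi>)"
      using \<phi>(3) by (subst card_self_dual_monics) (auto simp: N_def)
    ultimately show ?thesis by simp
  qed
  have "(\<Sum>\<phi>\<in>irr_dual n. degree \<phi> * (card unit_norms * q ^ (n - dual_size \<phi>)))
    \<le> (\<Sum>\<phi>\<in>irr_dual n. degree \<phi> * card {f \<in> ?T. \<phi> dvd f})"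
    by (intro sum_mono mult_left_mono count) auto
  also have "\<dots> = (\<Sum>\<phi>\<in>irr_dual n. \<Sum>f\<in>?T. if \<phi> dvd f then degree \<phi> else 0)"
    by (intro sum.cong refl) (simp add: sum.If_cases finite_self_dual_monics Int_def)
  also have "\<dots> = (\<Sum>f\<in>?T. \<Sum>\<phi>\<in>irr_dual n. if \<phi> dvd f then degree \<phi> else 0)" by (rule sum.swap)
  also have "\<dots> \<le> (\<Sum>f\<in>?T. N)"
  proof (rule sum_mono)
    fix f assume "f \<in> ?T"
    then have f: "f \<in> monics N" by (simp add: self_dual_monics_def)
    have "(\<Sum>\<phi>\<in>irr_dual n. if \<phi> dvd f then degree \<phi> else 0) = (\<Sum>\<phi>\<in>{\<phi> \<in> irr_dual n. \<phi> dvd f}. degree \<phi>)"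
      by (simp add: sum.If_cases finite_irr_dual Int_def)
    also have "\<dots> \<le> (\<Sum>\<phi>\<in>{\<phi> \<in> irr_upto N. \<phi> dvd f}. degree \<phi>)"
    proof (rule sum_mono2)
      show "finite {\<phi> \<in> irr_upto N. \<phi> dvd f}" by (simp add: finite_irr_upto)
      show "{\<phi> \<in> irr_dual n. \<phi> dvd f} \<subseteq> {\<phi> \<in> irr_upto N. \<phi> dvd f}"
        using irr_dual_subset[of n] by (auto simp: irr_upto_def N_def)
    qed simp
    also have "\<dots> \<le> N" by (rule sum_degree_divisors_le[OF f])
    finally show "(\<Sum>\<phi>\<in>irr_dual n. if \<phi> dvd f then degree \<phi> else 0) \<le> N" .
  qed
  also have "\<dots> = card unit_norms * (q ^ n * N)"
    by (simp add: card_self_dual_monics N_def algebra_simps)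
  also have "(\<Sum>\<phi>\<in>irr_dual n. degree \<phi> * (card unit_norms * q ^ (n - dual_size \<phi>)))
    = card unit_norms * (\<Sum>\<phi>\<in>irr_dual n. degree \<phi> * q ^ (n - dual_size \<phi>))"
    unfolding sum_distrib_left by (intro sum.cong refl) (rule mult.left_commute)
  finally have "card unit_norms * (\<Sum>\<phi>\<in>irr_dual n. degree \<phi> * q ^ (n - dual_size \<phi>)) \<le> card unit_norms * (q ^ n * N)" .
  then have le: "(\<Sum>\<phi>\<in>irr_dual n. degree \<phi> * q ^ (n - dual_size \<phi>)) \<le> q ^ n * N"
    using card_unit_norms(2) by simp
  have "real q ^ n * (\<Sum>\<phi>\<in>irr_dual n. real (degree \<phi>) * wt \<phi>) = real (\<Sum>\<phi>\<in>irr_dual n. degree \<phi> * q ^ (n - dual_size \<phi>))"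
    unfolding sum_distrib_left of_nat_sum
  proof (rule sum.cong[OF refl])
    fix \<phi> assume "\<phi> \<in> irr_dual n"
    then have "dual_size \<phi> \<le> n" by (simp add: irr_dual_def)
    then have "real q ^ (n - dual_size \<phi>) = real q ^ n / real q ^ dual_size \<phi>"
      using q_pos by (intro power_diff) auto
    then show "real q ^ n * (real (degree \<phi>) * wt \<phi>) = real (degree \<phi> * q ^ (n - dual_size \<phi>))"
      by (simp add: wt_def)
  qed
  also have "\<dots> \<le> real (q ^ n * N)" using le by (simp only: of_nat_le_iff)
  also have "\<dots> = real q ^ n * (real n + 1)" by (simp add: N_def algebra_simps)
  finally show ?thesis using q_pos by simp
qed

end

section \<open>Asymptotics\<close>

lemma telescope_fraction:
  fixes r x :: real
  assumes "r \<ge> 0"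
  shows "x / ((r + 1) * (r + 2)) = x / (r + 1) - x / (r + 2)"
  using assms by (subst diff_frac_eq) (auto simp: algebra_simps)

text \<open>Abel summation. The weights \<open>1 / (n + 1)\<close> and
  \<open>1 / (d * (d + 1))\<close> of the partial errors are positive and add up to 1, so the bound
  \<open>C\<close> survives unchanged.\<close>

lemma summation_by_parts_bound:
  fixes a :: "nat \<Rightarrow> real"
  assumes C: "\<And>n. \<bar>(\<Sum>d=1..n. a d) - c * real n\<bar> \<le> C"
  shows "\<bar>(\<Sum>d=1..n. a d / real d) - c * (\<Sum>d=1..n. 1 / real d)\<bar> \<le> C"
proof -
  define D where "D n = (\<Sum>d=1..n. a d) - c * real n" for n
  have eq: "(\<Sum>d=1..n. a d / real d) - c * (\<Sum>d=1..n. 1 / real d)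
    = D n / (real n + 1) + (\<Sum>d=1..n. D d / (real d * (real d + 1)))"
  proof (induction n)
    case (Suc n)
    have D: "D (Suc n) = D n + a (Suc n) - c" by (simp add: D_def algebra_simps)
    have "D (Suc n) / (real n + 2) + D (Suc n) / ((real n + 1) * (real n + 2)) = D (Suc n) / (real n + 1)"
      using telescope_fraction[of "real n" "D (Suc n)"] by simp
    also have "\<dots> = D n / (real n + 1) + a (Suc n) / (real n + 1) - c / (real n + 1)"
      unfolding D by (simp add: add_divide_distrib diff_divide_distrib)
    finally show ?case using Suc.IH by (simp add: algebra_simps)
  qed (simp add: D_def)
  have tele: "(\<Sum>d=1..n. C / (real d * (real d + 1))) = C - C / (real n + 1)"
  proof (induction n)
    case (Suc n)
    have "C / ((real n + 1) * (real n + 2)) = C / (real n + 1) - C / (real n + 2)"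
      by (rule telescope_fraction) simp
    then show ?case using Suc.IH by (simp add: algebra_simps)
  qed simp
  have "\<bar>D n / (real n + 1) + (\<Sum>d=1..n. D d / (real d * (real d + 1)))\<bar>
    \<le> \<bar>D n / (real n + 1)\<bar> + \<bar>\<Sum>d=1..n. D d / (real d * (real d + 1))\<bar>" by (rule abs_triangle_ineq)
  also have "\<bar>D n / (real n + 1)\<bar> \<le> C / (real n + 1)"
    using C[of n] by (simp add: D_def divide_right_mono)
  also have "\<bar>\<Sum>d=1..n. D d / (real d * (real d + 1))\<bar> \<le> (\<Sum>d=1..n. C / (real d * (real d + 1)))"
  proof (rule order_trans[OF sum_abs], rule sum_mono)
    fix d
    show "\<bar>D d / (real d * (real d + 1))\<bar> \<le> C / (real d * (real d + 1))"
      using C[of d] by (simp add: D_def abs_mult divide_right_mono)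
  qed
  finally show ?thesis unfolding eq tele by simp
qed

lemma harmonic_ln_bound:
  assumes "n \<ge> 1"
  shows "\<bar>(\<Sum>d=1..n. 1 / real d) - ln (real n)\<bar> \<le> 1"
proof -
  \<comment> \<open>With \<open>n + 1\<close> in the lower bound, both induction steps follow from
    \<open>ln x \<le> x - 1\<close>, at \<open>x = (n + 2) / (n + 1)\<close> and at
    \<open>x = n / (n + 1)\<close>.\<close>
  have "ln (real n + 1) \<le> (\<Sum>d=1..n. 1 / real d) \<and> (\<Sum>d=1..n. 1 / real d) \<le> 1 + ln (real n)"
    using assms
  proof (induction n rule: dec_induct)
    case base
    show ?case using ln_2_less_1 by simp
  next
    case (step n)
    have n: "real n > 0" using step by simp
    have "ln ((real n + 2) / (real n + 1)) \<le> (real n + 2) / (real n + 1) - 1"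
      by (rule ln_le_minus_one) simp
    also have "\<dots> = 1 / (real n + 1)" by (simp add: field_simps)
    finally have 1: "ln (real n + 2) - ln (real n + 1) \<le> 1 / (real n + 1)" by (simp add: ln_div)
    have "ln (real n / (real n + 1)) \<le> real n / (real n + 1) - 1"
      using n by (intro ln_le_minus_one) simp
    also have "\<dots> = - (1 / (real n + 1))" by (simp add: field_simps)
    finally have 2: "1 / (real n + 1) \<le> ln (real n + 1) - ln (real n)" using n by (simp add: ln_div)
    have "(\<Sum>d=1..Suc n. 1 / real d) = (\<Sum>d=1..n. 1 / real d) + 1 / (real n + 1)" by (simp add: add.commute)
    then show ?case using step.IH 1 2 by (simp add: algebra_simps)
  qed
  moreover have "ln (real n) \<le> ln (real n + 1)" using assms by simp
  ultimately show ?thesis by linarith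
qed

lemma ln_half_bound:
  assumes "n \<ge> 2"
  shows "\<bar>ln (real (n div 2)) - ln (real n)\<bar> \<le> 2"
proof -
  have "real n \<le> 3 * real (n div 2)"
  proof -
    \<comment> \<open>The factor 3 is attained at \<open>n = 3\<close>.\<close>
    have "n \<le> 3 * (n div 2)" using assms by linarith
    then show ?thesis by (metis of_nat_le_iff of_nat_mult of_nat_numeral)
  qed
  moreover have pos: "real (n div 2) > 0" using assms by simp
  ultimately have "ln (real n) \<le> ln (3 * real (n div 2))" using assms by simp
  also have "\<dots> = ln 3 + ln (real (n div 2))" using pos by (simp add: ln_mult)
  also have "ln (3 :: real) \<le> 3 - 1" by (rule ln_le_minus_one) simp
  finally have "ln (real n) \<le> 2 + ln (real (n div 2))" by simp
  moreover have "ln (real (n div 2)) \<le> ln (real n)" using pos by simp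
  ultimately show ?thesis by linarith
qed

section \<open>Self-dual and paired irreducible polynomials by degree\<close>

context unitary_field
begin

definition irr_self :: "nat \<Rightarrow> 'a poly set" where
  "irr_self d = {\<phi>. monic \<phi> \<and> irreducible \<phi> \<and> coeff \<phi> 0 \<noteq> 0 \<and> self_dual \<phi> \<and> degree \<phi> = d}"

definition irr_paired :: "nat \<Rightarrow> 'a poly set" where
  "irr_paired d = {\<phi>. monic \<phi> \<and> irreducible \<phi> \<and> coeff \<phi> 0 \<noteq> 0 \<and> \<not> self_dual \<phi> \<and> degree \<phi> = d}"

lemma finite_irr_self: "finite (irr_self d)"
  by (rule finite_subset[OF _ finite_monics[of d]]) (auto simp: irr_self_def monics_def)

lemma finite_irr_paired: "finite (irr_paired d)"
  by (rule finite_subset[OF _ finite_monics[of d]]) (auto simp: irr_paired_def monics_def)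

text \<open>Counting all self-dual monic polynomials, reducible ones included, already gives an
  order of magnitude \<open>q ^ d\<close>, the square root of the number of all monic ones;
  \<open>(q + 1) * q ^ (d - 1)\<close> is simplified to \<open>2 * q ^ d\<close>.\<close>

lemma card_irr_self: "card (irr_self d) \<le> 2 * q ^ d"
proof (cases "d = 0")
  case False
  have "card (irr_self d) \<le> card (self_dual_monics d)"
    using self_dual_in_monics by (intro card_mono finite_self_dual_monics) (auto simp: irr_self_def)
  also have "\<dots> = card unit_norms * q ^ (d - 1)" using False by (intro card_self_dual_monics) simp
  also have "\<dots> \<le> (2 * q) * q ^ (d - 1)"
    using card_unit_norms(1) q_ge_2 by (intro mult_right_mono) auto
  also have "\<dots> = 2 * q ^ d" using False by (cases d) auto
  finally show ?thesis .
next
  case True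
  have "irr_self 0 = {}" using degree_irreducible_pos by (auto simp: irr_self_def)
  then show ?thesis unfolding True by (simp only: card.empty)
qed

lemma card_irr_paired: "card (irr_paired d) \<le> CARD('a) ^ d"
  unfolding card_monics[symmetric]
  by (rule card_mono[OF finite_monics]) (auto simp: irr_paired_def monics_def)

lemma sum_by_degree_classes:
  fixes g :: "'a poly \<Rightarrow> real"
  shows "(\<Sum>\<phi>\<in>(\<Union>d\<in>{1..m}. irr_self d) \<union> (\<Union>d\<in>{1..k}. irr_paired d). g \<phi>)
    = (\<Sum>d=1..m. \<Sum>\<phi>\<in>irr_self d. g \<phi>) + (\<Sum>d=1..k. \<Sum>\<phi>\<in>irr_paired d. g \<phi>)"
proof -
  have 1: "(\<Sum>\<phi>\<in>(\<Union>d\<in>{1..m}. irr_self d). g \<phi>) = (\<Sum>d=1..m. \<Sum>\<phi>\<in>irr_self d. g \<phi>)"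
    by (rule sum.UNION_disjoint, simp, simp add: finite_irr_self, auto simp: irr_self_def)
  have 2: "(\<Sum>\<phi>\<in>(\<Union>d\<in>{1..k}. irr_paired d). g \<phi>) = (\<Sum>d=1..k. \<Sum>\<phi>\<in>irr_paired d. g \<phi>)"
    by (rule sum.UNION_disjoint, simp, simp add: finite_irr_paired, auto simp: irr_paired_def)
  have "(\<Sum>\<phi>\<in>(\<Union>d\<in>{1..m}. irr_self d) \<union> (\<Union>d\<in>{1..k}. irr_paired d). g \<phi>)
    = (\<Sum>\<phi>\<in>(\<Union>d\<in>{1..m}. irr_self d). g \<phi>) + (\<Sum>\<phi>\<in>(\<Union>d\<in>{1..k}. irr_paired d). g \<phi>)"
    by (rule sum.union_disjoint, simp add: finite_irr_self, simp add: finite_irr_paired,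
        auto simp: irr_self_def irr_paired_def)
  then show ?thesis unfolding 1 2 .
qed

lemma irr_dual_classes: "irr_dual n = (\<Union>d\<in>{1..n}. irr_self d) \<union> (\<Union>d\<in>{1..n div 2}. irr_paired d)"
proof (intro equalityI subsetI)
  fix \<phi> assume \<phi>: "\<phi> \<in> irr_dual n"
  then have "degree \<phi> > 0" by (auto simp: irr_dual_def intro: degree_irreducible_pos)
  then show "\<phi> \<in> (\<Union>d\<in>{1..n}. irr_self d) \<union> (\<Union>d\<in>{1..n div 2}. irr_paired d)"
    using \<phi> by (cases "self_dual \<phi>") (auto simp: irr_dual_def dual_size_def irr_self_def irr_paired_def Suc_le_eq)
qed (auto simp: irr_dual_def dual_size_def irr_self_def irr_paired_def)

text \<open>With weights \<open>q ^ (- 2 * d)\<close> in place of \<open>q ^ (- d)\<close>, the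
  self-dual polynomials contribute a bounded amount. This controls both their squared weights and
  their share in \<open>irr_mangoldt\<close>.\<close>

lemma sum_irr_self_card_weight: "(\<Sum>d=1..n. \<Sum>\<phi>\<in>irr_self d. real (degree \<phi>) / real CARD('a) ^ degree \<phi>) \<le> 4"
proof -
  have "(\<Sum>\<phi>\<in>irr_self d. real (degree \<phi>) / real CARD('a) ^ degree \<phi>) \<le> 2 * (real d / 2 ^ d)" for d
  proof -
    have q: "real q ^ d > 0" using q_pos by simp
    have "(\<Sum>\<phi>\<in>irr_self d. real (degree \<phi>) / real CARD('a) ^ degree \<phi>)
      = real (card (irr_self d)) * (real d / real CARD('a) ^ d)"
      by (simp add: irr_self_def)
    also have "\<dots> \<le> real (2 * q ^ d) * (real d / real CARD('a) ^ d)"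
      by (intro mult_right_mono of_nat_mono card_irr_self) simp
    also have "real CARD('a) ^ d = real q ^ d * real q ^ d"
      by (simp add: card_field power2_eq_square power_mult_distrib)
    also have "real (2 * q ^ d) * (real d / (real q ^ d * real q ^ d)) = 2 * (real d / real q ^ d)"
      using q by simp
    also have "\<dots> \<le> 2 * (real d / 2 ^ d)"
      using q_ge_2 by (intro mult_left_mono divide_left_mono power_mono mult_pos_pos) auto
    finally show ?thesis .
  qed
  then have "(\<Sum>d=1..n. \<Sum>\<phi>\<in>irr_self d. real (degree \<phi>) / real CARD('a) ^ degree \<phi>) \<le> (\<Sum>d=1..n. 2 * (real d / 2 ^ d))"
    by (rule sum_mono)
  also have "\<dots> = 2 * (\<Sum>d=1..n. real d / 2 ^ d)" by (simp only: sum_distrib_left)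
  finally show ?thesis using sum_linear_half_powers[of n] by linarith
qed

lemma wt_irr_self: "\<phi> \<in> irr_self d \<Longrightarrow> wt \<phi> = 1 / real q ^ d"
  by (simp add: irr_self_def wt_def dual_size_def)

lemma wt_irr_paired: "\<phi> \<in> irr_paired d \<Longrightarrow> wt \<phi> = 1 / real CARD('a) ^ d"
  by (simp add: irr_paired_def wt_def dual_size_def card_field power_mult)

text \<open>There are at most \<open>2 * q ^ d\<close> self-dual polynomials of degree
  \<open>d\<close> with squared weight \<open>q ^ (- 2 * d)\<close>, and at most
  \<open>q ^ (2 * d)\<close> others with squared weight \<open>q ^ (- 4 * d)\<close>. The two
  convergent sums give 4 and 2.\<close>

lemma sum_degree_wt_sq: "(\<Sum>\<phi>\<in>irr_dual n. real (degree \<phi>) * wt \<phi> ^ 2) \<le> 6"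
proof -
  have "(\<Sum>\<phi>\<in>irr_self d. real (degree \<phi>) * wt \<phi> ^ 2)
    = (\<Sum>\<phi>\<in>irr_self d. real (degree \<phi>) / real CARD('a) ^ degree \<phi>)" for d
    by (intro sum.cong refl)
      (auto simp: wt_irr_self irr_self_def[of d] card_field power_divide power2_eq_square power_mult_distrib wt_def dual_size_def)
  then have 1: "(\<Sum>d=1..n. \<Sum>\<phi>\<in>irr_self d. real (degree \<phi>) * wt \<phi> ^ 2) \<le> 4"
    using sum_irr_self_card_weight[of n] by simp
  have "(\<Sum>\<phi>\<in>irr_paired d. real (degree \<phi>) * wt \<phi> ^ 2) \<le> real d / 2 ^ d" for d
  proof -
    have Q: "real CARD('a) ^ d > 0" by (simp add: finite_UNIV_card_ge_0)
    have "(\<Sum>\<phi>\<in>irr_paired d. real (degree \<phi>) * wt \<phi> ^ 2)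
      = (\<Sum>\<phi>\<in>irr_paired d. real d * (1 / real CARD('a) ^ d) ^ 2)"
      by (intro sum.cong refl) (simp add: wt_irr_paired, simp add: irr_paired_def)
    also have "\<dots> = real (card (irr_paired d)) * (real d * (1 / real CARD('a) ^ d) ^ 2)" by simp
    also have "\<dots> \<le> real (CARD('a) ^ d) * (real d * (1 / real CARD('a) ^ d) ^ 2)"
      by (intro mult_right_mono of_nat_mono card_irr_paired) simp
    also have "\<dots> = real d / real CARD('a) ^ d" using Q by (simp add: power2_eq_square)
    also have "\<dots> \<le> real d / 2 ^ d"
      using card_field_gt_1[where ?'a = 'a]
      by (intro divide_left_mono power_mono mult_pos_pos) auto
    finally show ?thesis .
  qed
  then have "(\<Sum>d=1..n div 2. \<Sum>\<phi>\<in>irr_paired d. real (degree \<phi>) * wt \<phi> ^ 2) \<le> (\<Sum>d=1..n div 2. real d / 2 ^ d)"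
    by (rule sum_mono)
  also have "\<dots> \<le> 2" by (rule sum_linear_half_powers)
  finally have 2: "(\<Sum>d=1..n div 2. \<Sum>\<phi>\<in>irr_paired d. real (degree \<phi>) * wt \<phi> ^ 2) \<le> 2" .
  show ?thesis unfolding irr_dual_classes sum_by_degree_classes using 1 2 by linarith
qed

lemma irreducible_coeff_0_eq_0:
  fixes \<phi> :: "'a poly"
  assumes "monic \<phi>" "irreducible \<phi>" "coeff \<phi> 0 = 0"
  shows "\<phi> = [:0, 1:]"
proof -
  have "poly \<phi> 0 = 0" using assms(3) by (simp add: poly_0_coeff_0)
  then have "[:0, 1:] dvd \<phi>" by (simp add: poly_eq_0_iff_dvd)
  then obtain c where c: "\<phi> = [:0, 1:] * c" by blast
  have "\<not> [:0, 1 :: 'a:] dvd 1" by (simp add: is_unit_iff_degree)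
  then have u: "c dvd 1" using irreducibleD[OF assms(2) c] by blast
  have "c \<noteq> 0" using c assms(2) by auto
  then have "degree c = 0" using u by (simp add: is_unit_iff_degree)
  moreover have "lead_coeff c = 1" using lead_coeff_mult[of "[:0, 1:]" c] c assms(1) by simp
  ultimately have "c = 1" by (metis degree_0_id one_pCons)
  then show ?thesis using c by simp
qed

definition self_weight :: "nat \<Rightarrow> real" where
  "self_weight d = (\<Sum>\<phi>\<in>irr_self d. real d * wt \<phi>)"

definition paired_weight :: "nat \<Rightarrow> real" where
  "paired_weight d = (\<Sum>\<phi>\<in>irr_paired d. real d * wt \<phi>)"

text \<open>All irreducible polynomials together weigh \<open>m\<close> up to an error of 4.
  Removing the self-dual ones costs at most 4 and removing \<open>X\<close> at most 1, which makes
  9. The factor \<open>1 *\<close> matches the shape of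
  \<open>summation_by_parts_bound\<close>.\<close>

lemma sum_paired_weight: "\<bar>(\<Sum>d=1..m. paired_weight d) - 1 * real m\<bar> \<le> 9"
proof -
  let ?g = "\<lambda>\<phi> :: 'a poly. real (degree \<phi>) / real CARD('a) ^ degree \<phi>"
  let ?A = "(\<Union>d\<in>{1..m}. irr_self d) \<union> (\<Union>d\<in>{1..m}. irr_paired d)"
  have pw: "(\<Sum>\<phi>\<in>irr_paired d. ?g \<phi>) = paired_weight d" for d
    unfolding paired_weight_def by (intro sum.cong refl) (simp add: wt_irr_paired, simp add: irr_paired_def)
  have split: "(\<Sum>\<phi>\<in>?A. ?g \<phi>) = (\<Sum>d=1..m. \<Sum>\<phi>\<in>irr_self d. ?g \<phi>) + (\<Sum>d=1..m. paired_weight d)"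
    by (simp only: sum_by_degree_classes pw)
  have sub: "?A \<subseteq> irr_upto m" by (auto simp: irr_self_def irr_paired_def irr_upto_def)
  have "irr_upto m \<subseteq> insert [:0, 1:] ?A"
  proof
    fix \<phi> :: "'a poly" assume \<phi>: "\<phi> \<in> irr_upto m"
    show "\<phi> \<in> insert [:0, 1:] ?A"
    proof (cases "coeff \<phi> 0 = 0")
      case True
      then show ?thesis using irreducible_coeff_0_eq_0 \<phi> by (auto simp: irr_upto_def)
    next
      case False
      have "degree \<phi> > 0" using \<phi> degree_irreducible_pos by (auto simp: irr_upto_def)
      then show ?thesis
        using \<phi> False by (cases "self_dual \<phi>") (auto simp: irr_upto_def irr_self_def irr_paired_def Suc_le_eq)
    qed
  qed
  then have "(\<Sum>\<phi>\<in>irr_upto m. ?g \<phi>) \<le> (\<Sum>\<phi>\<in>insert [:0, 1:] ?A. ?g \<phi>)"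
    by (intro sum_mono2) (auto simp: finite_irr_self finite_irr_paired)
  also have "\<dots> \<le> ?g [:0, 1:] + (\<Sum>\<phi>\<in>?A. ?g \<phi>)"
    by (cases "[:0, 1:] \<in> ?A") (auto simp: insert_absorb finite_irr_self finite_irr_paired simp del: UN_iff)
  also have "?g [:0, 1:] \<le> 1" using card_field_gt_1[where ?'a = 'a] by simp
  finally have 1: "(\<Sum>\<phi>\<in>irr_upto m. ?g \<phi>) \<le> 1 + (\<Sum>\<phi>\<in>?A. ?g \<phi>)" by simp
  have 2: "(\<Sum>\<phi>\<in>?A. ?g \<phi>) \<le> (\<Sum>\<phi>\<in>irr_upto m. ?g \<phi>)"
    by (rule sum_mono2[OF finite_irr_upto sub]) simp
  have 3: "0 \<le> (\<Sum>d=1..m. \<Sum>\<phi>\<in>irr_self d. ?g \<phi>)" by (intro sum_nonneg) simp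
  show ?thesis
    using 1 2 3 split irr_weight_upper[where ?'a = 'a and n = m] irr_weight_lower[where ?'a = 'a and n = m]
      sum_irr_self_card_weight[of m] by linarith
qed

lemma sum_degree_wt_split:
  "(\<Sum>\<phi>\<in>irr_dual n. real (degree \<phi>) * wt \<phi>) = (\<Sum>d=1..n. self_weight d) + (\<Sum>d=1..n div 2. paired_weight d)"
  unfolding irr_dual_classes sum_by_degree_classes self_weight_def paired_weight_def
  by (intro arg_cong2[where f = "(+)"] sum.cong refl) (auto simp: irr_self_def irr_paired_def)

lemma sum_wt_split:
  "(\<Sum>\<phi>\<in>irr_dual n. wt \<phi>) = (\<Sum>d=1..n. self_weight d / real d) + (\<Sum>d=1..n div 2. paired_weight d / real d)"
  unfolding irr_dual_classes sum_by_degree_classes self_weight_def paired_weight_def sum_divide_distrib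
  by (intro arg_cong2[where f = "(+)"] sum.cong refl) auto

lemma sum_multiplicity:
  assumes "\<phi> \<in> irr_upto n"
  shows "(\<Sum>A\<in>unitary_group n q. real (poly_multiplicity \<phi> (char_poly (A :: 'a mat))))
    = real (card (unitary_group n q :: 'a mat set)) * expected_mult n \<phi>"
proof -
  let ?U = "unitary_group n q :: 'a mat set"
  have d: "degree \<phi> > 0" using assms degree_irreducible_pos by (auto simp: irr_upto_def)
  have mult: "real (poly_multiplicity \<phi> (char_poly A)) = (\<Sum>k=1..n. if \<phi> ^ k dvd char_poly A then 1 else 0)"
    if "A \<in> ?U" for A
  proof -
    have c: "degree (char_poly A) = n" "char_poly A \<noteq> 0"
      using degree_monic_char_poly[OF unitary_carrier[OF that]] by auto
    then show ?thesis
      using poly_multiplicity_eq_card[OF c(2) d, of n] by (simp add: sum.If_cases Int_def)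
  qed
  have "(\<Sum>A\<in>?U. real (poly_multiplicity \<phi> (char_poly A)))
    = (\<Sum>A\<in>?U. \<Sum>k=1..n. if \<phi> ^ k dvd char_poly A then 1 else 0)"
    by (intro sum.cong refl mult)
  also have "\<dots> = (\<Sum>k=1..n. \<Sum>A\<in>?U. if \<phi> ^ k dvd char_poly A then 1 else 0)" by (rule sum.swap)
  also have "\<dots> = (\<Sum>k=1..n. real (dvd_count n (\<phi> ^ k)))"
    by (intro sum.cong refl) (simp add: dvd_count_def sum.If_cases unitary_finite Int_def)
  finally show ?thesis using card_unitary_pos[of n] by (simp add: expected_mult_def)
qed

lemma expected_mult_outside:
  assumes "\<phi> \<in> irr_upto n - irr_dual n"
  shows "expected_mult n \<phi> = 0"
  using assms by (intro expected_mult_eq_0) (auto simp: irr_upto_def irr_dual_def)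

text \<open>Every characteristic polynomial has degree \<open>n\<close>, so this is the average of a
  constant.\<close>

lemma sum_degree_expected_mult: "(\<Sum>\<phi>\<in>irr_dual n. real (degree \<phi>) * expected_mult n \<phi>) = real n"
proof -
  let ?U = "unitary_group n q :: 'a mat set"
  have "real (card ?U) * real n = (\<Sum>A\<in>?U. \<Sum>\<phi>\<in>irr_upto n. real (degree \<phi>) * real (poly_multiplicity \<phi> (char_poly A)))"
  proof -
    have "real n = (\<Sum>\<phi>\<in>irr_upto n. real (degree \<phi>) * real (poly_multiplicity \<phi> (char_poly A)))" if "A \<in> ?U" for A
    proof -
      have c: "monic (char_poly A)" "degree (char_poly A) = n"
        using degree_monic_char_poly[OF unitary_carrier[OF that]] by auto
      have "(\<Sum>\<phi>\<in>irr_upto n. degree \<phi> * poly_multiplicity \<phi> (char_poly A)) = degree (char_poly A)"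
        by (rule sum_degree_multiplicity[OF c(1)]) (simp add: c(2))
      then have "real (\<Sum>\<phi>\<in>irr_upto n. degree \<phi> * poly_multiplicity \<phi> (char_poly A)) = real n" using c(2) by simp
      then show ?thesis by simp
    qed
    then have "(\<Sum>A\<in>?U. \<Sum>\<phi>\<in>irr_upto n. real (degree \<phi>) * real (poly_multiplicity \<phi> (char_poly A))) = (\<Sum>A\<in>?U. real n)"
      by (intro sum.cong refl) simp
    then show ?thesis by simp
  qed
  also have "\<dots> = (\<Sum>\<phi>\<in>irr_upto n. real (degree \<phi>) * (\<Sum>A\<in>?U. real (poly_multiplicity \<phi> (char_poly A))))"
    by (subst sum.swap) (simp add: sum_distrib_left)
  also have "\<dots> = (\<Sum>\<phi>\<in>irr_upto n. real (card ?U) * (real (degree \<phi>) * expected_mult n \<phi>))"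
    by (rule sum.cong[OF refl]) (simp add: sum_multiplicity)
  also have "\<dots> = real (card ?U) * (\<Sum>\<phi>\<in>irr_upto n. real (degree \<phi>) * expected_mult n \<phi>)"
    by (simp only: sum_distrib_left)
  finally have "real n = (\<Sum>\<phi>\<in>irr_upto n. real (degree \<phi>) * expected_mult n \<phi>)"
    using card_unitary_pos[of n] by simp
  also have "\<dots> = (\<Sum>\<phi>\<in>irr_dual n. real (degree \<phi>) * expected_mult n \<phi>)"
    by (rule sum.mono_neutral_right[OF finite_irr_upto irr_dual_subset]) (simp add: expected_mult_outside)
  finally show ?thesis by simp
qed

text \<open>The index set of \<open>num_irred_factors\<close> depends on \<open>A\<close>. Enlarging
  it to \<open>irr_upto n\<close>, where the new multiplicities are 0, allows the sums to be
  exchanged.\<close>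

lemma expectation_num_irred_factors:
  "measure_pmf.expectation (pmf_of_set (unitary_group n q :: 'a mat set)) (\<lambda>A. real (num_irred_factors A))
    = (\<Sum>\<phi>\<in>irr_dual n. expected_mult n \<phi>)"
proof -
  let ?U = "unitary_group n q :: 'a mat set"
  have num: "real (num_irred_factors A) = (\<Sum>\<phi>\<in>irr_upto n. real (poly_multiplicity \<phi> (char_poly A)))" if "A \<in> ?U" for A
  proof -
    have c: "char_poly A \<noteq> 0" "degree (char_poly A) = n"
      using degree_monic_char_poly[OF unitary_carrier[OF that]] by auto
    have "{\<phi>. monic \<phi> \<and> irreducible \<phi> \<and> \<phi> dvd char_poly A} \<subseteq> irr_upto n"
      using dvd_imp_degree_le[OF _ c(1)] c(2) by (auto simp: irr_upto_def)
    moreover have "poly_multiplicity \<phi> (char_poly A) = 0"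
      if \<phi>: "\<phi> \<in> irr_upto n - {\<phi>. monic \<phi> \<and> irreducible \<phi> \<and> \<phi> dvd char_poly A}" for \<phi>
    proof -
      have nd: "\<not> \<phi> dvd char_poly A" "degree \<phi> > 0"
        using \<phi> degree_irreducible_pos by (auto simp: irr_upto_def)
      have "\<not> \<phi> ^ k dvd char_poly A" if "k \<in> {1..n}" for k
      proof
        assume "\<phi> ^ k dvd char_poly A"
        moreover have "\<phi> dvd \<phi> ^ k" using that by (intro dvd_power) auto
        ultimately show False using nd(1) dvd_trans by blast
      qed
      then have "{k \<in> {1..n}. \<phi> ^ k dvd char_poly A} = {}" by blast
      then show ?thesis using poly_multiplicity_eq_card[OF c(1) nd(2), of n] c(2) by (simp only: card.empty order_refl)
    qed
    ultimately have "num_irred_factors A = (\<Sum>\<phi>\<in>irr_upto n. poly_multiplicity \<phi> (char_poly A))"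
      unfolding num_irred_factors_def by (intro sum.mono_neutral_left finite_irr_upto) auto
    then show ?thesis by simp
  qed
  have "measure_pmf.expectation (pmf_of_set ?U) (\<lambda>A. real (num_irred_factors A))
    = (\<Sum>A\<in>?U. real (num_irred_factors A)) / real (card ?U)"
    by (rule integral_pmf_of_set[OF unitary_nonempty unitary_finite])
  also have "(\<Sum>A\<in>?U. real (num_irred_factors A)) = (\<Sum>A\<in>?U. \<Sum>\<phi>\<in>irr_upto n. real (poly_multiplicity \<phi> (char_poly A)))"
    by (intro sum.cong refl num)
  also have "\<dots> = (\<Sum>\<phi>\<in>irr_upto n. \<Sum>A\<in>?U. real (poly_multiplicity \<phi> (char_poly A)))" by (rule sum.swap)
  also have "\<dots> = real (card ?U) * (\<Sum>\<phi>\<in>irr_upto n. expected_mult n \<phi>)"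
    unfolding sum_distrib_left by (intro sum.cong refl) (simp add: sum_multiplicity)
  also have "(\<Sum>\<phi>\<in>irr_upto n. expected_mult n \<phi>) = (\<Sum>\<phi>\<in>irr_dual n. expected_mult n \<phi>)"
    by (rule sum.mono_neutral_right[OF finite_irr_upto irr_dual_subset]) (simp add: expected_mult_outside)
  finally show ?thesis using card_unitary_pos[of n] by simp
qed

text \<open>The gaps \<delta> are nonnegative, and their degree-weighted sum is at most
  \<open>(n + 1) + 10 * 6 - n = 61\<close>. As all degrees are at least 1, the plain sum of the gaps
  is at most 61 too, and the plain sum of \<open>10 * wt \<phi> ^ 2\<close> lies between 0 and 60.
  Nonnegativity of the degree-weighted sum gives the second claim.\<close>

lemma expected_mult_deficit:
  defines "\<delta> n \<phi> \<equiv> wt \<phi> + 10 * wt \<phi> ^ 2 - expected_mult n \<phi>"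
  shows "\<bar>(\<Sum>\<phi>\<in>irr_dual n. expected_mult n \<phi>) - (\<Sum>\<phi>\<in>irr_dual n. wt \<phi>)\<bar> \<le> 61"
    and "(\<Sum>\<phi>\<in>irr_dual n. real (degree \<phi>) * wt \<phi>) \<ge> real n - 60"
proof -
  let ?I = "irr_dual n"
  have \<delta>: "0 \<le> \<delta> n \<phi>" "1 \<le> real (degree \<phi>)" if "\<phi> \<in> ?I" for \<phi>
    using expected_mult_bound[of \<phi> n] degree_irreducible_pos[of \<phi>] that
    by (auto simp: irr_dual_def \<delta>_def Suc_le_eq)
  have split: "(\<Sum>\<phi>\<in>?I. real (degree \<phi>) * \<delta> n \<phi>) = (\<Sum>\<phi>\<in>?I. real (degree \<phi>) * wt \<phi>)
    + 10 * (\<Sum>\<phi>\<in>?I. real (degree \<phi>) * wt \<phi> ^ 2) - real n"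
    unfolding \<delta>_def sum_degree_expected_mult[of n, symmetric]
    by (simp add: sum_distrib_left sum.distrib sum_subtractf algebra_simps)
  have "0 \<le> (\<Sum>\<phi>\<in>?I. real (degree \<phi>) * \<delta> n \<phi>)" using \<delta>(1) by (intro sum_nonneg) auto
  then show "(\<Sum>\<phi>\<in>?I. real (degree \<phi>) * wt \<phi>) \<ge> real n - 60"
    using split sum_degree_wt_sq[of n] by linarith
  have "(\<Sum>\<phi>\<in>?I. \<delta> n \<phi>) \<le> (\<Sum>\<phi>\<in>?I. real (degree \<phi>) * \<delta> n \<phi>)"
  proof (rule sum_mono)
    fix \<phi> assume "\<phi> \<in> ?I"
    from mult_right_mono[OF \<delta>(2)[OF this] \<delta>(1)[OF this]] show "\<delta> n \<phi> \<le> real (degree \<phi>) * \<delta> n \<phi>" by simp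
  qed
  also have "\<dots> \<le> 61" using split sum_degree_wt_sq[of n] sum_degree_wt_le[of n] by linarith
  finally have 1: "(\<Sum>\<phi>\<in>?I. \<delta> n \<phi>) \<le> 61" .
  have 2: "0 \<le> (\<Sum>\<phi>\<in>?I. \<delta> n \<phi>)" using \<delta>(1) by (intro sum_nonneg) auto
  have "(\<Sum>\<phi>\<in>?I. wt \<phi> ^ 2) \<le> (\<Sum>\<phi>\<in>?I. real (degree \<phi>) * wt \<phi> ^ 2)"
  proof (rule sum_mono)
    fix \<phi> assume "\<phi> \<in> ?I"
    from mult_right_mono[OF \<delta>(2)[OF this], of "wt \<phi> ^ 2"] show "wt \<phi> ^ 2 \<le> real (degree \<phi>) * wt \<phi> ^ 2" by simp
  qed
  then have 3: "(\<Sum>\<phi>\<in>?I. wt \<phi> ^ 2) \<le> 6" using sum_degree_wt_sq[of n] by linarith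
  have 4: "0 \<le> (\<Sum>\<phi>\<in>?I. wt \<phi> ^ 2)" by (intro sum_nonneg) auto
  have "(\<Sum>\<phi>\<in>?I. \<delta> n \<phi>) = (\<Sum>\<phi>\<in>?I. wt \<phi>) + 10 * (\<Sum>\<phi>\<in>?I. wt \<phi> ^ 2) - (\<Sum>\<phi>\<in>?I. expected_mult n \<phi>)"
    unfolding \<delta>_def by (simp add: sum_distrib_left sum.distrib sum_subtractf)
  then show "\<bar>(\<Sum>\<phi>\<in>?I. expected_mult n \<phi>) - (\<Sum>\<phi>\<in>?I. wt \<phi>)\<bar> \<le> 61"
    using 1 2 3 4 by linarith
qed

text \<open>Subtract the paired part, \<open>n div 2\<close> up to 9, from the total, which lies
  between \<open>n - 60\<close> and \<open>n + 1\<close>; the lower side gives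
  \<open>60 + 9 = 69\<close>.\<close>

lemma sum_self_weight: "\<bar>(\<Sum>d=1..n. self_weight d) - 1 / 2 * real n\<bar> \<le> 69"
proof -
  have "real n / 2 - 1 / 2 \<le> real (n div 2)" "real (n div 2) \<le> real n / 2" by linarith+
  then show ?thesis
    using expected_mult_deficit(2)[of n] sum_degree_wt_le[of n] sum_degree_wt_split[of n]
      sum_paired_weight[of "n div 2"] by linarith
qed

lemma expectation_bound:
  assumes n: "n \<ge> 2"
  shows "\<bar>measure_pmf.expectation (pmf_of_set (unitary_group n q :: 'a mat set)) (\<lambda>A. real (num_irred_factors A))
    - 3 / 2 * ln (real n)\<bar> \<le> 143"
proof -
  have a: "\<bar>(\<Sum>d=1..n. self_weight d / real d) - 1 / 2 * (\<Sum>d=1..n. 1 / real d)\<bar> \<le> 69"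
    by (rule summation_by_parts_bound) (rule sum_self_weight)
  have b: "\<bar>(\<Sum>d=1..n div 2. paired_weight d / real d) - 1 * (\<Sum>d=1..n div 2. 1 / real d)\<bar> \<le> 9"
    by (rule summation_by_parts_bound) (rule sum_paired_weight)
  have h: "\<bar>(\<Sum>d=1..n. 1 / real d) - ln (real n)\<bar> \<le> 1"
    "\<bar>(\<Sum>d=1..n div 2. 1 / real d) - ln (real (n div 2))\<bar> \<le> 1"
    by (rule harmonic_ln_bound, use n in simp)+
  show ?thesis
    \<comment> \<open>The errors are 61 from replacing expectations by weights, 69 and 9 from
      summation by parts, 1/2 and 1 from the harmonic sums, and 2 from \<open>ln (n div 2)\<close>;
      their sum is 142.5.\<close>
    unfolding expectation_num_irred_factors
    using expected_mult_deficit(1)[of n] sum_wt_split[of n] a b h ln_half_bound[OF n] by linarith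
qed

end

theorem theorem22:
  fixes q :: nat
  assumes "primepow q"
    and "CARD('a :: {finite, field}) = q ^ 2"
  shows "(\<lambda>n :: nat.
            measure_pmf.expectation (pmf_of_set (unitary_group n q :: 'a mat set))
              (\<lambda>A. real (num_irred_factors A))
            - 3 / 2 * ln (real n)) \<in> O(\<lambda>_. 1)"
proof -
  interpret unitary_field q "TYPE('a)" by unfold_locales (use assms in auto)
  show ?thesis
  proof (rule bigoI[where c = 143])
    show "\<forall>\<^sub>F n in sequentially. norm (measure_pmf.expectation (pmf_of_set (unitary_group n q :: 'a mat set))
        (\<lambda>A. real (num_irred_factors A)) - 3 / 2 * ln (real n)) \<le> 143 * norm (1 :: real)"
      using eventually_ge_at_top[of 2] by eventually_elim (use expectation_bound in simp)
  qed
qed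

end
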